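(* Let $d\ge 1$ be an integer, $0<\alpha\le d$ and $s\ge 0$ be such that $$s<\frac{d}{2(d+1)}\,(d+1-\alpha).$$ Then there exist $f\in H^s(\mathbb{T}^d)$ and $\Gamma\subset\mathbb{T}^d$ such that $\dim_{\mathcal H}\Gamma=\alpha$ and $$\limsup_{t\to 0}\,|e^{it\Delta}f(x)|=\infty\qquad\text{for all }x\in\Gamma.$$ Moreover, when $\alpha=d$, one has $\mathcal{H}^d(\Gamma)>0$.
   Context: $\mathbb{T}=\mathbb{R}/2\pi\mathbb{Z}$. For $f:\mathbb{T}^d\to\mathbb{C}$ and $k\in\mathbb{Z}^d$, $\widehat f(k)=\frac{1}{(2\pi)^d}\int_{\mathbb{T}^d}f(x)e^{-ik\cdot x}\,dx$, and $H^s(\mathbb{T}^d)$ is the Sobolev space with norm $\|f\|_{H^s(\mathbb{T}^d)}=\big(\sum_{k\in\mathbb{Z}^d}(1+|k|^2)^s|\widehat f(k)|^2\big)^{1/2}$. The solution of the periodic linear Schrödinger equation with initial datum $f$ is defined as the pointwise limit of partial Fourier sums over cubes, $$e^{it\Delta}f(x)=\lim_{N\to\infty}S_N(t)f(x),\qquad S_N(t)f(x)=\sum_{k\in\mathbb{Z}^d,\ |k_\ell|\le N,\ \ell=1,\dots,d}\widehat f(k)\,e^{ik\cdot x-i|k|^2t},$$ at each point at which this limit exists (accordingly, the $\limsup$ as $t\to0$ at a point $x$ is taken over those $t$ for which the limit defining $e^{it\Delta}f(x)$ exists). $\mathcal{H}^\beta$ denotes $\beta$-dimensional Hausdorff measure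 and $\dim_{\mathcal H}$ Hausdorff dimension. *)

theory Defs
  imports "HOL-Analysis.Analysis"
begin

section \<open>The torus\<close>

definition period_lattice :: "real set" where
  "period_lattice = range (\<lambda>m::int. 2 * pi * of_int m)"

lemma period_lattice_0: "0 \<in> period_lattice"
  unfolding period_lattice_def by (rule range_eqI[of _ _ 0]) simp

lemma period_lattice_add: "a \<in> period_lattice \<Longrightarrow> b \<in> period_lattice \<Longrightarrow> a + b \<in> period_lattice"
proof -
  assume "a \<in> period_lattice" "b \<in> period_lattice"
  then obtain m n :: int where "a = 2 * pi * of_int m" "b = 2 * pi * of_int n"
    by (auto simp: period_lattice_def)
  then have "a + b = 2 * pi * of_int (m + n)" by (simp add: algebra_simps)
  then show ?thesis unfolding period_lattice_def by blast
qed

lemma period_lattice_uminus: "a \<in> period_lattice \<Longrightarrow> - a \<in> period_lattice"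
proof -
  assume "a \<in> period_lattice"
  then obtain m :: int where "a = 2 * pi * of_int m" by (auto simp: period_lattice_def)
  then have "- a = 2 * pi * of_int (- m)" by simp
  then show ?thesis unfolding period_lattice_def by blast
qed

lemma closed_period_lattice: "closed period_lattice"
proof -
  have "period_lattice = (\<lambda>x. (2 * pi) *\<^sub>R x) ` (\<int> :: real set)"
    by (auto simp: period_lattice_def Ints_def)
  then show ?thesis using closed_scaling[OF closed_Ints[where 'a = real], of "2 * pi"] by simp
qed

definition circle_rel :: "real \<Rightarrow> real \<Rightarrow> bool" where
  "circle_rel x y \<longleftrightarrow> x - y \<in> period_lattice"

quotient_type circle = real / circle_rel
proof (rule equivpI)
  show "reflp circle_rel" by (auto simp: reflp_def circle_rel_def period_lattice_0)
  show "symp circle_rel"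
    using period_lattice_uminus by (fastforce simp: symp_def circle_rel_def)
  show "transp circle_rel"
    using period_lattice_add by (fastforce simp: transp_def circle_rel_def)
qed

lift_definition to_circle :: "real \<Rightarrow> circle" is "\<lambda>x. x" .

lemma infdist_period_lattice_add_le:
  "infdist (x + y) period_lattice \<le> infdist x period_lattice + infdist y period_lattice"
proof -
  have ne: "period_lattice \<noteq> {}" using period_lattice_0 by blast
  obtain a where a: "a \<in> period_lattice" "infdist x period_lattice = dist x a"
    using infdist_attains_inf[OF closed_period_lattice ne] by metis
  obtain b where b: "b \<in> period_lattice" "infdist y period_lattice = dist y b"
    using infdist_attains_inf[OF closed_period_lattice ne] by metis
  have "infdist (x + y) period_lattice \<le> dist (x + y) (a + b)"
    by (intro infdist_le period_lattice_add a b)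
  also have "\<dots> \<le> dist x a + dist y b" by (simp add: dist_real_def)
  finally show ?thesis using a b by simp
qed

lemma infdist_period_lattice_mem: "a \<in> period_lattice \<Longrightarrow> infdist a period_lattice = 0"
  by simp

lemma infdist_period_lattice_uminus:
  "infdist (- x) period_lattice = infdist x period_lattice"
proof -
  have *: "infdist (- x) period_lattice \<le> infdist x period_lattice" for x
  proof -
    have ne: "period_lattice \<noteq> {}" using period_lattice_0 by blast
    obtain a where a: "a \<in> period_lattice" "infdist x period_lattice = dist x a"
      using infdist_attains_inf[OF closed_period_lattice ne] by metis
    have "infdist (- x) period_lattice \<le> dist (- x) (- a)"
      by (intro infdist_le period_lattice_uminus a)
    then show ?thesis using a by (simp add: dist_real_def)
  qed
  from *[of x] *[of "- x"] show ?thesis by simp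
qed

instantiation circle :: metric_space
begin

text \<open>The quotient metric: the distance from \<open>x - y\<close> to the lattice of periods.\<close>

lift_definition dist_circle :: "circle \<Rightarrow> circle \<Rightarrow> real"
  is "\<lambda>x y. infdist (x - y) period_lattice"
proof -
  have le: "infdist u period_lattice \<le> infdist v period_lattice"
    if "u - v \<in> period_lattice" for u v :: real
    using infdist_period_lattice_add_le[of v "u - v"] infdist_period_lattice_mem[OF that] by simp
  fix x x' y y' :: real
  assume "circle_rel x x'" "circle_rel y y'"
  then have *: "(x - y) - (x' - y') \<in> period_lattice"
    using period_lattice_add[OF _ period_lattice_uminus, of "x - x'" "y - y'"]
    by (simp add: circle_rel_def algebra_simps)
  have "(x' - y') - (x - y) \<in> period_lattice"
    using period_lattice_uminus[OF *] by (simp add: algebra_simps)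
  with * show "infdist (x - y) period_lattice = infdist (x' - y') period_lattice"
    using le by (meson antisym)
qed

definition uniformity_circle :: "(circle \<times> circle) filter" where
  "uniformity_circle = (INF e\<in>{0 <..}. principal {(x, y). dist x y < e})"

definition open_circle :: "circle set \<Rightarrow> bool" where
  "open_circle U \<longleftrightarrow> (\<forall>x\<in>U. eventually (\<lambda>(x', y). x' = x \<longrightarrow> y \<in> U) uniformity)"

instance
proof
  show "dist x y = 0 \<longleftrightarrow> x = y" for x y :: circle
  proof transfer
    fix x y :: real
    show "infdist (x - y) period_lattice = 0 \<longleftrightarrow> circle_rel x y"
      unfolding circle_rel_def
      using in_closed_iff_infdist_zero[OF closed_period_lattice] period_lattice_0 by blast
  qed
  show "dist x y \<le> dist x z + dist y z" for x y z :: circle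
  proof transfer
    fix x y z :: real
    show "infdist (x - y) period_lattice
        \<le> infdist (x - z) period_lattice + infdist (y - z) period_lattice"
      using infdist_period_lattice_add_le[of "x - z" "z - y"]
        infdist_period_lattice_uminus[of "y - z"] by simp
  qed
qed (simp_all add: uniformity_circle_def open_circle_def)

end

text \<open>The \<open>d\<close>-dimensional torus is \<open>circle ^ 'd\<close>; the instance of \<open>metric_space\<close> for vectors
  makes its distance the flat one.\<close>

definition to_torus :: "real ^ 'd \<Rightarrow> circle ^ 'd" where
  "to_torus x = (\<chi> i. to_circle (x $ i))"

section \<open>Fourier coefficients and Sobolev spaces\<close>

lift_definition circle_char :: "int \<Rightarrow> circle \<Rightarrow> complex" is "\<lambda>k x. cis (of_int k * x)"
proof -
  fix k :: int and x y :: real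
  assume "circle_rel x y"
  then obtain m :: int where "x = y + 2 * pi * of_int m"
    by (auto simp: circle_rel_def period_lattice_def algebra_simps)
  then have "of_int k * x = of_int k * y + 2 * pi * of_int (k * m)"
    by (simp add: algebra_simps)
  then show "cis (of_int k * x) = cis (of_int k * y)"
    by (simp only: cis_mult[symmetric] cis_multiple_2pi Ints_of_int) simp
qed

definition torus_char :: "int ^ 'd \<Rightarrow> circle ^ 'd \<Rightarrow> complex" where
  "torus_char k x = (\<Prod>i\<in>UNIV. circle_char (k $ i) (x $ i))"

lemma torus_char_to_torus:
  "torus_char k (to_torus x) = cis (\<Sum>i\<in>UNIV. of_int (k $ i) * x $ i)"
proof -
  have [simp]: "circle_char m (to_circle a) = cis (of_int m * a)" for m a
    by transfer simp
  have "(\<Prod>i\<in>A. cis (g i)) = cis (\<Sum>i\<in>A. g i)" if "finite A" for A and g :: "'a \<Rightarrow> real"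
    using that by (induction A) (simp_all add: cis_mult)
  then show ?thesis by (simp add: torus_char_def to_torus_def)
qed

definition freq_norm_sq :: "int ^ 'd \<Rightarrow> real" where
  "freq_norm_sq k = (\<Sum>i\<in>UNIV. (of_int (k $ i))\<^sup>2)"

definition period_cube :: "(real ^ 'd) set" where
  "period_cube = cbox 0 (\<chi> i. 2 * pi)"

definition fourier_coeff :: "(circle ^ 'd \<Rightarrow> complex) \<Rightarrow> int ^ 'd \<Rightarrow> complex" where
  "fourier_coeff f k =
     (LINT x:period_cube|lebesgue. f (to_torus x) * torus_char (- k) (to_torus x))
       / (2 * of_real pi) ^ CARD('d)"

definition torus_L2 :: "(circle ^ 'd \<Rightarrow> complex) set" where
  "torus_L2 = {f. set_borel_measurable lebesgue period_cube (\<lambda>x. f (to_torus x)) \<and>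
                  set_integrable lebesgue period_cube (\<lambda>x. (cmod (f (to_torus x)))\<^sup>2)}"

text \<open>This describes the Sobolev space for \<open>s \<ge> 0\<close> only, where it consists of
  square-integrable functions.\<close>

definition sobolev :: "real \<Rightarrow> (circle ^ 'd \<Rightarrow> complex) set" where
  "sobolev s = {f \<in> torus_L2.
     (\<lambda>k. (1 + freq_norm_sq k) powr s * (cmod (fourier_coeff f k))\<^sup>2) summable_on UNIV}"

section \<open>The linear Schroedinger evolution\<close>

definition freq_cube :: "nat \<Rightarrow> (int ^ 'd) set" where
  "freq_cube N = {k. \<forall>i. \<bar>k $ i\<bar> \<le> int N}"

lemma finite_freq_cube: "finite (freq_cube N :: (int ^ 'd) set)"
proof (rule finite_imageD)
  show "inj_on vec_nth (freq_cube N :: (int ^ 'd) set)"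
    by (auto simp: inj_on_def vec_eq_iff)
  have "vec_nth ` (freq_cube N :: (int ^ 'd) set) \<subseteq> Pi\<^sub>E UNIV (\<lambda>_. {- int N..int N})"
    by (auto simp: freq_cube_def abs_le_iff)
      (metis minus_le_iff)
  then show "finite (vec_nth ` (freq_cube N :: (int ^ 'd) set))"
    by (rule finite_subset) (simp add: finite_PiE)
qed

definition schroedinger_partial ::
  "nat \<Rightarrow> real \<Rightarrow> (circle ^ 'd \<Rightarrow> complex) \<Rightarrow> circle ^ 'd \<Rightarrow> complex" where
  "schroedinger_partial N t f x =
     (\<Sum>k\<in>freq_cube N. fourier_coeff f k * torus_char k x * cis (- (freq_norm_sq k * t)))"

definition schroedinger_times :: "(circle ^ 'd \<Rightarrow> complex) \<Rightarrow> circle ^ 'd \<Rightarrow> real set" where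
  "schroedinger_times f x = {t. convergent (\<lambda>N. schroedinger_partial N t f x)}"

definition schroedinger ::
  "real \<Rightarrow> (circle ^ 'd \<Rightarrow> complex) \<Rightarrow> circle ^ 'd \<Rightarrow> complex" where
  "schroedinger t f x = lim (\<lambda>N. schroedinger_partial N t f x)"

section \<open>Hausdorff measure and dimension\<close>

text \<open>The power \<open>diam(U)^s\<close> with the conventions that it is \<open>0\<close> for the empty set and \<open>1\<close> for
  nonempty sets if \<open>s = 0\<close> (whereas \<open>0 powr 0 = 0\<close>).\<close>

definition diameter_power :: "real \<Rightarrow> 'a::metric_space set \<Rightarrow> ennreal" where
  "diameter_power s U =
     (if U = {} then 0 else if s = 0 then 1 else ennreal (diameter U powr s))"

text \<open>Boundedness of the covering sets is required explicitly because \<open>diameter\<close> carries no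
  information for unbounded sets.\<close>

definition hausdorff_premeasure :: "real \<Rightarrow> real \<Rightarrow> 'a::metric_space set \<Rightarrow> ennreal" where
  "hausdorff_premeasure s \<delta> A =
     (INF U\<in>{U :: nat \<Rightarrow> 'a set. A \<subseteq> (\<Union>i. U i) \<and> (\<forall>i. bounded (U i) \<and> diameter (U i) \<le> \<delta>)}.
        \<Sum>i. diameter_power s (U i))"

definition hausdorff_measure :: "real \<Rightarrow> 'a::metric_space set \<Rightarrow> ennreal" where
  "hausdorff_measure s A = (SUP \<delta>\<in>{0<..}. hausdorff_premeasure s \<delta> A)"

definition hausdorff_dim :: "'a::metric_space set \<Rightarrow> ennreal" where
  "hausdorff_dim A = (INF s\<in>{s. 0 \<le> s \<and> hausdorff_measure s A = 0}. ennreal s)"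

end

theory Submission
  imports Defs
begin

text \<open>
  The datum is a lacunary superposition of Fejer kernels. Write \<open>n\<close> for the dimension. The product
  over the coordinates of Fejer kernels of order \<open>K\<close> has frequencies of size at most \<open>K\<close> and
  \<open>H^s\<close> norm about \<open>K powr (n/2 + s)\<close>. At the time \<open>t = pi/(2q)\<close>, and at points \<open>x\<close> whose
  coordinates are within \<open>c/K\<close> of points \<open>2 pi r/q\<close>, the evolution of each factor is a quadratic
  Gauss sum of modulus at least about \<open>K / sqrt q\<close>. After normalisation in \<open>H^s\<close> the evolved
  block therefore has size about \<open>K powr (n/2 - s) / q powr (n/2)\<close>, which is large if \<open>q\<close> is at
  most a fixed power, less than \<open>1 - 2s/n\<close>, of \<open>K\<close>. The factor \<open>4\<close> in the period \<open>4q\<close> of the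
  phases makes the Gauss sum nonzero for all \<open>q\<close> and all numerators \<open>r\<close>
  (\<open>schroedinger_fejer_lower_bound\<close>).

  Positivity of the Fejer kernel is what makes the lower bound short: the finite Fourier expansion of
  the quadratic phase writes the evolution as a sum of \<open>4q\<close> translates of the kernel with
  coefficients of modulus at most \<open>sqrt (2/(4q))\<close>; one translate is nearly maximal, and the sum of
  all of them is known.

  The blocks must not destroy each other. Earlier blocks are bounded by constants fixed before the
  present scale is chosen. Later blocks are harmless because the phases are quasi-periodic in the
  frequency with period \<open>4q\<close>: if every coordinate of \<open>x\<close> exceeds that of \<open>2 pi r/q\<close>
  by at least \<open>\<rho>\<close> and at most \<open>1/(2q)\<close>, then all partial sums of all blocks are bounded by \<open>4/\<rho>\<close> per coordinate
  (\<open>schroedinger_fejer_sum_bound\<close>). For this reason the resonant points are taken at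
  distance between \<open>\<rho>\<close> and \<open>3 \<rho>\<close>. The same bound yields convergence of the partial sums over cubes
  at these times. Hence the upper limit is infinite at all points that are resonant at
  infinitely many scales (\<open>limsup_infinite\<close>).

  It remains to find a set of such points of dimension \<open>\<alpha>\<close>. By Dirichlet's theorem the points
  \<open>2 pi r/q\<close> with \<open>q\<close> comparable to \<open>m^n\<close> are so evenly spread that every cube contains
  about \<open>m^(n(n+1))\<close> of them with mutual distances at least a constant times \<open>m^-(n+1)\<close>
  (\<open>large_rational_net\<close>). For \<open>\<alpha> < n\<close> this gives a Cantor set with radii
  \<open>\<rho>\<close> about \<open>m powr (-n(n+1)/\<alpha>)\<close>, whose \<open>\<alpha>\<close>-dimensional measure is positive by a
  mass distribution argument (\<open>hausdorff_measure_cantor_set_pos\<close>). For \<open>\<alpha> = n\<close> the balls of radius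
  \<open>\<rho>\<close> about \<open>m^-(n+1)\<close> around the net fill a fixed proportion of the cube, and the upper limit of these
  sets has positive Lebesgue measure. In both cases \<open>K\<close> is about
  \<open>m powr (n(n+1)/\<alpha>)\<close> and \<open>q\<close> is at most \<open>m^n\<close>, so the blocks are large precisely if
  \<open>(n+1)/\<alpha> * (n/2 - s) > n/2\<close>, which is the hypothesis on \<open>s\<close>
  (\<open>admissible_scale_eventually\<close>).
\<close>

section \<open>Fejer weights and Fejer kernels\<close>

definition fejer_weight :: "nat \<Rightarrow> int \<Rightarrow> real" where
  "fejer_weight K k = max 0 (1 - \<bar>real_of_int k\<bar> / real K)"

lemma fejer_weight_nonneg [simp]: "0 \<le> fejer_weight K k"
  by (simp add: fejer_weight_def)

lemma fejer_weight_le_1: "fejer_weight K k \<le> 1"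
  by (simp add: fejer_weight_def)

lemma fejer_weight_0 [simp]: "fejer_weight K 0 = 1"
  by (simp add: fejer_weight_def)

lemma fejer_weight_eq_0: "K > 0 \<Longrightarrow> int K \<le> \<bar>k\<bar> \<Longrightarrow> fejer_weight K k = 0"
  by (simp add: fejer_weight_def divide_simps)

lemma fejer_weight_count:
  assumes "K > 0"
  shows "real K * fejer_weight K k = real (card {L. L < K \<and> \<bar>k\<bar> \<le> int L})"
proof -
  have "{L. L < K \<and> \<bar>k\<bar> \<le> int L} = {nat \<bar>k\<bar>..<K}" by auto
  then have "real (card {L. L < K \<and> \<bar>k\<bar> \<le> int L}) = real (K - nat \<bar>k\<bar>)" by simp
  also have "\<dots> = real K * fejer_weight K k"
  proof (cases "nat \<bar>k\<bar> \<le> K")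
    case True
    then have "real (K - nat \<bar>k\<bar>) = real K - \<bar>real_of_int k\<bar>" by (simp add: of_nat_diff)
    moreover have "\<bar>real_of_int k\<bar> \<le> real K" using True by linarith
    ultimately show ?thesis using assms by (simp add: fejer_weight_def field_simps)
  next
    case False
    then show ?thesis using assms fejer_weight_eq_0[of K k] by simp
  qed
  finally show ?thesis by simp
qed

text \<open>Fejer weights average the sharp cut-offs at \<open>0, ..., K - 1\<close>. Bounds for sharp
  symmetric sums thus carry over to weighted ones, also after a further truncation at \<open>N\<close>.\<close>

lemma fejer_sum_eq_average:
  fixes a :: "int \<Rightarrow> complex"
  assumes "K > 0"
  shows "(\<Sum>k\<in>{-int N..int N}. of_real (fejer_weight K k) * a k)
       = (\<Sum>L<K. \<Sum>k\<in>{-int (min L N)..int (min L N)}. a k) / of_nat K"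
proof -
  have "(\<Sum>L<K. \<Sum>k\<in>{-int (min L N)..int (min L N)}. a k)
      = (\<Sum>L<K. \<Sum>k\<in>{-int N..int N}. if \<bar>k\<bar> \<le> int L then a k else 0)"
  proof (rule sum.cong[OF refl])
    fix L
    have eq: "{-int (min L N)..int (min L N)} = {k\<in>{-int N..int N}. \<bar>k\<bar> \<le> int L}"
      by auto
    show "(\<Sum>k\<in>{-int (min L N)..int (min L N)}. a k)
        = (\<Sum>k\<in>{-int N..int N}. if \<bar>k\<bar> \<le> int L then a k else 0)"
      unfolding eq by (rule sum.inter_filter) simp
  qed
  also have "\<dots> = (\<Sum>k\<in>{-int N..int N}. \<Sum>L<K. if \<bar>k\<bar> \<le> int L then a k else 0)"
    by (rule sum.swap)
  also have "\<dots> = (\<Sum>k\<in>{-int N..int N}. of_nat K * (of_real (fejer_weight K k) * a k))"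
  proof (rule sum.cong[OF refl])
    fix k
    have eq: "{L \<in> {..<K}. \<bar>k\<bar> \<le> int L} = {L. L < K \<and> \<bar>k\<bar> \<le> int L}" by auto
    have "(\<Sum>L<K. if \<bar>k\<bar> \<le> int L then a k else 0) = (\<Sum>L\<in>{L \<in> {..<K}. \<bar>k\<bar> \<le> int L}. a k)"
      by (rule sum.inter_filter[symmetric]) simp
    also have "\<dots> = of_real (real (card {L. L < K \<and> \<bar>k\<bar> \<le> int L})) * a k"
      unfolding eq by simp
    also have "\<dots> = of_nat K * (of_real (fejer_weight K k) * a k)"
      by (simp flip: fejer_weight_count[OF assms])
    finally show "(\<Sum>L<K. if \<bar>k\<bar> \<le> int L then a k else 0)
        = of_nat K * (of_real (fejer_weight K k) * a k)" .
  qed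
  also have "\<dots> = of_nat K * (\<Sum>k\<in>{-int N..int N}. of_real (fejer_weight K k) * a k)"
    by (simp add: sum_distrib_left)
  finally show ?thesis using assms by (simp add: field_simps)
qed

lemma symmetric_sum_Suc:
  fixes a :: "int \<Rightarrow> 'a::ab_group_add"
  shows "(\<Sum>k\<in>{-int (Suc K)..int (Suc K)}. a k)
       = a (- int (Suc K)) + a (int (Suc K)) + (\<Sum>k\<in>{-int K..int K}. a k)"
proof -
  have "{-int (Suc K)..int (Suc K)} = insert (- int (Suc K)) (insert (int (Suc K)) {-int K..int K})"
    by auto
  then show ?thesis by simp
qed

lemma symmetric_sum_eq:
  fixes a :: "int \<Rightarrow> 'a::ab_group_add"
  shows "(\<Sum>k\<in>{-int K..int K}. a k) = a 0 + (\<Sum>j<K. a (int K - int j) + a (int j - int K))"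
proof -
  have "(\<Sum>k\<in>{-int K..int K}. a k) = a 0 + (\<Sum>j<K. a (int (Suc j)) + a (- int (Suc j)))"
  proof (induction K)
    case 0 show ?case by simp
  next
    case (Suc K) then show ?case by (subst symmetric_sum_Suc) (simp add: algebra_simps)
  qed
  also have "(\<Sum>j<K. a (int (Suc j)) + a (- int (Suc j)))
      = (\<Sum>j<K. a (int (Suc (K - Suc j))) + a (- int (Suc (K - Suc j))))"
    by (rule sum.nat_diff_reindex[symmetric])
  also have "\<dots> = (\<Sum>j<K. a (int K - int j) + a (int j - int K))"
    by (intro sum.cong refl) (auto simp: of_nat_diff)
  finally show ?thesis .
qed

text \<open>The pairs \<open>(k, l)\<close> below \<open>K\<close> with a given difference \<open>m\<close> number \<open>K - |m|\<close>. This
  form exhibits the kernel as the square of the modulus of an exponential sum.\<close>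

lemma fejer_sum_eq_double_sum:
  fixes a :: "int \<Rightarrow> complex"
  assumes "K > 0" "K \<le> N"
  shows "(\<Sum>k\<in>{-int N..int N}. of_real (fejer_weight K k) * a k)
       = (\<Sum>k<K. \<Sum>l<K. a (int k - int l)) / of_nat K"
proof -
  have min: "min L N = L" if "L < K" for L using that assms by simp
  have "(\<Sum>L<K. \<Sum>k\<in>{-int L..int L}. a k) = (\<Sum>k<K. \<Sum>l<K. a (int k - int l))"
  proof (induction K)
    case 0 show ?case by simp
  next
    case (Suc K)
    have "(\<Sum>k<Suc K. \<Sum>l<Suc K. a (int k - int l))
        = (\<Sum>k<K. \<Sum>l<K. a (int k - int l)) + (\<Sum>k<K. a (int k - int K))
          + ((\<Sum>l<K. a (int K - int l)) + a 0)"
      by (simp add: sum.distrib)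
    also have "\<dots> = (\<Sum>k<K. \<Sum>l<K. a (int k - int l)) + (\<Sum>k\<in>{-int K..int K}. a k)"
      by (simp add: symmetric_sum_eq[of a K] sum.distrib)
    finally show ?case using Suc by simp
  qed
  then show ?thesis
    by (simp add: fejer_sum_eq_average[OF assms(1)] min cong: sum.cong_simp)
qed

definition fejer_kernel :: "nat \<Rightarrow> real \<Rightarrow> real" where
  "fejer_kernel K \<theta> = (cmod (\<Sum>k<K. cis (of_nat k * \<theta>)))\<^sup>2 / real K"

lemma fejer_kernel_nonneg: "0 \<le> fejer_kernel K \<theta>"
  by (simp add: fejer_kernel_def)

lemma double_cis_sum:
  "(\<Sum>k<K. \<Sum>l<K. cis (of_int (int k - int l) * \<theta>))
     = of_real ((cmod (\<Sum>k<K. cis (of_nat k * \<theta>)))\<^sup>2)"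
proof -
  have "of_real ((cmod (\<Sum>k<K. cis (of_nat k * \<theta>)))\<^sup>2)
     = (\<Sum>k<K. cis (of_nat k * \<theta>)) * cnj (\<Sum>k<K. cis (of_nat k * \<theta>))"
    by (rule complex_norm_square)
  also have "\<dots> = (\<Sum>k<K. \<Sum>l<K. cis (of_nat k * \<theta>) * cis (- (of_nat l * \<theta>)))"
    by (simp add: sum_product cnj_sum cis_cnj)
  also have "\<dots> = (\<Sum>k<K. \<Sum>l<K. cis (of_int (int k - int l) * \<theta>))"
    by (intro sum.cong refl) (simp add: cis_mult algebra_simps)
  finally show ?thesis by simp
qed

lemma fejer_kernel_eq_sum:
  assumes "K > 0" "K \<le> N"
  shows "(\<Sum>k\<in>{-int N..int N}. of_real (fejer_weight K k) * cis (of_int k * \<theta>))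
       = of_real (fejer_kernel K \<theta>)"
  using double_cis_sum[of \<theta> K] by (simp add: fejer_sum_eq_double_sum[OF assms] fejer_kernel_def)

lemma fejer_kernel_le:
  assumes "K > 0"
  shows "fejer_kernel K \<theta> \<le> real K"
proof -
  have "cmod (\<Sum>k<K. cis (of_nat k * \<theta>)) \<le> (\<Sum>k<K. 1)"
    by (rule sum_norm_le) simp
  then have "(cmod (\<Sum>k<K. cis (of_nat k * \<theta>)))\<^sup>2 \<le> (real K)\<^sup>2"
    by (intro power_mono) auto
  then show ?thesis using assms by (simp add: fejer_kernel_def power2_eq_square field_simps)
qed

text \<open>For \<open>k < K\<close> all phases \<open>k \<theta>\<close> are at most \<open>1/4\<close>, so there is hardly any cancellation.\<close>

lemma fejer_kernel_ge:
  assumes "K > 0" "\<bar>\<theta>\<bar> \<le> 1 / (4 * real K)"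
  shows "9 / 10 * real K \<le> fejer_kernel K \<theta>"
proof -
  \<comment> \<open>From \<open>cos u \<ge> 1 - u^2/2\<close> with \<open>u \<le> 1/4\<close>.\<close>
  have c: "31/32 \<le> cos (of_nat k * \<theta>)" if "k < K" for k
  proof -
    have "\<bar>of_nat k * \<theta>\<bar> \<le> real K * (1 / (4 * real K))"
      unfolding abs_mult using that assms by (intro mult_mono) auto
    also have "\<dots> = 1/4" using assms by simp
    finally have "(of_nat k * \<theta>)\<^sup>2 \<le> (1/4)\<^sup>2" by (metis abs_le_square_iff abs_of_nonneg zero_le_divide_1_iff zero_le_numeral)
    moreover have "1 - (of_nat k * \<theta>)\<^sup>2 / 2 \<le> cos (of_nat k * \<theta>)"
    proof -
      have "cos (of_nat k * \<theta>) = 1 - 2 * (sin (of_nat k * \<theta> / 2))\<^sup>2"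
        using cos_double_sin[of "of_nat k * \<theta> / 2"] by simp
      moreover have "(sin (of_nat k * \<theta> / 2))\<^sup>2 \<le> (of_nat k * \<theta> / 2)\<^sup>2"
        using abs_sin_x_le_abs_x[of "of_nat k * \<theta> / 2"] abs_le_square_iff by blast
      ultimately show ?thesis by (simp add: power2_eq_square)
    qed
    ultimately show ?thesis by (simp add: power2_eq_square)
  qed
  have "31/32 * real K = (\<Sum>k<K. 31/32)" by simp
  also have "\<dots> \<le> (\<Sum>k<K. cos (of_nat k * \<theta>))" by (intro sum_mono c) simp
  also have "\<dots> = Re (\<Sum>k<K. cis (of_nat k * \<theta>))" by simp
  also have "\<dots> \<le> cmod (\<Sum>k<K. cis (of_nat k * \<theta>))" by (rule complex_Re_le_cmod)
  finally have "(31/32 * real K)\<^sup>2 \<le> (cmod (\<Sum>k<K. cis (of_nat k * \<theta>)))\<^sup>2"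
    by (intro power_mono) auto
  moreover have "9/10 * real K * real K \<le> (31/32 * real K)\<^sup>2"
    by (simp add: power2_eq_square)
  ultimately show ?thesis using assms by (simp add: fejer_kernel_def field_simps)
qed

section \<open>Quadratic Gauss sums\<close>

text \<open>The additive character of the integers modulo \<open>n\<close>.\<close>

definition unity_root :: "nat \<Rightarrow> int \<Rightarrow> complex" where
  "unity_root n j = cis (2 * pi * of_int j / real n)"

lemma unity_root_add: "unity_root n (i + j) = unity_root n i * unity_root n j"
  by (simp add: unity_root_def cis_mult add_divide_distrib distrib_left)

lemma unity_root_0 [simp]: "unity_root n 0 = 1"
  by (simp add: unity_root_def)

lemma cnj_unity_root: "cnj (unity_root n i) = unity_root n (- i)"
  by (simp add: unity_root_def cis_cnj)

lemma unity_root_pow: "unity_root n (int m * j) = unity_root n j ^ m"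
  by (simp add: unity_root_def Complex.DeMoivre mult_ac)

lemma unity_root_multiple: "n > 0 \<Longrightarrow> unity_root n (int n * j) = 1"
  using cis_multiple_2pi[of "of_int j"] by (simp add: unity_root_def mult.assoc)

lemma unity_root_cong:
  assumes "n > 0" "int n dvd i - j"
  shows "unity_root n i = unity_root n j"
proof -
  obtain c where "i = int n * c + j" using assms(2) by (metis dvdE diff_add_cancel)
  then show ?thesis using assms(1) by (simp add: unity_root_add unity_root_multiple)
qed

lemma unity_root_eq_1_iff:
  assumes "n > 0"
  shows "unity_root n j = 1 \<longleftrightarrow> int n dvd j"
proof
  assume "unity_root n j = 1"
  then have "cos (2 * pi * of_int j / real n) = 1"
    unfolding unity_root_def by (metis cis.simps(1) one_complex.simps(1))
  then obtain c :: int where "2 * pi * of_int j / real n = of_int c * 2 * pi"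
    using cos_one_2pi_int by blast
  then have "real_of_int j = real_of_int (int n * c)" using assms by (simp add: field_simps)
  then have "j = int n * c" by linarith
  then show "int n dvd j" by simp
next
  assume "int n dvd j"
  then show "unity_root n j = 1" using assms unity_root_multiple by (metis dvdE)
qed

lemma sum_unity_roots:
  assumes "n > 0"
  shows "(\<Sum>m<n. unity_root n (int m * j)) = (if int n dvd j then of_nat n else 0)"
proof (cases "int n dvd j")
  case True
  then have "unity_root n (int m * j) = 1" for m
    using assms by (simp add: unity_root_eq_1_iff)
  then show ?thesis using True by simp
next
  case False
  then have ne: "unity_root n j \<noteq> 1" using unity_root_eq_1_iff[OF assms] by blast
  have "(\<Sum>m<n. unity_root n (int m * j)) = (\<Sum>m<n. unity_root n j ^ m)"
    by (simp add: unity_root_pow)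
  also have "\<dots> = (unity_root n j ^ n - 1) / (unity_root n j - 1)"
    by (rule geometric_sum[OF ne])
  also have "unity_root n j ^ n = 1" using assms by (simp add: unity_root_multiple flip: unity_root_pow)
  finally show ?thesis using False by simp
qed

lemma periodic_sum_shift:
  fixes g :: "int \<Rightarrow> complex"
  assumes "\<And>k. g (k + int n) = g k"
  shows "(\<Sum>h<n. g (int l + int h)) = (\<Sum>h<n. g (int h))"
proof (induction l)
  case 0 show ?case by simp
next
  case (Suc l)
  have "(\<Sum>h<n. g (int (Suc l) + int h)) + g (int l) = (\<Sum>h<Suc n. g (int l + int h))"
    by (subst sum.lessThan_Suc_shift) (simp add: algebra_simps)
  also have "\<dots> = (\<Sum>h<n. g (int l + int h)) + g (int l)" by (simp add: assms)
  finally show ?case using Suc by simp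
qed

text \<open>The Gauss sum of the quadratic polynomial \<open>- (l^2 + l m)\<close> modulo \<open>n\<close>; up to the factor
  \<open>1/n\<close>, these are the finite Fourier coefficients of the quadratic phase.\<close>

definition gauss_sum :: "nat \<Rightarrow> int \<Rightarrow> complex" where
  "gauss_sum n m = (\<Sum>l<n. unity_root n (- ((int l)\<^sup>2 + int l * m)))"

text \<open>Weyl differencing: in the square of the modulus the sum over \<open>l\<close> for a fixed difference
  \<open>h\<close> vanishes unless \<open>4q\<close> divides \<open>2h\<close>. For even \<open>m\<close> the two surviving differences
  reinforce each other.\<close>

lemma gauss_sum_norm:
  assumes "q > 0"
  shows "(cmod (gauss_sum (4 * q) m))\<^sup>2 = (if even m then 8 * real q else 0)"
proof -
  define n where "n = 4 * q"
  have n: "n > 0" using assms by (simp add: n_def)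
  define \<psi> where "\<psi> l = unity_root n (- (l\<^sup>2 + l * m))" for l
  have per: "\<psi> (k + int n) = \<psi> k" for k
    unfolding \<psi>_def by (rule unity_root_cong[OF n]) (simp add: power2_eq_square algebra_simps)
  have mult: "\<psi> (int l + int h) * cnj (\<psi> (int l)) = \<psi> (int h) * unity_root n (int l * (- 2 * int h))" for l h
    by (simp add: \<psi>_def cnj_unity_root power2_eq_square algebra_simps flip: unity_root_add)
  have "of_real ((cmod (gauss_sum n m))\<^sup>2) = gauss_sum n m * cnj (gauss_sum n m)"
    by (rule complex_norm_square)
  also have "\<dots> = (\<Sum>l'<n. \<psi> (int l')) * (\<Sum>l<n. cnj (\<psi> (int l)))"
    by (simp add: gauss_sum_def \<psi>_def cnj_sum)
  also have "\<dots> = (\<Sum>l<n. (\<Sum>h<n. \<psi> (int l + int h)) * cnj (\<psi> (int l)))"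
    by (simp add: periodic_sum_shift[of \<psi>, OF per] sum_distrib_left)
  also have "\<dots> = (\<Sum>l<n. \<Sum>h<n. \<psi> (int h) * unity_root n (int l * (- 2 * int h)))"
    by (simp only: sum_distrib_right mult)
  also have "\<dots> = (\<Sum>h<n. \<Sum>l<n. \<psi> (int h) * unity_root n (int l * (- 2 * int h)))"
    by (rule sum.swap)
  also have "\<dots> = (\<Sum>h<n. \<psi> (int h) * (if int n dvd - 2 * int h then of_nat n else 0))"
    by (simp only: sum_distrib_left[symmetric] sum_unity_roots[OF n])
  \<comment> \<open>\<open>4q\<close> divides \<open>2h\<close> only for \<open>h = 0\<close> and \<open>h = 2q\<close>.\<close>
  also have "\<dots> = (\<Sum>h\<in>{0, 2 * q}. \<psi> (int h) * (if int n dvd - 2 * int h then of_nat n else 0))"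
  proof (rule sum.mono_neutral_right)
    show "{0, 2 * q} \<subseteq> {..<n}" using assms by (auto simp: n_def)
    show "\<forall>h\<in>{..<n} - {0, 2 * q}. \<psi> (int h) * (if int n dvd - 2 * int h then of_nat n else 0) = 0"
    proof
      fix h assume h: "h \<in> {..<n} - {0, 2 * q}"
      have "\<not> int n dvd - 2 * int h"
      proof
        assume "int n dvd - 2 * int h"
        then have "int (4 * q) dvd int (2 * h)" by (simp add: n_def)
        then have "4 * q dvd 2 * h" by (simp only: of_nat_dvd_iff)
        then obtain c where "2 * h = 4 * q * c" by (elim dvdE)
        then have c: "h = 2 * q * c" by simp
        have "c < 2" using h c by (simp add: n_def)
        then have "c = 0 \<or> c = 1" by auto
        then show False using c h by auto
      qed
      then show "\<psi> (int h) * (if int n dvd - 2 * int h then of_nat n else 0) = 0" by simp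
    qed
  qed simp
  also have "\<dots> = of_nat n * (1 + \<psi> (2 * int q))"
    using assms by (simp add: n_def \<psi>_def algebra_simps)
  also have "\<psi> (2 * int q) = (if even m then 1 else - 1)"
  proof -
    have "\<psi> (2 * int q) = cis (- (2 * pi * of_int (int q) + pi * of_int m))"
      unfolding \<psi>_def unity_root_def n_def using assms
      by (intro arg_cong[of _ _ cis]) (simp add: field_simps power2_eq_square)
    also have "\<dots> = cis (- (2 * pi * of_int (int q))) * cis (- (pi * of_int m))"
      by (simp add: cis_mult)
    also have "cis (- (2 * pi * of_int (int q))) = 1"
      using cis_multiple_2pi[of "- of_int (int q)"] by simp
    also have "cis (- (pi * of_int m)) = (if even m then 1 else - 1)"
    proof (cases "even m")
      case True
      then obtain c where "m = 2 * c" by (elim evenE)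
      then show ?thesis using cis_multiple_2pi[of "- of_int c"] by (simp add: algebra_simps)
    next
      case False
      then obtain c where c: "m = 2 * c + 1" by (elim oddE)
      have "cis (- (pi * of_int m)) = cis (2 * pi * - of_int c) * cis (- pi)"
        unfolding c by (simp add: cis_mult algebra_simps)
      also have "\<dots> = -1" by (subst cis_multiple_2pi) (auto simp: complex_eq_iff)
      finally show ?thesis using False by simp
    qed
    finally show ?thesis by simp
  qed
  also have "of_nat n * (1 + (if even m then 1 else - 1 :: complex))
      = of_real (if even m then 8 * real q else 0)"
    by (simp add: n_def)
  finally show ?thesis unfolding n_def of_real_eq_iff .
qed

text \<open>Fourier inversion on the integers modulo \<open>n\<close>.\<close>

lemma unity_root_square_expansion:
  assumes "n > 0"
  shows "unity_root n (- k\<^sup>2) = (\<Sum>m<n. gauss_sum n (int m) * unity_root n (int m * k)) / of_nat n"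
proof -
  define l0 where "l0 = nat (k mod int n)"
  have l0: "l0 < n" "int l0 = k mod int n" using assms by (simp_all add: l0_def nat_less_iff)
  have "(\<Sum>m<n. gauss_sum n (int m) * unity_root n (int m * k))
      = (\<Sum>m<n. \<Sum>l<n. unity_root n (- (int l)\<^sup>2) * unity_root n (int m * (k - int l)))"
    unfolding gauss_sum_def sum_distrib_right
    by (intro sum.cong refl) (simp add: algebra_simps flip: unity_root_add)
  also have "\<dots> = (\<Sum>l<n. \<Sum>m<n. unity_root n (- (int l)\<^sup>2) * unity_root n (int m * (k - int l)))"
    by (rule sum.swap)
  also have "\<dots> = (\<Sum>l<n. unity_root n (- (int l)\<^sup>2) * (if int n dvd k - int l then of_nat n else 0))"
    by (simp only: sum_distrib_left[symmetric] sum_unity_roots[OF assms])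
  also have "\<dots> = (\<Sum>l\<in>{l0}. unity_root n (- (int l)\<^sup>2) * (if int n dvd k - int l then of_nat n else 0))"
  proof (rule sum.mono_neutral_right)
    show "\<forall>l\<in>{..<n} - {l0}. unity_root n (- (int l)\<^sup>2) * (if int n dvd k - int l then of_nat n else 0) = 0"
    proof
      fix l assume l: "l \<in> {..<n} - {l0}"
      have "\<not> int n dvd k - int l"
      proof
        assume "int n dvd k - int l"
        then have "k mod int n = int l mod int n" by (simp add: mod_eq_dvd_iff)
        then have "l = l0" using l l0 by simp
        then show False using l by simp
      qed
      then show "unity_root n (- (int l)\<^sup>2) * (if int n dvd k - int l then of_nat n else 0) = 0"
        by simp
    qed
  qed (use l0 in auto)
  also have "\<dots> = of_nat n * unity_root n (- (int l0)\<^sup>2)"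
    using l0 by simp
  also have "unity_root n (- (int l0)\<^sup>2) = unity_root n (- k\<^sup>2)"
  proof (rule unity_root_cong[OF assms])
    have "int n dvd k - int l0" using l0 by simp
    then have "int n dvd (k - int l0) * (k + int l0)" by (rule dvd_mult2)
    then show "int n dvd - (int l0)\<^sup>2 - - k\<^sup>2" by (simp add: power2_eq_square algebra_simps)
  qed
  finally show ?thesis using assms by simp
qed

section \<open>Bounds for evolved Fejer kernels\<close>

lemma card_residue_class_le:
  assumes "n > 0"
  shows "card {l. l < K \<and> int n dvd j - int l} \<le> K div n + 1"
proof -
  have "inj_on (\<lambda>l. l div n) {l. l < K \<and> int n dvd j - int l}"
  proof (rule inj_onI)
    fix l l' assume l: "l \<in> {l. l < K \<and> int n dvd j - int l}" "l' \<in> {l. l < K \<and> int n dvd j - int l}"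
      and div: "l div n = l' div n"
    have "int n dvd (j - int l') - (j - int l)" using l by (intro dvd_diff[of "int n" "j - int l'" "j - int l"]) blast+
    then have "int n dvd int l - int l'" by simp
    then have "int l mod int n = int l' mod int n" by (simp add: mod_eq_dvd_iff)
    then have "l mod n = l' mod n" by (metis of_nat_eq_iff of_nat_mod)
    with div show "l = l'" by (metis div_mult_mod_eq)
  qed
  then have "card {l. l < K \<and> int n dvd j - int l} \<le> card {..K div n}"
    by (rule card_inj_on_le) (auto intro: div_le_mono)
  then show ?thesis by simp
qed

text \<open>Summing over all translates by multiples of \<open>2 pi/n\<close> keeps only the frequencies
  divisible by \<open>n\<close>.\<close>

lemma sum_fejer_kernel_translates_le:
  assumes "n > 0" "K > 0"
  shows "(\<Sum>m<n. fejer_kernel K (2 * pi * of_int (int m + j) / real n + \<eta>)) \<le> real K + real n"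
proof -
  define e where "e k l = cis (of_int (int k - int l) * \<eta>)" for k l
  define b where "b k l = (if int n dvd int k - int l then of_nat n else (0::complex))" for k l
  have split: "cis (of_int i * (2 * pi * of_int (int m + j) / real n + \<eta>))
      = unity_root n (int m * i) * (unity_root n (j * i) * cis (of_int i * \<eta>))" for i m
    unfolding mult.assoc[symmetric] unity_root_add[symmetric] unfolding unity_root_def cis_mult
    using assms by (intro arg_cong[of _ _ cis]) (simp add: field_simps)
  have "of_real (real K * (\<Sum>m<n. fejer_kernel K (2 * pi * of_int (int m + j) / real n + \<eta>)))
      = (\<Sum>m<n. \<Sum>k<K. \<Sum>l<K. cis (of_int (int k - int l) * (2 * pi * of_int (int m + j) / real n + \<eta>)))"
    unfolding double_cis_sum using assms by (simp add: fejer_kernel_def sum_distrib_left)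
  also have "\<dots> = (\<Sum>k<K. \<Sum>l<K. \<Sum>m<n. cis (of_int (int k - int l) * (2 * pi * of_int (int m + j) / real n + \<eta>)))"
    by (subst sum.swap) (intro sum.cong refl sum.swap)
  also have "\<dots> = (\<Sum>k<K. \<Sum>l<K. b k l * (unity_root n (j * (int k - int l)) * e k l))"
    unfolding split sum_distrib_right[symmetric] sum_unity_roots[OF assms(1)] b_def e_def ..
  finally have "cmod (of_real (real K * (\<Sum>m<n. fejer_kernel K (2 * pi * of_int (int m + j) / real n + \<eta>))))
      \<le> (\<Sum>k<K. \<Sum>l<K. cmod (b k l))"
    by (simp only:) (intro order_trans[OF norm_sum] sum_mono, simp add: norm_mult e_def unity_root_def)
  also have "\<dots> \<le> (\<Sum>k<K. real n * (real K / real n + 1))"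
  proof (rule sum_mono)
    fix k
    have "(\<Sum>l<K. cmod (b k l)) = (\<Sum>l<K. if int n dvd int k - int l then real n else 0)"
      by (intro sum.cong refl) (simp add: b_def)
    also have "\<dots> = (\<Sum>l\<in>{l\<in>{..<K}. int n dvd int k - int l}. real n)"
      by (rule sum.inter_filter[symmetric]) simp
    also have "\<dots> = real n * real (card {l. l < K \<and> int n dvd int k - int l})"
      by simp
    also have "\<dots> \<le> real n * real (K div n + 1)"
      using card_residue_class_le[OF assms(1), of K "int k"] by (intro mult_left_mono) linarith+
    also have "\<dots> \<le> real n * (real K / real n + 1)"
      by (intro mult_left_mono) (simp_all add: of_nat_div_le_of_nat)
    finally show "(\<Sum>l<K. cmod (b k l)) \<le> real n * (real K / real n + 1)" .
  qed
  also have "\<dots> = real K * (real K + real n)" using assms by (simp add: field_simps)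
  finally have "real K * (\<Sum>m<n. fejer_kernel K (2 * pi * of_int (int m + j) / real n + \<eta>))
      \<le> real K * (real K + real n)"
    unfolding norm_of_real by linarith
  then show ?thesis using assms by simp
qed

text \<open>With \<open>n = 4q\<close>, the Fourier expansion of the quadratic phase writes the sum as a combination
  of \<open>n\<close> translates of the Fejer kernel, with coefficients of modulus \<open>sqrt (2/n)\<close> or \<open>0\<close>. The
  translate with index \<open>m0\<close> congruent to \<open>-4r\<close> is taken at the small argument \<open>\<eta>\<close>, where the kernel is at least
  \<open>9/10 K\<close>. The translates are nonnegative and sum to at most \<open>K + n\<close>, which is at most \<open>3/2 K\<close>, so
  the remaining ones cannot compensate it.\<close>

lemma schroedinger_fejer_lower_bound:
  fixes q K N :: nat and r :: int and \<eta> x t :: real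
  assumes q: "0 < q" "8 * q \<le> K" and "K \<le> N" and \<eta>: "\<bar>\<eta>\<bar> \<le> 1 / (4 * real K)"
    and x: "x = 2 * pi * of_int r / real q + \<eta>" and t: "t = pi / (2 * real q)"
  shows "real K / (4 * sqrt (2 * real q))
     \<le> cmod (\<Sum>k\<in>{-int N..int N}. of_real (fejer_weight K k) * cis (of_int k * x - (of_int k)\<^sup>2 * t))"
    (is "_ \<le> cmod ?S")
proof -
  define n where "n = 4 * q"
  have n: "n > 0" and K: "K > 0" using q by (simp_all add: n_def)
  define F where "F m = fejer_kernel K (2 * pi * of_int (int m + 4 * r) / real n + \<eta>)" for m
  \<comment> \<open>The index of the dominant translate; it is even, so its Gauss sum does not vanish.\<close>
  define m0 where "m0 = nat ((- 4 * r) mod int n)"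
  have m0: "m0 < n" "int m0 = (- 4 * r) mod int n" using n by (simp_all add: m0_def nat_less_iff)
  have m0_dvd: "int n dvd int m0 + 4 * r"
    using m0(2) by (metis dvd_minus_mod minus_diff_eq dvd_minus_iff diff_minus_eq_add mult_minus_left add.commute)
  then obtain c where c: "int m0 + 4 * r = int n * c" by (elim dvdE)
  have even: "even m0"
  proof -
    have "int m0 = 2 * (2 * int q * c - 2 * r)" using c by (simp add: n_def)
    then show ?thesis by presburger
  qed
  have F_m0: "F m0 = fejer_kernel K \<eta>"
  proof -
    have "cis (of_nat k * (2 * pi * of_int (int m0 + 4 * r) / real n + \<eta>)) = cis (of_nat k * \<eta>)" for k :: nat
    proof -
      have "of_nat k * (2 * pi * of_int (int m0 + 4 * r) / real n + \<eta>)
          = 2 * pi * of_int (int k * c) + of_nat k * \<eta>"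
        unfolding c using n by (simp add: field_simps)
      then show ?thesis by (simp only: cis_mult[symmetric] cis_multiple_2pi Ints_of_int) simp
    qed
    then show ?thesis by (simp add: F_def fejer_kernel_def)
  qed
  have phase: "cis (of_int k * x - (of_int k)\<^sup>2 * t)
      = (\<Sum>m<n. gauss_sum n (int m) * cis (of_int k * (2 * pi * of_int (int m + 4 * r) / real n + \<eta>))) / of_nat n"
    for k
  proof -
    have "cis (of_int k * x - (of_int k)\<^sup>2 * t)
        = unity_root n (- k\<^sup>2) * cis (of_int k * (2 * pi * of_int (4 * r) / real n + \<eta>))"
      unfolding unity_root_def x t n_def cis_mult using q
      by (intro arg_cong[of _ _ cis]) (simp add: field_simps power2_eq_square)
    also have "\<dots> = (\<Sum>m<n. gauss_sum n (int m) * (unity_root n (int m * k) *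
          cis (of_int k * (2 * pi * of_int (4 * r) / real n + \<eta>)))) / of_nat n"
      by (simp add: unity_root_square_expansion[OF n] sum_distrib_right mult.assoc)
    also have "\<dots> = (\<Sum>m<n. gauss_sum n (int m) * cis (of_int k * (2 * pi * of_int (int m + 4 * r) / real n + \<eta>))) / of_nat n"
      unfolding unity_root_def cis_mult using n
      by (intro arg_cong2[of _ _ _ _ "(/)"] sum.cong refl arg_cong2[of _ _ _ _ "(*)"] arg_cong[of _ _ cis])
        (simp add: field_simps)
    finally show ?thesis .
  qed
  have S: "?S = (\<Sum>m<n. gauss_sum n (int m) * of_real (F m)) / of_nat n"
  proof -
    have "?S = (\<Sum>k\<in>{-int N..int N}. \<Sum>m<n. gauss_sum n (int m) * (of_real (fejer_weight K k) *
        cis (of_int k * (2 * pi * of_int (int m + 4 * r) / real n + \<eta>)))) / of_nat n"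
      unfolding phase sum_divide_distrib sum_distrib_left by (intro sum.cong refl) (simp add: mult_ac)
    also have "(\<Sum>k\<in>{-int N..int N}. \<Sum>m<n. gauss_sum n (int m) * (of_real (fejer_weight K k) *
        cis (of_int k * (2 * pi * of_int (int m + 4 * r) / real n + \<eta>))))
      = (\<Sum>m<n. gauss_sum n (int m) * (\<Sum>k\<in>{-int N..int N}. of_real (fejer_weight K k) *
        cis (of_int k * (2 * pi * of_int (int m + 4 * r) / real n + \<eta>))))"
      by (subst sum.swap) (simp add: sum_distrib_left)
    also have "\<dots> = (\<Sum>m<n. gauss_sum n (int m) * of_real (F m))"
      by (simp only: fejer_kernel_eq_sum[OF K \<open>K \<le> N\<close>] F_def)
    finally show ?thesis .
  qed
  define R where "R = (\<Sum>m\<in>{..<n} - {m0}. gauss_sum n (int m) * of_real (F m))"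
  have G: "cmod (gauss_sum n m) = (if even m then sqrt (8 * real q) else 0)" for m
    using gauss_sum_norm[OF q(1), of m] unfolding n_def
    by (metis norm_ge_zero real_sqrt_unique real_sqrt_zero)
  have F_nonneg: "0 \<le> F m" for m by (simp add: F_def fejer_kernel_nonneg)
  have "cmod R \<le> (\<Sum>m\<in>{..<n} - {m0}. sqrt (8 * real q) * F m)"
    unfolding R_def
    by (intro order_trans[OF norm_sum] sum_mono) (simp add: norm_mult G F_nonneg mult_right_mono)
  also have "\<dots> = sqrt (8 * real q) * ((\<Sum>m<n. F m) - F m0)"
    using m0 by (simp add: sum_distrib_left[symmetric] sum_diff1)
  also have "\<dots> \<le> sqrt (8 * real q) * ((real K + real n) - F m0)"
    using sum_fejer_kernel_translates_le[OF n K, of "4 * r" \<eta>]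
    by (intro mult_left_mono) (simp_all add: F_def)
  finally have R: "cmod R \<le> sqrt (8 * real q) * ((real K + real n) - F m0)" .
  have F_ge: "9 / 10 * real K \<le> F m0" unfolding F_m0 by (rule fejer_kernel_ge[OF K \<eta>])
  have "real n * cmod ?S = cmod (gauss_sum n (int m0) * of_real (F m0) + R)"
    unfolding S R_def using n m0 by (simp add: norm_divide sum.remove[of "{..<n}" m0])
  also have "\<dots> \<ge> sqrt (8 * real q) * F m0 - cmod R"
    using norm_diff_ineq[of "gauss_sum n (int m0) * of_real (F m0)" R] even F_nonneg[of m0]
    by (simp add: norm_mult G)
  finally have "sqrt (8 * real q) * F m0 - cmod R \<le> real n * cmod ?S" .
  then have "sqrt (8 * real q) * (2 * F m0 - (real K + real n)) \<le> real n * cmod ?S"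
    using R by (simp add: algebra_simps)
  moreover have "sqrt (8 * real q) * (real K / 4) \<le> sqrt (8 * real q) * (2 * F m0 - (real K + real n))"
    using F_ge q by (intro mult_left_mono) (simp_all add: n_def)
  ultimately have "sqrt (8 * real q) * (real K / 4) \<le> real n * cmod ?S" by linarith
  moreover have "sqrt (8 * real q) = 2 * sqrt (2 * real q)"
    using real_sqrt_mult[of 4 "2 * real q"] by simp
  moreover have "real n = 2 * sqrt (2 * real q) * sqrt (2 * real q)"
    by (simp add: n_def)
  ultimately have "2 * sqrt (2 * real q) * (real K / 4) \<le> 2 * sqrt (2 * real q) * (sqrt (2 * real q) * cmod ?S)"
    by (simp only: mult.assoc)
  moreover have "0 < 2 * sqrt (2 * real q)" using q by simp
  ultimately have "real K / 4 \<le> sqrt (2 * real q) * cmod ?S"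
    by (rule mult_left_le_imp_le)
  then show ?thesis using q by (simp add: field_simps)
qed

lemma half_le_sin:
  fixes y :: real assumes "0 \<le> y" "y \<le> 1" shows "y / 2 \<le> sin y"
proof (cases "y = 0")
  case False
  then have "\<exists>z>0. z < y \<and> sin y - sin 0 = (y - 0) * cos z"
    using assms by (intro MVT2) (auto intro!: derivative_eq_intros)
  then obtain z where z: "0 < z" "z < y" "sin y = y * cos z" by auto
  have "z \<le> pi / 3" using z assms pi_gt3 by linarith
  then have "cos (pi / 3) \<le> cos z" using z pi_gt3 by (intro cos_monotone_0_pi_le) auto
  then have "1 / 2 \<le> cos z" by (simp add: cos_60)
  then have "y * (1 / 2) \<le> y * cos z" using assms by (intro mult_left_mono) auto
  then show ?thesis using z by simp
qed simp

text \<open>Telescoping with step \<open>n\<close>: only \<open>n\<close> terms at either end survive.\<close>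

lemma sum_shift_difference:
  fixes a :: "int \<Rightarrow> complex"
  shows "(\<Sum>k\<in>{-int L..int L}. a k - a (k + int n))
    = (\<Sum>i<n. a (- int L + int i)) - (\<Sum>i<n. a (int L + 1 + int i))"
proof -
  define g where "g k = (\<Sum>i<n. a (k + int i))" for k
  have step: "a k - a (k + int n) = g k - g (k + 1)" for k
  proof -
    have "a k + g (k + 1) = (\<Sum>i<Suc n. a (k + int i))"
      unfolding g_def by (subst sum.lessThan_Suc_shift) (simp add: algebra_simps)
    then show ?thesis by (simp add: g_def algebra_simps)
  qed
  have "(\<Sum>k\<in>{-int L..int L}. a k - a (k + int n)) = (\<Sum>k\<in>{-int L..int L}. g k - g (k + 1))"
    by (simp only: step)
  also have "\<dots> = g (- int L) - g (int L + 1)"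
  proof (induction L)
    case (Suc L) then show ?case by (subst symmetric_sum_Suc) (simp add: algebra_simps)
  qed simp
  finally show ?thesis by (simp add: g_def)
qed

text \<open>The phases satisfy \<open>a (k + n) = z * a k\<close> with \<open>n = 4q\<close> and \<open>z = cis (n \<eta>)\<close>. Since
  \<open>z\<close> has distance at least \<open>2 q \<eta>\<close> from \<open>1\<close>, summation by shifts gives a bound that does not depend on the
  length of the sum.\<close>

lemma schroedinger_sharp_sum_bound:
  fixes q L :: nat and r :: int and \<eta> x t :: real
  assumes q: "0 < q" and \<eta>: "0 < \<eta>" "2 * real q * \<eta> \<le> 1"
    and x: "x = 2 * pi * of_int r / real q + \<eta>" and t: "t = pi / (2 * real q)"
  shows "cmod (\<Sum>k\<in>{-int L..int L}. cis (of_int k * x - (of_int k)\<^sup>2 * t)) \<le> 4 / \<eta>"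
proof -
  define n where "n = 4 * q"
  define a where "a k = cis (of_int k * x - (of_int k)\<^sup>2 * t)" for k :: int
  define z where "z = cis (real n * \<eta>)"
  have shift: "a (k + int n) = z * a k" for k
  proof -
    have "of_int (k + int n) * x - (of_int (k + int n))\<^sup>2 * t
       = 2 * pi * of_int (4 * r - 2 * k - 4 * int q) + (real n * \<eta> + (of_int k * x - (of_int k)\<^sup>2 * t))"
      unfolding x t n_def using q by (simp add: field_simps power2_eq_square)
    then show ?thesis unfolding a_def z_def
      by (simp only: cis_mult[symmetric] cis_multiple_2pi Ints_of_int) simp
  qed
  have norm_a: "cmod (a k) = 1" for k by (simp add: a_def)
  have bd: "cmod (\<Sum>i<n. a (f i)) \<le> real n" for f :: "nat \<Rightarrow> int"
    using sum_norm_le[of "{..<n}" "\<lambda>i. a (f i)" "\<lambda>_. 1"] norm_a by simp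
  have "(1 - z) * (\<Sum>k\<in>{-int L..int L}. a k)
      = (\<Sum>i<n. a (- int L + int i)) - (\<Sum>i<n. a (int L + 1 + int i))"
    unfolding sum_shift_difference[symmetric] shift by (simp add: sum_distrib_left algebra_simps sum_subtractf)
  then have "cmod (1 - z) * cmod (\<Sum>k\<in>{-int L..int L}. a k)
      = cmod ((\<Sum>i<n. a (- int L + int i)) - (\<Sum>i<n. a (int L + 1 + int i)))"
    by (metis norm_mult)
  also have "\<dots> \<le> cmod (\<Sum>i<n. a (- int L + int i)) + cmod (\<Sum>i<n. a (int L + 1 + int i))"
    by (rule norm_triangle_ineq4)
  also have "\<dots> \<le> real n + real n" by (intro add_mono bd)
  finally have "cmod (1 - z) * cmod (\<Sum>k\<in>{-int L..int L}. a k) \<le> 2 * real n" by simp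
  moreover have "2 * real q * \<eta> \<le> cmod (1 - z)"
  proof -
    have "cmod (1 - z) = 2 * \<bar>sin (real n * \<eta> / 2)\<bar>"
      using dist_exp_i_1[of "real n * \<eta>"] by (simp add: z_def cis_conv_exp norm_minus_commute)
    moreover have "2 * real q * \<eta> / 2 \<le> sin (2 * real q * \<eta>)"
      using \<eta> q by (intro half_le_sin) auto
    moreover have "real n * \<eta> / 2 = 2 * real q * \<eta>" by (simp add: n_def)
    ultimately have "cmod (1 - z) = 2 * \<bar>sin (2 * real q * \<eta>)\<bar>" by presburger
    then show ?thesis
      using \<open>2 * real q * \<eta> / 2 \<le> sin (2 * real q * \<eta>)\<close> by linarith
  qed
  then have "2 * real q * \<eta> * cmod (\<Sum>k\<in>{-int L..int L}. a k)
      \<le> cmod (1 - z) * cmod (\<Sum>k\<in>{-int L..int L}. a k)"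
    by (rule mult_right_mono) simp
  ultimately have "2 * real q * \<eta> * cmod (\<Sum>k\<in>{-int L..int L}. a k) \<le> 2 * real n"
    by linarith
  then show ?thesis using q \<eta> by (simp add: n_def a_def field_simps)
qed

lemma schroedinger_fejer_sum_bound:
  fixes q K N :: nat and r :: int and \<eta> x t :: real
  assumes K: "0 < K" and q: "0 < q" and \<eta>: "0 < \<eta>" "2 * real q * \<eta> \<le> 1"
    and x: "x = 2 * pi * of_int r / real q + \<eta>" and t: "t = pi / (2 * real q)"
  shows "cmod (\<Sum>k\<in>{-int N..int N}. of_real (fejer_weight K k) * cis (of_int k * x - (of_int k)\<^sup>2 * t))
      \<le> 4 / \<eta>"
proof -
  have "cmod (\<Sum>L<K. \<Sum>k\<in>{-int (min L N)..int (min L N)}. cis (of_int k * x - (of_int k)\<^sup>2 * t))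
      \<le> (\<Sum>L<K. 4 / \<eta>)"
    by (intro sum_norm_le schroedinger_sharp_sum_bound[OF q \<eta> x t])
  then show ?thesis unfolding fejer_sum_eq_average[OF K] norm_divide
    using K by (simp add: field_simps)
qed

lemma fejer_sum_trivial_bound:
  assumes "0 < K" "\<And>k. cmod (a k) \<le> 1"
  shows "cmod (\<Sum>k\<in>{-int N..int N}. of_real (fejer_weight K k) * a k) \<le> real K"
proof -
  have *: "(\<Sum>k\<in>{-int N..int N}. fejer_weight K k) \<le> real K"
  proof -
    have "(\<Sum>k\<in>{-int N..int N}. fejer_weight K k) \<le> (\<Sum>k\<in>{-int (max K N)..int (max K N)}. fejer_weight K k)"
      by (rule sum_mono2) auto
    also have "complex_of_real \<dots> = of_real (real K)"
      using fejer_kernel_eq_sum[OF assms(1), of "max K N" 0] assms(1)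
      by (simp add: fejer_kernel_def power2_eq_square)
    then have "(\<Sum>k\<in>{-int (max K N)..int (max K N)}. fejer_weight K k) = real K"
      by (simp only: of_real_eq_iff)
    finally show ?thesis .
  qed
  have "cmod (\<Sum>k\<in>{-int N..int N}. of_real (fejer_weight K k) * a k)
      \<le> (\<Sum>k\<in>{-int N..int N}. fejer_weight K k)"
    using assms(2) by (intro sum_norm_le) (simp add: norm_mult mult_left_le)
  with * show ?thesis by linarith
qed

section \<open>Fejer polynomials on the torus\<close>

lemma circle_char_to_circle: "circle_char m (to_circle a) = cis (of_int m * a)"
  by transfer simp

text \<open>Sums over frequency cubes factorise, so that everything reduces to one coordinate.\<close>

lemma sum_freq_cube_prod:
  fixes g :: "'d::finite \<Rightarrow> int \<Rightarrow> 'c::comm_semiring_1"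
  shows "(\<Sum>k\<in>(freq_cube N :: (int^'d) set). \<Prod>l\<in>UNIV. g l (k $ l)) = (\<Prod>l\<in>UNIV. \<Sum>j\<in>{-int N..int N}. g l j)"
proof -
  have "(\<Prod>l\<in>UNIV. \<Sum>j\<in>{-int N..int N}. g l j)
      = (\<Sum>h\<in>(PiE UNIV (\<lambda>_. {-int N..int N}) :: ('d \<Rightarrow> int) set). \<Prod>l\<in>UNIV. g l (h l))"
    by (rule prod_sum_PiE) auto
  also have "\<dots> = (\<Sum>k\<in>(freq_cube N :: (int^'d) set). \<Prod>l\<in>UNIV. g l (k $ l))"
    by (rule sum.reindex_bij_witness[of _ vec_nth vec_lambda])
      (auto simp: freq_cube_def abs_le_iff vec_eq_iff PiE_iff, (metis minus_le_iff)+)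
  finally show ?thesis by simp
qed

definition torus_weight :: "nat \<Rightarrow> int ^ 'd \<Rightarrow> real" where
  "torus_weight K k = (\<Prod>l\<in>UNIV. fejer_weight K (k $ l))"

text \<open>The product over the coordinates of Fejer kernels of order \<open>K\<close>, written as a trigonometric
  polynomial.\<close>

definition fejer_poly :: "nat \<Rightarrow> circle ^ 'd \<Rightarrow> complex" where
  "fejer_poly K y = (\<Sum>k\<in>freq_cube K. of_real (torus_weight K k) * torus_char k y)"

definition fejer_series :: "(nat \<Rightarrow> real) \<Rightarrow> (nat \<Rightarrow> nat) \<Rightarrow> circle ^ 'd \<Rightarrow> complex" where
  "fejer_series c K y = (\<Sum>j. of_real (c j) * fejer_poly (K j) y)"

lemma torus_weight_bounds: "0 \<le> torus_weight K k" "torus_weight K k \<le> 1"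
  unfolding torus_weight_def by (simp_all add: prod_nonneg prod_le_1 fejer_weight_le_1)

lemma torus_weight_outside: "K > 0 \<Longrightarrow> k \<notin> freq_cube K \<Longrightarrow> torus_weight K k = 0"
proof -
  assume "K > 0" "k \<notin> freq_cube K"
  then obtain l where "int K \<le> \<bar>k $ l\<bar>" by (auto simp: freq_cube_def not_le intro: less_imp_le)
  then have "fejer_weight K (k $ l) = 0" using \<open>K > 0\<close> by (rule fejer_weight_eq_0[rotated])
  then show ?thesis unfolding torus_weight_def by (intro prod_zero) auto
qed

lemma fejer_poly_to_torus:
  fixes x :: "real ^ 'd::finite"
  assumes "K > 0"
  shows "fejer_poly K (to_torus x) = of_real (\<Prod>l\<in>UNIV. fejer_kernel K (x $ l))"
proof -
  have "fejer_poly K (to_torus x)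
      = (\<Sum>k\<in>freq_cube K. \<Prod>l\<in>UNIV. of_real (fejer_weight K (k $ l)) * cis (of_int (k $ l) * x $ l))"
    by (simp add: fejer_poly_def torus_weight_def torus_char_def to_torus_def circle_char_to_circle
        prod.distrib)
  also have "\<dots> = (\<Prod>l\<in>UNIV. of_real (fejer_kernel K (x $ l)))"
    unfolding sum_freq_cube_prod[of "\<lambda>l j. of_real (fejer_weight K j) * cis (of_int j * x $ l)" K]
    by (simp add: fejer_kernel_eq_sum[OF assms])
  finally show ?thesis by simp
qed

lemma circle_character_integral:
  "(LINT u|lborel. indicator {0..2 * pi} u *\<^sub>R cis (of_int m * u)) = (if m = 0 then 2 * of_real pi else 0)"
proof (cases "m = 0")
  case True
  have "(LINT u|lborel. indicator {0..2 * pi} u *\<^sub>R (1::complex)) = of_real (2 * pi) - of_real 0"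
    by (rule integral_FTC_Icc) (auto intro!: derivative_eq_intros simp: has_vector_derivative_def scaleR_conv_of_real)
  then show ?thesis using True by simp
next
  case False
  have "(LINT u|lborel. indicator {0..2 * pi} u *\<^sub>R cis (of_int m * u))
      = cis (of_int m * (2 * pi)) / (\<i> * of_int m) - cis (of_int m * 0) / (\<i> * of_int m)"
  proof (rule integral_FTC_Icc)
    fix u :: real
    show "((\<lambda>u. cis (of_int m * u) / (\<i> * of_int m)) has_vector_derivative cis (of_int m * u)) (at u within {0..2 * pi})"
      unfolding cis_conv_exp using False
      by (auto intro!: derivative_eq_intros has_vector_derivative_real_field simp: field_simps)
  qed (auto intro!: continuous_intros)
  also have "cis (of_int m * (2 * pi)) = 1"
    using cis_multiple_2pi[of "of_int m"] by (simp add: mult_ac)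
  finally show ?thesis using False by simp
qed

lemma integrable_circle_character: "integrable lborel (\<lambda>u. indicator {0..2 * pi} u *\<^sub>R cis (of_int m * u))"
  by (rule borel_integrable_compact) (auto intro!: continuous_intros)

lemma integrable_period_cube:
  fixes g :: "real ^ 'd::finite \<Rightarrow> 'b::{banach, second_countable_topology}"
  assumes "continuous_on UNIV g"
  shows "integrable lebesgue (\<lambda>x. indicator period_cube x *\<^sub>R g x)"
proof -
  have "integrable lborel (\<lambda>x. indicator period_cube x *\<^sub>R g x)"
    by (rule borel_integrable_compact) (auto simp: period_cube_def intro: continuous_on_subset[OF assms])
  then show ?thesis by (simp add: integrable_completion borel_measurable_integrable)
qed

lemma torus_char_continuous: "continuous_on UNIV (\<lambda>x::real^'d::finite. torus_char k (to_torus x))"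
  unfolding torus_char_to_torus by (intro continuous_intros)

lemma fejer_poly_continuous: "continuous_on UNIV (\<lambda>x::real^'d::finite. fejer_poly K (to_torus x))"
  unfolding fejer_poly_def by (intro continuous_intros torus_char_continuous)

lemma torus_char_mult: "torus_char k y * torus_char m y = torus_char (k + m) y"
proof -
  have "circle_char a z * circle_char b z = circle_char (a + b) z" for a b z
    by transfer (simp add: cis_mult distrib_right)
  then show ?thesis by (simp add: torus_char_def prod.distrib[symmetric])
qed

lemma norm_torus_char [simp]: "cmod (torus_char k (to_torus x)) = 1"
  by (simp add: torus_char_to_torus)

lemma torus_character_integral:
  fixes k :: "int ^ 'd::finite"
  shows "(LINT x:period_cube|lebesgue. torus_char k (to_torus x))
      = (if k = 0 then (2 * of_real pi) ^ CARD('d) else 0)"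
proof -
  interpret product_sigma_finite "\<lambda>_::real^'d. lborel :: real measure" ..
  define idx :: "real^'d \<Rightarrow> 'd" where "idx b = (SOME i. b = axis i 1)" for b
  have idx: "idx (axis i 1) = i" for i
    unfolding idx_def by (rule some_equality) (auto simp: axis_eq_axis)
  have bij: "bij_betw (\<lambda>i. axis i 1) UNIV (Basis :: (real^'d) set)"
    unfolding bij_betw_def by (auto simp: inj_on_def axis_eq_axis Basis_vec_def)
  define h :: "real^'d \<Rightarrow> real \<Rightarrow> complex"
    where "h b u = indicator {0..2 * pi} u *\<^sub>R cis (of_int (k $ idx b) * u)" for b u
  have prod_h: "indicator period_cube x *\<^sub>R torus_char k (to_torus x) = (\<Prod>b\<in>Basis. h b (x \<bullet> b))" for x
  proof -
    have "(\<Prod>b\<in>Basis. h b (x \<bullet> b)) = (\<Prod>i\<in>UNIV. h (axis i 1) (x \<bullet> axis i 1))"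
      by (rule prod.reindex_bij_betw[OF bij, symmetric])
    also have "\<dots> = (\<Prod>i\<in>UNIV. indicator {0..2 * pi} (x $ i) *\<^sub>R cis (of_int (k $ i) * x $ i))"
      by (simp add: h_def idx inner_axis)
    also have "\<dots> = (\<Prod>i\<in>UNIV. of_real (indicator {0..2 * pi} (x $ i))) * torus_char k (to_torus x)"
      by (simp add: torus_char_def to_torus_def circle_char_to_circle scaleR_conv_of_real prod.distrib)
    also have "(\<Prod>i\<in>UNIV. of_real (indicator {0..2 * pi} (x $ i))) = (of_real (indicator period_cube x) :: complex)"
    proof (cases "x \<in> period_cube")
      case True
      then have "x $ i \<in> {0..2 * pi}" for i by (simp add: period_cube_def mem_box_cart)
      then show ?thesis using True by simp
    next
      case False
      then obtain i where "x $ i \<notin> {0..2 * pi}" by (auto simp: period_cube_def mem_box_cart)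
      then have "(\<Prod>i\<in>UNIV. of_real (indicator {0..2 * pi} (x $ i))) = (0::complex)"
        by (intro prod_zero) (auto intro!: exI[of _ i])
      then show ?thesis using False by simp
    qed
    finally show ?thesis by (simp add: scaleR_conv_of_real)
  qed
  have "integrable lborel (\<lambda>x. indicator period_cube x *\<^sub>R torus_char k (to_torus x))"
    by (rule borel_integrable_compact)
      (auto simp: period_cube_def intro: continuous_on_subset[OF torus_char_continuous])
  then have meas: "(\<lambda>x. \<Prod>b\<in>Basis. h b (x \<bullet> b)) \<in> borel_measurable borel"
    unfolding prod_h by (simp add: borel_measurable_integrable)
  have "(LINT x:period_cube|lebesgue. torus_char k (to_torus x)) = (LINT x|lborel. (\<Prod>b\<in>Basis. h b (x \<bullet> b)))"
    unfolding set_lebesgue_integral_def prod_h using meas by (intro integral_completion) simp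
  also have "\<dots> = (LINT f|(\<Pi>\<^sub>M b\<in>Basis. lborel). (\<Prod>b\<in>Basis. h b ((\<Sum>b\<in>Basis. f b *\<^sub>R b) \<bullet> b)))"
    by (subst lborel_eq, rule integral_distr) (use meas in \<open>auto intro!: borel_measurable_sum\<close>)
  also have "\<dots> = (LINT f|(\<Pi>\<^sub>M b\<in>Basis. lborel). (\<Prod>b\<in>Basis. h b (f b)))"
    by (intro Bochner_Integration.integral_cong refl prod.cong) simp
  also have "\<dots> = (\<Prod>b\<in>Basis. LINT u|lborel. h b u)"
    by (rule product_integral_prod) (auto simp: h_def integrable_circle_character)
  also have "\<dots> = (\<Prod>i\<in>UNIV. LINT u|lborel. h (axis i 1) u)"
    by (rule prod.reindex_bij_betw[OF bij, symmetric])
  also have "\<dots> = (\<Prod>i\<in>UNIV. if k $ i = 0 then 2 * of_real pi else 0)"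
    by (simp add: h_def idx circle_character_integral)
  also have "\<dots> = (if k = 0 then (2 * of_real pi) ^ CARD('d) else 0)"
    by (auto simp: vec_eq_iff)
  finally show ?thesis .
qed

text \<open>Orthogonality of the characters.\<close>

lemma fejer_poly_integral:
  fixes m :: "int ^ 'd::finite"
  assumes "K > 0"
  shows "(LINT x:period_cube|lebesgue. fejer_poly K (to_torus x) * torus_char (- m) (to_torus x))
     = (2 * of_real pi) ^ CARD('d) * of_real (torus_weight K m)"
proof -
  have "(LINT x:period_cube|lebesgue. fejer_poly K (to_torus x) * torus_char (- m) (to_torus x))
     = (LINT x|lebesgue. (\<Sum>k\<in>freq_cube K. of_real (torus_weight K k) * (indicator period_cube x *\<^sub>R torus_char (k - m) (to_torus x))))"
    unfolding set_lebesgue_integral_def fejer_poly_def sum_distrib_right scaleR_sum_right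
    by (intro Bochner_Integration.integral_cong refl sum.cong) (simp add: mult.assoc torus_char_mult)
  also have "\<dots> = (\<Sum>k\<in>freq_cube K. of_real (torus_weight K k) * (LINT x:period_cube|lebesgue. torus_char (k - m) (to_torus x)))"
    unfolding set_lebesgue_integral_def
    by (subst Bochner_Integration.integral_sum)
      (intro integrable_mult_right integrable_period_cube torus_char_continuous,
        simp only: integral_mult_right_zero)
  also have "\<dots> = (\<Sum>k\<in>freq_cube K. if k = m then (2 * of_real pi) ^ CARD('d) * of_real (torus_weight K k) else 0)"
    by (intro sum.cong refl) (auto simp: torus_character_integral)
  also have "\<dots> = (2 * of_real pi) ^ CARD('d) * of_real (torus_weight K m)"
    using torus_weight_outside[OF assms, of m] by (simp add: sum.delta finite_freq_cube)
  finally show ?thesis .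
qed

section \<open>A lacunary series of Fejer polynomials\<close>

text \<open>The Cauchy--Schwarz inequality with weights \<open>2^-j\<close>. It replaces Minkowski's inequality for
  infinite sums: the terms below decay so fast that the additional factors \<open>2^j\<close> do no harm.\<close>

lemma square_suminf_le:
  fixes a :: "nat \<Rightarrow> real"
  assumes "\<And>j. 0 \<le> a j" "summable a" "summable (\<lambda>j. 2 ^ j * (a j)\<^sup>2)"
  shows "(\<Sum>j. a j)\<^sup>2 \<le> 2 * (\<Sum>j. 2 ^ j * (a j)\<^sup>2)"
proof -
  have fin: "(\<Sum>j<n. a j)\<^sup>2 \<le> 2 * (\<Sum>j. 2 ^ j * (a j)\<^sup>2)" for n
  proof -
    have "(\<Sum>j<n. a j)\<^sup>2 = (\<Sum>j<n. sqrt ((1/2) ^ j) * (sqrt (2 ^ j) * a j))\<^sup>2"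
      by (simp add: power_one_over flip: mult.assoc real_sqrt_mult)
    also have "\<dots> \<le> (\<Sum>j<n. (sqrt ((1/2) ^ j))\<^sup>2) * (\<Sum>j<n. (sqrt (2 ^ j) * a j)\<^sup>2)"
      by (rule Cauchy_Schwarz_ineq_sum)
    also have "\<dots> = (\<Sum>j<n. (1/2) ^ j) * (\<Sum>j<n. 2 ^ j * (a j)\<^sup>2)"
      by (simp add: power_mult_distrib)
    also have "\<dots> \<le> 2 * (\<Sum>j. 2 ^ j * (a j)\<^sup>2)"
    proof (rule mult_mono)
      have "(\<Sum>j<n. (1/2::real) ^ j) \<le> (\<Sum>j. (1/2) ^ j)"
        by (rule sum_le_suminf) (auto intro: summable_geometric)
      then show "(\<Sum>j<n. (1/2::real) ^ j) \<le> 2" by (simp add: suminf_geometric)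
      show "(\<Sum>j<n. 2 ^ j * (a j)\<^sup>2) \<le> (\<Sum>j. 2 ^ j * (a j)\<^sup>2)"
        by (rule sum_le_suminf[OF assms(3)]) auto
    qed (auto intro: sum_nonneg)
    finally show ?thesis .
  qed
  have "(\<lambda>n. (\<Sum>j<n. a j)\<^sup>2) \<longlonglongrightarrow> (\<Sum>j. a j)\<^sup>2"
    by (intro tendsto_power summable_LIMSEQ assms)
  then show ?thesis by (rule LIMSEQ_le_const2) (use fin in blast)
qed

lemma AE_summable_of_summable_integrals:
  fixes g :: "nat \<Rightarrow> 'a \<Rightarrow> real"
  assumes "\<And>j. integrable M (g j)" "\<And>j x. 0 \<le> g j x" "summable (\<lambda>j. integral\<^sup>L M (g j))"
  shows "AE x in M. summable (\<lambda>j. g j x)"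
proof -
  have [measurable]: "g j \<in> borel_measurable M" for j using assms(1) by blast
  have "(\<integral>\<^sup>+ x. (\<Sum>j. ennreal (g j x)) \<partial>M) = (\<Sum>j. \<integral>\<^sup>+ x. ennreal (g j x) \<partial>M)"
    by (rule nn_integral_suminf) simp
  also have "\<dots> = (\<Sum>j. ennreal (integral\<^sup>L M (g j)))"
    by (intro suminf_cong nn_integral_eq_integral) (use assms in auto)
  also have "\<dots> \<noteq> top"
    using assms by (intro ennreal_suminf_neq_top) (auto intro: integral_nonneg_AE)
  finally have "AE x in M. (\<Sum>j. ennreal (g j x)) \<noteq> \<infinity>"
    by (intro nn_integral_PInf_AE) (auto simp: infinity_ennreal_def)
  then show ?thesis
    by eventually_elim (auto intro: summable_suminf_not_top assms(2) simp: infinity_ennreal_def)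
qed

text \<open>The factor \<open>K powr -(n/2 + s)\<close> normalises the block of order \<open>K\<close> in \<open>H^s\<close>, and the factor
  \<open>2^-j\<close> makes the series of the norms converge.\<close>

locale fejer_data =
  fixes c :: "nat \<Rightarrow> real" and K :: "nat \<Rightarrow> nat" and s :: real
    and f :: "circle ^ 'd::finite \<Rightarrow> complex"
  assumes f_def: "f = fejer_series c K" 
    and K_pos: "\<And>j. 0 < K j"
    and s_nonneg: "0 \<le> s"
    and c_def: "\<And>j. c j = (1/2) ^ j * real (K j) powr (- (real CARD('d) / 2 + s))"
begin

lemma c_nonneg: "0 \<le> c j" by (simp add: c_def)

lemma c_le: "c j \<le> (1/2) ^ j"
proof -
  have "real (K j) powr (- (real CARD('d) / 2 + s)) \<le> 1 powr (- (real CARD('d) / 2 + s))"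
    using K_pos[of j] s_nonneg by (intro powr_mono2') auto
  then show ?thesis by (simp add: c_def mult_left_le)
qed

lemma summable_c: "summable c"
  by (rule summable_comparison_test'[of "\<lambda>j. (1/2) ^ j" 0]) (auto simp: c_nonneg c_le summable_geometric)

lemma c_square: "2 ^ j * (c j)\<^sup>2 * real (K j) powr (real CARD('d) + 2 * s) = (1/2) ^ j"
proof -
  have "(real (K j) powr (- (real CARD('d) / 2 + s)))\<^sup>2 = real (K j) powr (2 * (- (real CARD('d) / 2 + s)))"
    unfolding power2_eq_square powr_add[symmetric] by (simp only: mult_2)
  also have "2 * (- (real CARD('d) / 2 + s)) = - (real CARD('d) + 2 * s)" by simp
  finally have "(c j)\<^sup>2 = ((1/2) ^ j)\<^sup>2 * real (K j) powr (- (real CARD('d) + 2 * s))"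
    unfolding c_def power_mult_distrib by presburger
  moreover have "real (K j) powr (- (real CARD('d) + 2 * s)) * real (K j) powr (real CARD('d) + 2 * s) = 1"
    using K_pos[of j] by (simp flip: powr_add)
  moreover have "2 ^ j * ((1/2::real) ^ j)\<^sup>2 = (1/2) ^ j"
    by (simp add: power_one_over power2_eq_square)
  ultimately show ?thesis by (simp add: mult.assoc)
qed

lemma c_square_le: "2 ^ j * (c j)\<^sup>2 * real (K j) ^ CARD('d) \<le> (1/2) ^ j"
proof -
  have "real (K j) ^ CARD('d) = real (K j) powr (real CARD('d))"
    using K_pos[of j] by (simp add: powr_realpow)
  also have "\<dots> \<le> real (K j) powr (real CARD('d) + 2 * s)"
    using K_pos[of j] s_nonneg by (intro powr_mono) auto
  finally have "2 ^ j * (c j)\<^sup>2 * real (K j) ^ CARD('d) \<le> 2 ^ j * (c j)\<^sup>2 * real (K j) powr (real CARD('d) + 2 * s)"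
    by (intro mult_left_mono) auto
  then show ?thesis unfolding c_square .
qed

definition block :: "nat \<Rightarrow> real ^ 'd \<Rightarrow> real" where
  "block j x = (\<Prod>l\<in>UNIV. fejer_kernel (K j) (x $ l))"

lemma fejer_poly_eq_block: "fejer_poly (K j) (to_torus x) = of_real (block j x)"
  unfolding block_def by (rule fejer_poly_to_torus[OF K_pos])

lemma block_nonneg: "0 \<le> block j x"
  by (simp add: block_def prod_nonneg fejer_kernel_nonneg)

lemma block_le: "block j x \<le> real (K j) ^ CARD('d)"
proof -
  have "block j x \<le> (\<Prod>l\<in>(UNIV::'d set). real (K j))"
    unfolding block_def by (intro prod_mono) (auto simp: fejer_kernel_nonneg fejer_kernel_le K_pos)
  then show ?thesis by simp
qed

lemma block_continuous: "continuous_on UNIV (block j)"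
proof -
  have "continuous_on UNIV (\<lambda>x::real^'d. Re (fejer_poly (K j) (to_torus x)))"
    by (intro continuous_intros fejer_poly_continuous)
  then show ?thesis unfolding fejer_poly_eq_block by simp
qed

lemma block_integrable: "integrable lebesgue (\<lambda>x. indicator period_cube x *\<^sub>R block j x)"
  by (rule integrable_period_cube[OF block_continuous])

lemma block_integral: "(LINT x|lebesgue. indicator period_cube x *\<^sub>R block j x) = (2 * pi) ^ CARD('d)"
proof -
  have "complex_of_real (LINT x|lebesgue. indicator period_cube x *\<^sub>R block j x)
      = (LINT x|lebesgue. of_real (indicator period_cube x *\<^sub>R block j x))"
    by (rule integral_complex_of_real[symmetric])
  also have "\<dots> = (LINT x:(period_cube :: (real^'d) set)|lebesgue. fejer_poly (K j) (to_torus x) * torus_char (- 0) (to_torus x))"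
    unfolding set_lebesgue_integral_def fejer_poly_eq_block
    by (intro Bochner_Integration.integral_cong refl)
      (simp add: torus_char_to_torus scaleR_conv_of_real)
  also have "\<dots> = of_real ((2 * pi) ^ CARD('d))"
    unfolding fejer_poly_integral[OF K_pos] by (simp add: torus_weight_def)
  finally show ?thesis unfolding of_real_eq_iff .
qed

text \<open>The blocks are nonnegative with the same integral, so the series converges almost everywhere.
  Elsewhere the value of \<open>f\<close>
  is that of a divergent infinite sum and thus unspecified.\<close>

lemma AE_summable_block: "AE x in lebesgue. x \<in> period_cube \<longrightarrow> summable (\<lambda>j. c j * block j x)"
proof -
  have "AE x in lebesgue. summable (\<lambda>j. c j * (indicator period_cube x *\<^sub>R block j x))"
  proof (rule AE_summable_of_summable_integrals)
    show "summable (\<lambda>j. LINT x|lebesgue. c j * (indicator period_cube x *\<^sub>R block j x))"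
      by (simp only: integral_mult_right_zero block_integral) (intro summable_mult2 summable_c)
  qed (use block_integrable c_nonneg block_nonneg in \<open>auto intro!: integrable_mult_right\<close>)
  then show ?thesis by eventually_elim auto
qed

lemma summable_c_weight: "summable (\<lambda>j. c j * torus_weight (K j) m)"
  by (rule summable_comparison_test'[OF summable_c, of 0])
    (simp add: abs_mult c_nonneg torus_weight_bounds mult_left_le)

lemma f_measurable: "(\<lambda>x. f (to_torus x)) \<in> borel_measurable lebesgue"
  unfolding f_def fejer_series_def
  by (intro borel_measurable_suminf measurable_completion)
    (auto intro!: borel_measurable_continuous_onI continuous_intros fejer_poly_continuous)

text \<open>The integral may be computed termwise because the \<open>L^1\<close> norms of the terms are summable.\<close>

lemma f_coeff: "fourier_coeff f m = of_real (\<Sum>j. c j * torus_weight (K j) m)"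
proof -
  define g where "g j x = indicator period_cube x *\<^sub>R (of_real (c j) * (fejer_poly (K j) (to_torus x) * torus_char (- m) (to_torus x)))"
    for j and x :: "real ^ 'd"
  have g_int: "integrable lebesgue (g j)" for j
    unfolding g_def
    by (intro integrable_period_cube continuous_intros fejer_poly_continuous torus_char_continuous)
  have norm_g: "norm (g j x) = c j * (indicator period_cube x *\<^sub>R block j x)" for j x
    by (simp add: g_def fejer_poly_eq_block norm_mult block_nonneg c_nonneg)
  have g_integral: "integral\<^sup>L lebesgue (g j) = of_real (c j) * ((2 * of_real pi) ^ CARD('d) * of_real (torus_weight (K j) m))" for j
  proof -
    have "integral\<^sup>L lebesgue (g j) = of_real (c j) * (LINT x:period_cube|lebesgue. fejer_poly (K j) (to_torus x) * torus_char (- m) (to_torus x))"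
      unfolding g_def set_lebesgue_integral_def
      by (simp only: mult_scaleR_right[symmetric] integral_mult_right_zero)
    then show ?thesis by (simp add: fejer_poly_integral[OF K_pos])
  qed
  have sum_norms: "summable (\<lambda>j. LINT x|lebesgue. norm (g j x))"
    unfolding norm_g by (simp only: integral_mult_right_zero block_integral) (intro summable_mult2 summable_c)
  have AE_sum: "AE x in lebesgue. summable (\<lambda>j. norm (g j x))"
    using AE_summable_block unfolding norm_g
    by eventually_elim (auto split: split_indicator)
  have "(LINT x:period_cube|lebesgue. f (to_torus x) * torus_char (- m) (to_torus x))
      = (LINT x|lebesgue. (\<Sum>j. g j x))"
    unfolding set_lebesgue_integral_def
  proof (rule integral_cong_AE)
    have "(\<lambda>x. \<Sum>j. g j x) \<in> borel_measurable lebesgue"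
      by (intro borel_measurable_suminf borel_measurable_integrable g_int)
    then show "(\<lambda>x. \<Sum>j. g j x) \<in> borel_measurable lebesgue" .
    note f_measurable
    moreover have "(\<lambda>x::real^'d. torus_char (- m) (to_torus x)) \<in> borel_measurable lebesgue"
      by (intro measurable_completion) (auto intro!: borel_measurable_continuous_onI torus_char_continuous)
    moreover have "(indicator period_cube :: real^'d \<Rightarrow> real) \<in> borel_measurable lebesgue"
      by (intro borel_measurable_indicator) (simp add: period_cube_def)
    ultimately show "(\<lambda>x. indicator period_cube x *\<^sub>R (f (to_torus x) * torus_char (- m) (to_torus x))) \<in> borel_measurable lebesgue"
      by (intro borel_measurable_scaleR borel_measurable_times)
    show "AE x in lebesgue. indicator period_cube x *\<^sub>R (f (to_torus x) * torus_char (- m) (to_torus x)) = (\<Sum>j. g j x)"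
      using AE_summable_block
    proof eventually_elim
      case (elim x)
      show ?case
      proof (cases "x \<in> period_cube")
        case True
        then have "summable (\<lambda>j. c j * block j x)" using elim by simp
        then have "summable (\<lambda>j. complex_of_real (c j * block j x))" by (rule summable_of_real)
        then show ?thesis using True
          by (simp add: g_def f_def fejer_series_def fejer_poly_eq_block suminf_mult2 mult.assoc)
      qed (simp add: g_def)
    qed
  qed
  also have "\<dots> = (\<Sum>j. integral\<^sup>L lebesgue (g j))"
    by (rule integral_suminf[OF g_int AE_sum sum_norms])
  also have "\<dots> = (\<Sum>j. (2 * of_real pi) ^ CARD('d) * of_real (c j * torus_weight (K j) m))"
    unfolding g_integral by (simp add: mult_ac)
  also have "\<dots> = (2 * of_real pi) ^ CARD('d) * (\<Sum>j. of_real (c j * torus_weight (K j) m))"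
    by (rule suminf_mult) (intro summable_of_real summable_c_weight)
  finally show ?thesis by (simp add: fourier_coeff_def suminf_of_real summable_c_weight)
qed

text \<open>The square of a block integrates to at most \<open>K^n\<close> times the integral of the block.\<close>

lemma f_L2: "f \<in> torus_L2"
proof -
  define g where "g j x = 2 ^ j * (c j)\<^sup>2 * (indicator period_cube x *\<^sub>R (block j x)\<^sup>2)" for j and x :: "real ^ 'd"
  have sq_int: "integrable lebesgue (\<lambda>x. indicator period_cube x *\<^sub>R (block j x)\<^sup>2)" for j
    by (intro integrable_period_cube continuous_intros block_continuous)
  have g_int: "integrable lebesgue (g j)" for j
    unfolding g_def by (intro integrable_mult_right sq_int)
  have g_nonneg: "0 \<le> g j x" for j x by (simp add: g_def)
  have g_le: "integral\<^sup>L lebesgue (g j) \<le> (1/2) ^ j * (2 * pi) ^ CARD('d)" for j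
  proof -
    have "(LINT x|lebesgue. indicator period_cube x *\<^sub>R (block j x)\<^sup>2)
       \<le> (LINT x|lebesgue. real (K j) ^ CARD('d) * (indicator period_cube x *\<^sub>R block j x))"
      using block_le[of j] block_nonneg[of j]
      by (intro integral_mono sq_int integrable_mult_right block_integrable)
        (auto split: split_indicator simp: power2_eq_square intro: mult_right_mono)
    also have "\<dots> = real (K j) ^ CARD('d) * (2 * pi) ^ CARD('d)"
      by (simp only: integral_mult_right_zero block_integral)
    finally have "integral\<^sup>L lebesgue (g j) \<le> 2 ^ j * (c j)\<^sup>2 * (real (K j) ^ CARD('d) * (2 * pi) ^ CARD('d))"
      unfolding g_def integral_mult_right_zero by (intro mult_left_mono) auto
    also have "\<dots> = (2 ^ j * (c j)\<^sup>2 * real (K j) ^ CARD('d)) * (2 * pi) ^ CARD('d)"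
      by (simp add: mult_ac)
    also have "\<dots> \<le> (1/2) ^ j * (2 * pi) ^ CARD('d)"
      by (intro mult_right_mono c_square_le) auto
    finally show ?thesis .
  qed
  have g_sum: "summable (\<lambda>j. integral\<^sup>L lebesgue (g j))"
  proof (rule summable_comparison_test'[of "\<lambda>j. (1/2) ^ j * (2 * pi) ^ CARD('d)" 0])
    show "summable (\<lambda>j. (1/2) ^ j * (2 * pi) ^ CARD('d))"
      by (intro summable_mult2 summable_geometric) auto
    show "norm (integral\<^sup>L lebesgue (g j)) \<le> (1/2) ^ j * (2 * pi) ^ CARD('d)" for j
      using g_le g_nonneg by (simp add: integral_nonneg_AE)
  qed
  have AE_g: "AE x in lebesgue. summable (\<lambda>j. g j x)"
    by (rule AE_summable_of_summable_integrals[OF g_int g_nonneg g_sum])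
  have G_int: "integrable lebesgue (\<lambda>x. \<Sum>j. g j x)"
    by (rule integrable_suminf[OF g_int]) (use AE_g g_nonneg g_sum in auto)
  have bound: "AE x in lebesgue. norm (indicator period_cube x *\<^sub>R (cmod (f (to_torus x)))\<^sup>2) \<le> norm (2 * (\<Sum>j. g j x))"
    using AE_summable_block AE_g
  proof eventually_elim
    case (elim x)
    show ?case
    proof (cases "x \<in> period_cube")
      case True
      have sm: "summable (\<lambda>j. c j * block j x)" using elim True by simp
      have sq: "2 ^ j * (c j * block j x)\<^sup>2 = g j x" for j
        using True by (simp add: g_def power_mult_distrib)
      have "f (to_torus x) = (\<Sum>j. complex_of_real (c j * block j x))"
        by (simp add: f_def fejer_series_def fejer_poly_eq_block)
      also have "\<dots> = of_real (\<Sum>j. c j * block j x)" by (rule suminf_of_real[OF sm, symmetric])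
      finally have "(cmod (f (to_torus x)))\<^sup>2 = (\<Sum>j. c j * block j x)\<^sup>2" by simp
      also have "\<dots> \<le> 2 * (\<Sum>j. 2 ^ j * (c j * block j x)\<^sup>2)"
        by (rule square_suminf_le) (use sm elim in \<open>auto simp: c_nonneg block_nonneg sq\<close>)
      finally show ?thesis using True unfolding sq by simp
    qed simp
  qed
  have ind: "(indicator period_cube :: real^'d \<Rightarrow> real) \<in> borel_measurable lebesgue"
    by (intro borel_measurable_indicator) (simp add: period_cube_def)
  have "integrable lebesgue (\<lambda>x. indicator period_cube x *\<^sub>R (cmod (f (to_torus x)))\<^sup>2)"
    by (rule Bochner_Integration.integrable_bound[OF integrable_mult_right[OF G_int, of 2] _ bound])
      (use ind f_measurable in measurable)
  moreover have "(\<lambda>x. indicator period_cube x *\<^sub>R f (to_torus x)) \<in> borel_measurable lebesgue"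
    by (intro borel_measurable_scaleR ind f_measurable)
  ultimately show ?thesis
    by (simp add: torus_L2_def set_borel_measurable_def set_integrable_def)
qed

lemma card_freq_cube: "card (freq_cube N :: (int ^ 'd) set) = (2 * N + 1) ^ CARD('d)"
proof -
  have "of_nat (card (freq_cube N :: (int ^ 'd) set)) = (\<Sum>k\<in>(freq_cube N :: (int ^ 'd) set). \<Prod>l\<in>(UNIV::'d set). (1::int))"
    by simp
  also have "\<dots> = (\<Prod>l\<in>(UNIV::'d set). \<Sum>j\<in>{-int N..int N}. 1)"
    by (rule sum_freq_cube_prod[of "\<lambda>l j. 1"])
  also have "\<dots> = int ((2 * N + 1) ^ CARD('d))" by (simp add: add.commute)
  finally show ?thesis by linarith
qed

lemma sobolev_weight_sum_le:
  assumes "N > 0"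
  shows "(\<Sum>k\<in>(freq_cube N :: (int ^ 'd) set). (1 + freq_norm_sq k) powr s)
     \<le> 3 ^ CARD('d) * (1 + real CARD('d)) powr s * real N powr (real CARD('d) + 2 * s)"
proof -
  have w: "(1 + freq_norm_sq k) powr s \<le> ((1 + real CARD('d)) * (real N)\<^sup>2) powr s"
    if "k \<in> freq_cube N" for k :: "int ^ 'd"
  proof (rule powr_mono2)
    have "freq_norm_sq k \<le> (\<Sum>i\<in>(UNIV::'d set). (real N)\<^sup>2)"
      unfolding freq_norm_sq_def
    proof (rule sum_mono)
      fix i :: 'd
      have "\<bar>k $ i\<bar> \<le> int N" using that by (simp add: freq_cube_def)
      then have "\<bar>real_of_int (k $ i)\<bar> \<le> \<bar>real N\<bar>" by linarith
      then show "(real_of_int (k $ i))\<^sup>2 \<le> (real N)\<^sup>2" by (rule abs_le_square_iff[THEN iffD1])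
    qed
    moreover have "1 \<le> (real N)\<^sup>2" using assms by simp
    ultimately show "1 + freq_norm_sq k \<le> (1 + real CARD('d)) * (real N)\<^sup>2"
      by (simp add: distrib_right)
  qed (use s_nonneg in \<open>auto simp: freq_norm_sq_def intro!: add_nonneg_nonneg sum_nonneg\<close>)
  have "(\<Sum>k\<in>(freq_cube N :: (int ^ 'd) set). (1 + freq_norm_sq k) powr s)
     \<le> (\<Sum>k\<in>(freq_cube N :: (int ^ 'd) set). ((1 + real CARD('d)) * (real N)\<^sup>2) powr s)"
    by (rule sum_mono[OF w])
  also have "\<dots> = real (2 * N + 1) ^ CARD('d) * (((1 + real CARD('d)) * (real N)\<^sup>2) powr s)"
    by (simp add: card_freq_cube)
  also have "\<dots> \<le> (3 * real N) ^ CARD('d) * (((1 + real CARD('d)) * (real N)\<^sup>2) powr s)"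
    using assms by (intro mult_right_mono power_mono) auto
  also have "((1 + real CARD('d)) * (real N)\<^sup>2) powr s = (1 + real CARD('d)) powr s * real N powr (2 * s)"
  proof -
    have "(real N)\<^sup>2 = real N powr 2" using assms by (simp add: powr_numeral)
    then show ?thesis by (simp only: powr_mult powr_powr)
  qed
  also have "(3 * real N) ^ CARD('d) = 3 ^ CARD('d) * real N powr real CARD('d)"
    using assms by (simp add: power_mult_distrib powr_realpow)
  finally show ?thesis by (simp add: powr_add mult_ac)
qed

text \<open>By the weighted Cauchy--Schwarz inequality the squares of the coefficients are bounded by sums over
  \<open>j\<close> of \<open>2^j (c j)^2\<close> on the frequency cube of size \<open>K j\<close>; the Sobolev weight sums over this cube to
  \<open>O((K j) powr (n + 2s))\<close>.\<close>

lemma f_sobolev: "f \<in> sobolev s"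
proof -
  define B where "B = 3 ^ CARD('d) * (1 + real CARD('d)) powr s"
  have B: "0 \<le> B" by (simp add: B_def)
  define a where "a j m = 2 ^ j * (c j)\<^sup>2 * (if m \<in> freq_cube (K j) then 1 else (0::real))" for j and m :: "int ^ 'd"
  have a_le: "a j m \<le> (1/2) ^ j" for j m
  proof -
    have "a j m \<le> 2 ^ j * (c j)\<^sup>2 * real (K j) ^ CARD('d)"
      unfolding a_def using K_pos[of j] by (intro mult_left_mono) auto
    then show ?thesis using c_square_le[of j] by linarith
  qed
  have a_nonneg: "0 \<le> a j m" for j m by (simp add: a_def)
  have a_summable: "summable (\<lambda>j. a j m)" for m
    by (rule summable_comparison_test'[of "\<lambda>j. (1/2) ^ j" 0]) (auto simp: a_nonneg a_le summable_geometric)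
  have coeff: "(cmod (fourier_coeff f m))\<^sup>2 \<le> 2 * (\<Sum>j. a j m)" for m
  proof -
    have sq_le: "2 ^ j * (c j * torus_weight (K j) m)\<^sup>2 \<le> a j m" for j
    proof (cases "m \<in> freq_cube (K j)")
      case True
      have "(torus_weight (K j) m)\<^sup>2 \<le> 1" by (simp add: power_le_one torus_weight_bounds)
      then show ?thesis using True by (simp add: a_def power_mult_distrib mult_left_le)
    qed (simp add: torus_weight_outside[OF K_pos] a_def)
    have sm: "summable (\<lambda>j. 2 ^ j * (c j * torus_weight (K j) m)\<^sup>2)"
      by (rule summable_comparison_test'[OF a_summable, of 0]) (use sq_le in auto)
    have "(cmod (fourier_coeff f m))\<^sup>2 = (\<Sum>j. c j * torus_weight (K j) m)\<^sup>2"
      by (simp add: f_coeff)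
    also have "\<dots> \<le> 2 * (\<Sum>j. 2 ^ j * (c j * torus_weight (K j) m)\<^sup>2)"
      by (rule square_suminf_le) (auto simp: c_nonneg torus_weight_bounds summable_c_weight sm)
    also have "\<dots> \<le> 2 * (\<Sum>j. a j m)"
      by (intro mult_left_mono suminf_le sq_le sm a_summable) simp
    finally show ?thesis .
  qed
  have "(\<lambda>k. (1 + freq_norm_sq k) powr s * (cmod (fourier_coeff f k))\<^sup>2) summable_on UNIV"
  proof (rule nonneg_bdd_above_summable_on)
    show "bdd_above (sum (\<lambda>k. (1 + freq_norm_sq k) powr s * (cmod (fourier_coeff f k))\<^sup>2) ` {F. F \<subseteq> UNIV \<and> finite F})"
    proof (rule bdd_aboveI2)
      fix A :: "(int ^ 'd) set" assume A: "A \<in> {F. F \<subseteq> UNIV \<and> finite F}"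
      define w where "w k = (1 + freq_norm_sq k) powr s" for k :: "int ^ 'd"
      have "(\<Sum>k\<in>A. w k * (cmod (fourier_coeff f k))\<^sup>2) \<le> (\<Sum>k\<in>A. w k * (2 * (\<Sum>j. a j k)))"
        by (intro sum_mono mult_left_mono coeff) (simp add: w_def)
      also have "\<dots> = (\<Sum>k\<in>A. \<Sum>j. 2 * w k * a j k)"
        by (intro sum.cong refl) (simp add: suminf_mult a_summable mult_ac)
      also have "\<dots> = (\<Sum>j. \<Sum>k\<in>A. 2 * w k * a j k)"
        by (rule suminf_sum[symmetric]) (intro summable_mult a_summable)
      also have "\<dots> \<le> (\<Sum>j. 2 * B * (1/2) ^ j)"
      proof (rule suminf_le)
        fix j
        have "(\<Sum>k\<in>A. 2 * w k * a j k) = 2 * (2 ^ j * (c j)\<^sup>2) * (\<Sum>k\<in>A. if k \<in> freq_cube (K j) then w k else 0)"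
          by (auto simp: a_def sum_distrib_left intro!: sum.cong)
        also have "(\<Sum>k\<in>A. if k \<in> freq_cube (K j) then w k else 0) = (\<Sum>k\<in>A \<inter> freq_cube (K j). w k)"
          using A by (intro sum.inter_restrict[symmetric]) auto
        also have "\<dots> \<le> (\<Sum>k\<in>freq_cube (K j). w k)"
          by (rule sum_mono2) (auto simp: finite_freq_cube w_def)
        also have "\<dots> \<le> B * real (K j) powr (real CARD('d) + 2 * s)"
          unfolding w_def B_def by (rule sobolev_weight_sum_le[OF K_pos])
        finally have "(\<Sum>k\<in>A. 2 * w k * a j k) \<le> 2 * (2 ^ j * (c j)\<^sup>2) * (B * real (K j) powr (real CARD('d) + 2 * s))"
          by (simp add: mult_left_mono)
        also have "\<dots> = 2 * B * (1/2) ^ j" unfolding c_square[symmetric] by (simp add: mult_ac)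
        finally show "(\<Sum>k\<in>A. 2 * w k * a j k) \<le> 2 * B * (1/2) ^ j" .
      next
        show "summable (\<lambda>j. \<Sum>k\<in>A. 2 * w k * a j k)" by (intro summable_sum summable_mult a_summable)
        show "summable (\<lambda>j. 2 * B * (1/2) ^ j)" by (intro summable_mult summable_geometric) auto
      qed
      finally show "(\<Sum>k\<in>A. (1 + freq_norm_sq k) powr s * (cmod (fourier_coeff f k))\<^sup>2) \<le> (\<Sum>j. 2 * B * (1/2) ^ j)"
        by (simp add: w_def)
    qed
  qed auto
  with f_L2 show ?thesis by (simp add: sobolev_def)
qed

end

section \<open>Evolution of the lacunary series\<close>

text \<open>The evolution at time \<open>t\<close> of the one-dimensional Fejer kernel of order \<open>K\<close>, truncated to the
  frequencies up to \<open>N\<close>.\<close>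

definition fejer_evolution :: "nat \<Rightarrow> nat \<Rightarrow> real \<Rightarrow> real \<Rightarrow> complex" where
  "fejer_evolution N K t x =
     (\<Sum>k\<in>{-int N..int N}. of_real (fejer_weight K k) * cis (of_int k * x - (of_int k)\<^sup>2 * t))"

lemma fejer_evolution_stable:
  assumes "0 < K" "K \<le> N"
  shows "fejer_evolution N K t x = fejer_evolution K K t x"
  unfolding fejer_evolution_def
proof (rule sum.mono_neutral_right)
  show "\<forall>k\<in>{- int N..int N} - {- int K..int K}.
      complex_of_real (fejer_weight K k) * cis (of_int k * x - (of_int k)\<^sup>2 * t) = 0"
    using assms by (auto intro!: fejer_weight_eq_0)
qed (use assms in auto)

lemma torus_char_evolution:
  fixes x :: "real ^ 'd::finite"
  shows "of_real (torus_weight K k) * (torus_char k (to_torus x) * cis (- (freq_norm_sq k * t)))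
    = (\<Prod>l\<in>UNIV. of_real (fejer_weight K (k $ l)) * cis (of_int (k $ l) * x $ l - (of_int (k $ l))\<^sup>2 * t))"
proof -
  have cis_sum: "cis (\<Sum>i\<in>A. g i) = (\<Prod>i\<in>A. cis (g i))" if "finite A" for A :: "'d set" and g
    using that by (induction A) (simp_all flip: cis_mult)
  have "torus_char k (to_torus x) * cis (- (freq_norm_sq k * t))
      = cis (\<Sum>l\<in>UNIV. of_int (k $ l) * x $ l - (of_int (k $ l))\<^sup>2 * t)"
    by (simp add: torus_char_to_torus cis_mult freq_norm_sq_def sum_subtractf sum_distrib_right)
  then show ?thesis by (simp add: cis_sum prod.distrib torus_weight_def)
qed

context fejer_data
begin

lemma schroedinger_partial_eq:
  "schroedinger_partial N t f (to_torus x)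
     = (\<Sum>j. of_real (c j) * (\<Prod>l\<in>UNIV. fejer_evolution N (K j) t (x $ l)))"
proof -
  define E where "E k = torus_char k (to_torus x) * cis (- (freq_norm_sq k * t))" for k
  have sm: "summable (\<lambda>j. complex_of_real (c j * torus_weight (K j) k) * E k)" for k
    by (intro summable_mult2 summable_of_real summable_c_weight)
  have "schroedinger_partial N t f (to_torus x)
      = (\<Sum>k\<in>freq_cube N. (\<Sum>j. complex_of_real (c j * torus_weight (K j) k)) * E k)"
    unfolding schroedinger_partial_def f_coeff E_def suminf_of_real[OF summable_c_weight]
    by (simp add: mult.assoc)
  also have "\<dots> = (\<Sum>k\<in>freq_cube N. \<Sum>j. complex_of_real (c j * torus_weight (K j) k) * E k)"
    by (intro sum.cong refl suminf_mult2 summable_of_real summable_c_weight)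
  also have "\<dots> = (\<Sum>j. \<Sum>k\<in>freq_cube N. complex_of_real (c j * torus_weight (K j) k) * E k)"
    by (rule suminf_sum[symmetric, OF sm])
  also have "(\<lambda>j. \<Sum>k\<in>freq_cube N. complex_of_real (c j * torus_weight (K j) k) * E k)
      = (\<lambda>j. of_real (c j) * (\<Prod>l\<in>UNIV. fejer_evolution N (K j) t (x $ l)))"
  proof
    fix j
    have "(\<Sum>k\<in>freq_cube N. complex_of_real (c j * torus_weight (K j) k) * E k)
        = of_real (c j) * (\<Sum>k\<in>freq_cube N. of_real (torus_weight (K j) k) * E k)"
      by (simp add: sum_distrib_left mult.assoc)
    also have "(\<Sum>k\<in>freq_cube N. of_real (torus_weight (K j) k) * E k)
        = (\<Prod>l\<in>UNIV. fejer_evolution N (K j) t (x $ l))"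
      unfolding E_def torus_char_evolution fejer_evolution_def
      by (rule sum_freq_cube_prod[of "\<lambda>l k. of_real (fejer_weight (K j) k) * cis (of_int k * x $ l - (of_int k)\<^sup>2 * t)"])
    finally show "(\<Sum>k\<in>freq_cube N. complex_of_real (c j * torus_weight (K j) k) * E k)
        = of_real (c j) * (\<Prod>l\<in>UNIV. fejer_evolution N (K j) t (x $ l))" .
  qed
  finally show ?thesis .
qed

definition evolved_block :: "real \<Rightarrow> real ^ 'd \<Rightarrow> nat \<Rightarrow> complex" where
  "evolved_block t x j = of_real (c j) * (\<Prod>l\<in>UNIV. fejer_evolution (K j) (K j) t (x $ l))"

lemma norm_block:
  "cmod (of_real (c j) * (\<Prod>l\<in>(UNIV::'d set). g l)) = c j * (\<Prod>l\<in>UNIV. cmod (g l))"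
  by (simp only: norm_mult norm_of_real abs_of_nonneg[OF c_nonneg] prod_norm)

text \<open>Dominated convergence for series: each term is eventually constant in \<open>N\<close>, and the
  coefficients \<open>c j\<close> are summable.\<close>

lemma schroedinger_converges:
  assumes "\<And>N j l. cmod (fejer_evolution N (K j) t (x $ l)) \<le> B"
  shows "summable (\<lambda>j. cmod (evolved_block t x j))"
    and "(\<lambda>N. schroedinger_partial N t f (to_torus x)) \<longlonglongrightarrow> (\<Sum>j. evolved_block t x j)"
proof -
  have lim: "(\<lambda>N. of_real (c j) * (\<Prod>l\<in>UNIV. fejer_evolution N (K j) t (x $ l))) \<longlonglongrightarrow> evolved_block t x j" for j
  proof (rule tendsto_eventually)
    show "\<forall>\<^sub>F N in sequentially. of_real (c j) * (\<Prod>l\<in>UNIV. fejer_evolution N (K j) t (x $ l)) = evolved_block t x j"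
      using eventually_ge_at_top[of "K j"]
    proof eventually_elim
      case (elim N)
      have "fejer_evolution N (K j) t u = fejer_evolution (K j) (K j) t u" for u
        by (rule fejer_evolution_stable[OF K_pos elim])
      then show ?case by (simp only: evolved_block_def)
    qed
  qed
  have bound: "norm (of_real (c j) * (\<Prod>l\<in>UNIV. fejer_evolution N (K j) t (x $ l))) \<le> c j * B ^ CARD('d)" for j N
  proof -
    have "(\<Prod>l\<in>UNIV. cmod (fejer_evolution N (K j) t (x $ l))) \<le> (\<Prod>l\<in>(UNIV::'d set). B)"
      by (intro prod_mono conjI assms) simp
    then show ?thesis unfolding norm_block using c_nonneg by (simp add: mult_left_mono)
  qed
  have sm: "summable (\<lambda>j. c j * B ^ CARD('d))" by (intro summable_mult2 summable_c)
  have *: "eventually (\<lambda>N. summable (\<lambda>j. norm (of_real (c j) * (\<Prod>l\<in>UNIV. fejer_evolution N (K j) t (x $ l))))) sequentially \<and>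
      summable (\<lambda>j. norm (evolved_block t x j)) \<and>
      (\<lambda>N. \<Sum>j. of_real (c j) * (\<Prod>l\<in>UNIV. fejer_evolution N (K j) t (x $ l))) \<longlonglongrightarrow> (\<Sum>j. evolved_block t x j)"
    by (rule tannerys_theorem[OF lim _ sm]) (use bound in \<open>auto intro!: always_eventually\<close>)
  then show "summable (\<lambda>j. cmod (evolved_block t x j))" by blast
  show "(\<lambda>N. schroedinger_partial N t f (to_torus x)) \<longlonglongrightarrow> (\<Sum>j. evolved_block t x j)"
    unfolding schroedinger_partial_eq using * by blast
qed

end

text \<open>All coordinates of \<open>x\<close> are slightly to the right of rational multiples of \<open>2 pi\<close> with the same
  denominator. The lower bound \<open>\<rho>\<close> on the distance keeps the evolution of all other blocks under
  control; the bound \<open>L\<close> forces the times \<open>pi/(2q)\<close> to tend to zero.\<close>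

definition resonant :: "nat \<Rightarrow> nat \<Rightarrow> real \<Rightarrow> real ^ 'd \<Rightarrow> bool" where
  "resonant L Q \<rho> x \<longleftrightarrow> (\<exists>q r. L \<le> q \<and> 0 < q \<and> q \<le> Q \<and>
     (\<forall>l. \<rho> \<le> x $ l - 2 * pi * of_int (r l) / real q \<and> x $ l - 2 * pi * of_int (r l) / real q \<le> 3 * \<rho>))"

text \<open>The largest order \<open>K\<close> for which a distance of \<open>3 \<rho>\<close> is at most \<open>1/(4K)\<close>, as the lower bound for
  evolved Fejer kernels requires.\<close>

definition block_size :: "real \<Rightarrow> nat" where
  "block_size \<rho> = nat \<lfloor>1 / (12 * \<rho>)\<rfloor>"

lemma block_size_le: "0 < \<rho> \<Longrightarrow> real (block_size \<rho>) \<le> 1 / (12 * \<rho>)"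
  unfolding block_size_def by simp

text \<open>The conditions that relate a scale \<open>\<rho>\<close> with denominators up to \<open>Q\<close> to the preceding scale
  \<open>\<rho>'\<close>: the lower bound for evolved kernels applies; the block does not disturb the
  resonances at scale \<open>\<rho>'\<close>; and at a resonance the block exceeds all preceding blocks, whose sum is at
  most \<open>2/\<rho>'^n\<close>, by at least \<open>j + 2\<close>, of which the later
  blocks can cancel at most two.\<close>

definition admissible_scale :: "nat \<Rightarrow> real \<Rightarrow> nat \<Rightarrow> real \<Rightarrow> real \<Rightarrow> nat \<Rightarrow> bool" where
  "admissible_scale n s j \<rho>' \<rho> Q \<longleftrightarrow> 0 < Q \<and> 8 * Q \<le> block_size \<rho> \<and> 16 / \<rho>'\<^sup>2 \<le> real (block_size \<rho>) \<and>
     real j + 2 + 2 / \<rho>' ^ n \<le>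
       (1/2) ^ j * real (block_size \<rho>) powr (- (real n / 2 + s)) * (real (block_size \<rho>) / (4 * sqrt (2 * real Q))) ^ n"

text \<open>Each block is adapted to the scale with the same index, and each scale is small compared with the
  preceding one.\<close>

locale resonance = fejer_data c K s f
  for c :: "nat \<Rightarrow> real" and K :: "nat \<Rightarrow> nat" and s :: real and f :: "circle ^ 'd::finite \<Rightarrow> complex" +
  fixes \<rho> :: "nat \<Rightarrow> real" and Q :: "nat \<Rightarrow> nat"
  assumes K_eq: "\<And>j. K j = block_size (\<rho> j)"
    and \<rho>_pos: "\<And>j. 0 < \<rho> j" and \<rho>_decreasing: "decseq \<rho>"
    and admissible: "\<And>j. admissible_scale CARD('d) s (Suc j) (\<rho> j) (\<rho> (Suc j)) (Q (Suc j))"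
begin

lemma later_block_size: "j < i \<Longrightarrow> 16 / (\<rho> j)\<^sup>2 \<le> real (K i)"
proof -
  assume "j < i"
  then obtain i' where i': "i = Suc i'" "j \<le> i'" by (cases i) auto
  have "16 / (\<rho> j)\<^sup>2 \<le> 16 / (\<rho> i')\<^sup>2"
    using i' \<rho>_pos[of j] \<rho>_pos[of i'] \<rho>_decreasing
    by (intro divide_left_mono power_mono) (auto simp: decseq_def less_imp_le)
  then show ?thesis using admissible[of i'] by (simp add: i' admissible_scale_def K_eq)
qed

text \<open>The amplitude is at most \<open>2^-i * K powr (-n/2)\<close>, and the order \<open>K\<close> is at least the square of
  the bound \<open>4/\<rho>\<close> at every preceding scale.\<close>

lemma later_block_bound:
  assumes "j < i"
  shows "c i * (4 / \<rho> j) ^ CARD('d) \<le> (1/2) ^ i"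
proof -
  have "(4 / \<rho> j) ^ CARD('d) = (4 / \<rho> j) powr real CARD('d)"
    using \<rho>_pos[of j] by (simp add: powr_realpow)
  also have "\<dots> = ((4 / \<rho> j) powr 2) powr (real CARD('d) / 2)" by (simp add: powr_powr)
  also have "(4 / \<rho> j) powr 2 = 16 / (\<rho> j)\<^sup>2"
    using \<rho>_pos[of j] by (simp add: powr_numeral power_divide)
  also have "(16 / (\<rho> j)\<^sup>2) powr (real CARD('d) / 2) \<le> real (K i) powr (real CARD('d) / 2)"
    by (intro powr_mono2 later_block_size assms) auto
  also have "\<dots> \<le> real (K i) powr (real CARD('d) / 2 + s)"
    using K_pos[of i] s_nonneg by (intro powr_mono) auto
  finally have "c i * (4 / \<rho> j) ^ CARD('d) \<le> c i * real (K i) powr (real CARD('d) / 2 + s)"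
    by (intro mult_left_mono c_nonneg)
  also have "\<dots> = (1/2) ^ i"
    using K_pos[of i] unfolding c_def mult.assoc powr_add[symmetric] by simp
  finally show ?thesis .
qed

lemma earlier_block_bound:
  assumes "i \<le> j"
  shows "c i * real (K i) ^ CARD('d) \<le> (1/2) ^ i * (1 / \<rho> j ^ CARD('d))"
proof -
  have "real (K i) \<le> 1 / (12 * \<rho> i)" unfolding K_eq by (rule block_size_le[OF \<rho>_pos])
  also have "\<dots> \<le> 1 / \<rho> j"
  proof (rule divide_left_mono)
    have "\<rho> j \<le> \<rho> i" using assms \<rho>_decreasing by (simp add: decseq_def)
    then show "\<rho> j \<le> 12 * \<rho> i" using \<rho>_pos[of i] by linarith
  qed (use \<rho>_pos in auto)
  finally have "real (K i) ^ CARD('d) \<le> (1 / \<rho> j) ^ CARD('d)" by (intro power_mono) auto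
  then have "c i * real (K i) ^ CARD('d) \<le> (1/2) ^ i * (1 / \<rho> j) ^ CARD('d)"
    using \<rho>_pos[of j] by (intro mult_mono c_le) auto
  then show ?thesis by (simp add: power_divide)
qed

text \<open>At the time \<open>pi/(2q)\<close> given by the resonance, the block with index \<open>Suc j\<close> dominates
  the sum of all the others.\<close>

lemma large_at_resonance:
  assumes "resonant (Suc j) (Q (Suc j)) (\<rho> (Suc j)) x"
  obtains t where "0 < t" "t \<le> pi / (2 * real (Suc j))" "t \<in> schroedinger_times f (to_torus x)"
    "real j \<le> cmod (schroedinger t f (to_torus x))"
proof -
  define J where "J = Suc j"
  obtain q r where q: "J \<le> q" "0 < q" "q \<le> Q J"
    and r: "\<And>l. \<rho> J \<le> x $ l - 2 * pi * of_int (r l) / real q" "\<And>l. x $ l - 2 * pi * of_int (r l) / real q \<le> 3 * \<rho> J"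
    using assms unfolding resonant_def J_def[symmetric] by blast
  define t where "t = pi / (2 * real q)"
  define \<eta> where "\<eta> l = x $ l - 2 * pi * of_int (r l) / real q" for l
  have x: "x $ l = 2 * pi * of_int (r l) / real q + \<eta> l" for l by (simp add: \<eta>_def)
  have adm: "8 * Q J \<le> K J"
    "real J + 2 + 2 / \<rho> j ^ CARD('d) \<le> c J * (real (K J) / (4 * sqrt (2 * real (Q J)))) ^ CARD('d)"
    using admissible[of j] by (simp_all add: admissible_scale_def J_def K_eq c_def)
  have K\<rho>: "real (K J) * (12 * \<rho> J) \<le> 1"
    using block_size_le[OF \<rho>_pos, of J] \<rho>_pos[of J] by (simp add: K_eq field_simps)
  have \<eta>: "0 < \<eta> l" "\<rho> J \<le> \<eta> l" "\<bar>\<eta> l\<bar> \<le> 1 / (4 * real (K J))" "2 * real q * \<eta> l \<le> 1" for l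
  proof -
    show 1: "\<rho> J \<le> \<eta> l" and 0: "0 < \<eta> l" using r[of l] \<rho>_pos[of J] by (simp_all add: \<eta>_def)
    have "real (K J) * (4 * \<eta> l) \<le> real (K J) * (12 * \<rho> J)"
      using r[of l] by (intro mult_left_mono) (simp_all add: \<eta>_def)
    then have 2: "real (K J) * (4 * \<eta> l) \<le> 1" using K\<rho> by linarith
    then show "\<bar>\<eta> l\<bar> \<le> 1 / (4 * real (K J))" using 0 K_pos[of J] by (simp add: field_simps)
    have "real (8 * q) * (4 * \<eta> l) \<le> real (K J) * (4 * \<eta> l)"
      using q adm 0 by (intro mult_right_mono) (auto intro: order_trans simp del: of_nat_mult)
    moreover have "real (8 * q) * (4 * \<eta> l) = 16 * (2 * real q * \<eta> l)" by simp
    ultimately have "16 * (2 * real q * \<eta> l) \<le> 1" using 2 by linarith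
    moreover have "0 \<le> 2 * real q * \<eta> l" using 0 by simp
    ultimately show "2 * real q * \<eta> l \<le> 1" by linarith
  qed
  have bound: "cmod (fejer_evolution N (K i) t (x $ l)) \<le> 4 / \<rho> J" for N i l
  proof -
    have "cmod (fejer_evolution N (K i) t (x $ l)) \<le> 4 / \<eta> l"
      unfolding fejer_evolution_def
      by (rule schroedinger_fejer_sum_bound[OF K_pos q(2) \<eta>(1) \<eta>(4) x t_def])
    also have "\<dots> \<le> 4 / \<rho> J" using \<eta> \<rho>_pos[of J] by (intro divide_left_mono) auto
    finally show ?thesis .
  qed
  define b where "b i = evolved_block t x i" for i
  have summable_b: "summable (\<lambda>i. cmod (b i))" and lim: "(\<lambda>N. schroedinger_partial N t f (to_torus x)) \<longlonglongrightarrow> (\<Sum>i. b i)"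
    unfolding b_def by (rule schroedinger_converges[OF bound])+
  have main: "real J + 2 + 2 / \<rho> j ^ CARD('d) \<le> cmod (b J)"
  proof -
    have "(real (K J) / (4 * sqrt (2 * real (Q J)))) ^ CARD('d)
        = (\<Prod>l\<in>(UNIV::'d set). real (K J) / (4 * sqrt (2 * real (Q J))))" by simp
    also have "\<dots> \<le> (\<Prod>l\<in>(UNIV::'d set). cmod (fejer_evolution (K J) (K J) t (x $ l)))"
    proof (intro prod_mono conjI)
      fix l :: 'd
      have "real (K J) / (4 * sqrt (2 * real (Q J))) \<le> real (K J) / (4 * sqrt (2 * real q))"
        using q by (intro divide_left_mono) auto
      also have "\<dots> \<le> cmod (fejer_evolution (K J) (K J) t (x $ l))"
        unfolding fejer_evolution_def
        by (rule schroedinger_fejer_lower_bound[OF q(2) _ order_refl \<eta>(3) x t_def]) (use q adm in linarith)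
      finally show "real (K J) / (4 * sqrt (2 * real (Q J))) \<le> cmod (fejer_evolution (K J) (K J) t (x $ l))" .
    qed simp
    finally have "c J * (real (K J) / (4 * sqrt (2 * real (Q J)))) ^ CARD('d) \<le> cmod (b J)"
      unfolding b_def evolved_block_def norm_block by (intro mult_left_mono c_nonneg)
    then show ?thesis using adm by linarith
  qed
  define C where "C = 1 + 1 / \<rho> j ^ CARD('d)"
  \<comment> \<open>Earlier blocks are bounded trivially by their order, later ones by quasi-periodicity.\<close>
  have rest: "cmod (b i) \<le> (1/2) ^ i * C" if "i \<noteq> J" for i
  proof (cases "i < J")
    case True
    have "(\<Prod>l\<in>(UNIV::'d set). cmod (fejer_evolution (K i) (K i) t (x $ l))) \<le> (\<Prod>l\<in>(UNIV::'d set). real (K i))"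
      unfolding fejer_evolution_def by (intro prod_mono conjI fejer_sum_trivial_bound K_pos) auto
    then have "cmod (b i) \<le> c i * real (K i) ^ CARD('d)"
      unfolding b_def evolved_block_def norm_block by (intro mult_left_mono c_nonneg) simp
    also have "\<dots> \<le> (1/2) ^ i * (1 / \<rho> j ^ CARD('d))"
      using True by (intro earlier_block_bound) (simp add: J_def)
    also have "\<dots> \<le> (1/2) ^ i * C" unfolding C_def by (intro mult_left_mono) auto
    finally show ?thesis .
  next
    case False
    then have "J < i" using that by simp
    have "(\<Prod>l\<in>(UNIV::'d set). cmod (fejer_evolution (K i) (K i) t (x $ l))) \<le> (\<Prod>l\<in>(UNIV::'d set). 4 / \<rho> J)"
      by (intro prod_mono conjI bound) auto
    then have "cmod (b i) \<le> c i * (4 / \<rho> J) ^ CARD('d)"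
      unfolding b_def evolved_block_def norm_block
      by (intro mult_left_mono c_nonneg) simp
    also have "\<dots> \<le> (1/2) ^ i" by (rule later_block_bound[OF \<open>J < i\<close>])
    also have "\<dots> \<le> (1/2) ^ i * C" unfolding C_def using \<rho>_pos[of j] by simp
    finally show ?thesis .
  qed
  define b' where "b' i = (if i = J then 0 else b i)" for i
  have b'_le: "cmod (b' i) \<le> (1/2) ^ i * C" for i
    using rest[of i] \<rho>_pos[of j] by (simp add: b'_def C_def)
  have sm: "summable (\<lambda>i. (1/2) ^ i * C)" by (intro summable_mult2 summable_geometric) auto
  have "summable b'" by (rule summable_comparison_test'[OF sm, of 0]) (use b'_le in auto)
  then have "(\<lambda>i. (if i = J then b J else 0) + b' i) sums (b J + (\<Sum>i. b' i))"
    by (intro sums_add summable_sums sums_single)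
  moreover have "(\<lambda>i. (if i = J then b J else 0) + b' i) = b" by (auto simp: b'_def)
  ultimately have "(\<Sum>i. b i) = b J + (\<Sum>i. b' i)" by (simp add: sums_iff)
  moreover have "cmod (\<Sum>i. b' i) \<le> 2 * C"
  proof -
    have "cmod (\<Sum>i. b' i) \<le> (\<Sum>i. (1/2) ^ i * C)" by (rule norm_suminf_le[OF b'_le sm])
    also have "\<dots> = (\<Sum>i. (1/2) ^ i) * C" by (rule suminf_mult2[symmetric]) (auto intro: summable_geometric)
    finally show ?thesis by (simp add: suminf_geometric)
  qed
  moreover have "cmod (b J) - cmod (\<Sum>i. b' i) \<le> cmod (b J + (\<Sum>i. b' i))"
    by (rule norm_diff_ineq)
  ultimately have "cmod (b J) - 2 * C \<le> cmod (\<Sum>i. b i)" by simp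
  moreover have "2 * C = 2 + 2 / \<rho> j ^ CARD('d)" by (simp add: C_def)
  ultimately have large: "real j \<le> cmod (\<Sum>i. b i)" using main by (simp add: J_def)
  show ?thesis
  proof
    show "0 < t" using q by (simp add: t_def)
    show "t \<le> pi / (2 * real (Suc j))" unfolding t_def using q J_def by (intro divide_left_mono) auto
    show "t \<in> schroedinger_times f (to_torus x)"
      unfolding schroedinger_times_def using lim by (auto intro: convergentI)
    show "real j \<le> cmod (schroedinger t f (to_torus x))"
      unfolding schroedinger_def limI[OF lim] by (rule large)
  qed
qed

theorem limsup_infinite:
  assumes "\<exists>\<^sub>\<infinity>j. resonant j (Q j) (\<rho> j) x"
  shows "Limsup (at 0 within schroedinger_times f (to_torus x))
           (\<lambda>t. ereal (cmod (schroedinger t f (to_torus x)))) = \<infinity>"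
proof (rule ccontr)
  assume "\<not> ?thesis"
  then obtain b :: real where "Limsup (at 0 within schroedinger_times f (to_torus x))
           (\<lambda>t. ereal (cmod (schroedinger t f (to_torus x)))) < ereal b"
    by (metis ereal_dense2 less_PInf_Ex_of_nat neq_PInf_trans order_less_le top_ereal_def top.not_eq_extremum)
  then have "\<forall>\<^sub>F t in at 0 within schroedinger_times f (to_torus x). ereal (cmod (schroedinger t f (to_torus x))) < ereal b"
    by (rule Limsup_lessD)
  then obtain \<delta> where \<delta>: "0 < \<delta>"
    "\<And>t. t \<in> schroedinger_times f (to_torus x) \<Longrightarrow> t \<noteq> 0 \<Longrightarrow> dist t 0 < \<delta> \<Longrightarrow> cmod (schroedinger t f (to_torus x)) < b"
    unfolding eventually_at by auto
  obtain n :: nat where n: "b < real n" "pi / \<delta> < real n"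
    using reals_Archimedean2[of "max b (pi / \<delta>)"] by auto
  obtain j where j: "Suc n \<le> j" "resonant j (Q j) (\<rho> j) x"
    using assms unfolding INFM_nat_le by blast
  obtain j' where j': "j = Suc j'" using j(1) by (cases j) auto
  obtain t where t: "0 < t" "t \<le> pi / (2 * real (Suc j'))" "t \<in> schroedinger_times f (to_torus x)"
    "real j' \<le> cmod (schroedinger t f (to_torus x))"
    using large_at_resonance j(2) unfolding j' by blast
  have "pi < \<delta> * (2 * real (Suc j'))"
  proof -
    have "pi < real n * \<delta>" using n(2) \<delta>(1) by (simp add: field_simps)
    also have "\<dots> \<le> (2 * real (Suc j')) * \<delta>" using j(1) j' \<delta>(1) by (intro mult_right_mono) auto
    finally show ?thesis by (simp add: mult.commute)
  qed
  then have "pi / (2 * real (Suc j')) < \<delta>" by (simp add: field_simps)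
  then have "cmod (schroedinger t f (to_torus x)) < b"
    using t by (intro \<delta>(2)) auto
  then show False using t(4) n(1) j(1) j' by simp
qed

end

section \<open>Hausdorff measure and dimension\<close>

lemma diameter_le_of_dist:
  fixes S :: "'a::metric_space set"
  assumes "0 \<le> D" "\<And>x y. x \<in> S \<Longrightarrow> y \<in> S \<Longrightarrow> dist x y \<le> D"
  shows "bounded S" "diameter S \<le> D"
proof -
  show "bounded S" using assms(2) by (auto simp: bounded_two_points)
  show "diameter S \<le> D"
    unfolding diameter_def using assms by (auto intro!: cSUP_least)
qed

lemma diameter_power_mono:
  assumes "0 \<le> s" "bounded U" "bounded V" "U = {} \<or> V \<noteq> {}" "diameter U \<le> diameter V"
  shows "diameter_power s U \<le> diameter_power s V"
proof -
  have "diameter U powr s \<le> diameter V powr s"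
    by (rule powr_mono2) (use assms diameter_ge_0 in auto)
  then show ?thesis using assms(4) by (auto simp: diameter_power_def ennreal_leI)
qed

lemma hausdorff_premeasure_antimono:
  assumes "\<delta> \<le> \<delta>'"
  shows "hausdorff_premeasure s \<delta>' A \<le> hausdorff_premeasure s \<delta> A"
  unfolding hausdorff_premeasure_def
proof (rule INF_superset_mono)
  show "{U. A \<subseteq> (\<Union>i. U i) \<and> (\<forall>i::nat. bounded (U i) \<and> diameter (U i) \<le> \<delta>)}
      \<subseteq> {U. A \<subseteq> (\<Union>i. U i) \<and> (\<forall>i::nat. bounded (U i) \<and> diameter (U i) \<le> \<delta>')}"
    using order_trans[OF _ assms] by blast
qed simp

lemma hausdorff_premeasure_le_measure:
  "0 < \<delta> \<Longrightarrow> hausdorff_premeasure s \<delta> A \<le> hausdorff_measure s A"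
  unfolding hausdorff_measure_def by (rule SUP_upper) simp

text \<open>Sets of diameter at most one have smaller powers of the diameter for larger exponents.\<close>

lemma hausdorff_premeasure_exponent_antimono:
  assumes "0 \<le> s" "s \<le> t" "\<delta> \<le> 1"
  shows "hausdorff_premeasure t \<delta> A \<le> hausdorff_premeasure s \<delta> A"
  unfolding hausdorff_premeasure_def
proof (rule INF_mono)
  fix U assume U: "U \<in> {U :: nat \<Rightarrow> 'a set. A \<subseteq> (\<Union>i. U i) \<and> (\<forall>i. bounded (U i) \<and> diameter (U i) \<le> \<delta>)}"
  have "diameter_power t (U i) \<le> diameter_power s (U i)" for i
  proof -
    have d: "0 \<le> diameter (U i)" "diameter (U i) \<le> 1"
      using U assms(3) by (auto intro: diameter_ge_0 order_trans)
    have "diameter (U i) powr t \<le> 1" using d assms by (intro powr_le1) auto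
    moreover have "diameter (U i) powr t \<le> diameter (U i) powr s" using d assms by (intro powr_mono') auto
    ultimately show ?thesis using assms by (auto simp: diameter_power_def ennreal_leI)
  qed
  then have "(\<Sum>i. diameter_power t (U i)) \<le> (\<Sum>i. diameter_power s (U i))"
    by (intro suminf_le summableI) auto
  with U show "\<exists>V\<in>{U. A \<subseteq> (\<Union>i. U i) \<and> (\<forall>i. bounded (U i) \<and> diameter (U i) \<le> \<delta>)}.
      (\<Sum>i. diameter_power t (V i)) \<le> (\<Sum>i. diameter_power s (U i))" by blast
qed

lemma hausdorff_measure_zero_mono:
  assumes "0 \<le> s" "s \<le> t" "hausdorff_measure s A = 0"
  shows "hausdorff_measure t A = 0"
proof -
  have "hausdorff_premeasure t \<delta> A \<le> 0" if "0 < \<delta>" for \<delta>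
  proof -
    have "hausdorff_premeasure t \<delta> A \<le> hausdorff_premeasure t (min \<delta> 1) A"
      by (rule hausdorff_premeasure_antimono) simp
    also have "\<dots> \<le> hausdorff_premeasure s (min \<delta> 1) A"
      by (rule hausdorff_premeasure_exponent_antimono) (use assms in auto)
    also have "\<dots> \<le> hausdorff_measure s A"
      by (rule hausdorff_premeasure_le_measure) (use that in simp)
    finally show ?thesis using assms(3) by simp
  qed
  then have "hausdorff_measure t A \<le> 0" unfolding hausdorff_measure_def by (intro SUP_least) auto
  then show ?thesis by simp
qed

text \<open>Positivity at \<open>\<alpha>\<close> excludes smaller exponents, since vanishing of the measure is inherited by
  larger exponents.\<close>

lemma hausdorff_dim_eqI:
  assumes "0 \<le> \<alpha>" "0 < hausdorff_measure \<alpha> A" "\<And>\<beta>. \<alpha> < \<beta> \<Longrightarrow> hausdorff_measure \<beta> A = 0"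
  shows "hausdorff_dim A = ennreal \<alpha>"
proof (rule antisym)
  show "hausdorff_dim A \<le> ennreal \<alpha>"
  proof (rule ennreal_le_epsilon)
    fix e :: real assume "0 < e"
    then have "hausdorff_dim A \<le> ennreal (\<alpha> + e)"
      unfolding hausdorff_dim_def using assms(1,3) by (intro INF_lower) auto
    then show "hausdorff_dim A \<le> ennreal \<alpha> + ennreal e"
      using assms(1) \<open>0 < e\<close> by (simp add: ennreal_plus)
  qed
  show "ennreal \<alpha> \<le> hausdorff_dim A"
    unfolding hausdorff_dim_def
  proof (rule INF_greatest)
    fix s assume s: "s \<in> {s. 0 \<le> s \<and> hausdorff_measure s A = 0}"
    have "\<alpha> \<le> s"
    proof (rule ccontr)
      assume "\<not> \<alpha> \<le> s"
      then have "hausdorff_measure \<alpha> A = 0" using s by (auto intro: hausdorff_measure_zero_mono[of s \<alpha>])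
      then show False using assms(2) by simp
    qed
    then show "ennreal \<alpha> \<le> ennreal s" by (rule ennreal_leI)
  qed
qed

lemma hausdorff_measure_isometric_image_le:
  fixes A :: "'a::metric_space set" and h :: "'a \<Rightarrow> 'b::metric_space"
  assumes "0 \<le> s" "\<And>x y. x \<in> A \<Longrightarrow> y \<in> A \<Longrightarrow> dist (h x) (h y) = dist x y"
  shows "hausdorff_measure s (h ` A) \<le> hausdorff_measure s A"
proof -
  have "hausdorff_premeasure s \<delta> (h ` A) \<le> hausdorff_premeasure s \<delta> A" for \<delta>
    unfolding hausdorff_premeasure_def
  proof (rule INF_mono)
    fix U :: "nat \<Rightarrow> 'a set" assume U: "U \<in> {U. A \<subseteq> (\<Union>i. U i) \<and> (\<forall>i. bounded (U i) \<and> diameter (U i) \<le> \<delta>)}"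
    have d: "bounded (h ` (U i \<inter> A))" "diameter (h ` (U i \<inter> A)) \<le> diameter (U i)" for i
    proof -
      have bd: "bounded (U i)" using U by blast
      have "dist x y \<le> diameter (U i)" if "x \<in> h ` (U i \<inter> A)" "y \<in> h ` (U i \<inter> A)" for x y
        using that assms(2) diameter_bounded_bound[OF bd] by auto
      then show "bounded (h ` (U i \<inter> A))" "diameter (h ` (U i \<inter> A)) \<le> diameter (U i)"
        using diameter_le_of_dist[of "diameter (U i)" "h ` (U i \<inter> A)"] diameter_ge_0[OF bd] by auto
    qed
    have "(\<Sum>i. diameter_power s (h ` (U i \<inter> A))) \<le> (\<Sum>i. diameter_power s (U i))"
      by (intro suminf_le summableI diameter_power_mono assms(1) d) (use U in auto)
    moreover have "diameter (h ` (U i \<inter> A)) \<le> \<delta>" for i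
      using d(2)[of i] U by (auto intro: order_trans)
    moreover have "h ` A \<subseteq> (\<Union>i. h ` (U i \<inter> A))" using U by blast
    ultimately show "\<exists>V\<in>{V. h ` A \<subseteq> (\<Union>i. V i) \<and> (\<forall>i. bounded (V i) \<and> diameter (V i) \<le> \<delta>)}.
        (\<Sum>i. diameter_power s (V i)) \<le> (\<Sum>i. diameter_power s (U i))"
      using d(1) by (intro bexI[of _ "\<lambda>i. h ` (U i \<inter> A)"]) auto
  qed
  then show ?thesis unfolding hausdorff_measure_def by (intro SUP_mono) auto
qed

lemma hausdorff_measure_isometric_image:
  fixes A :: "'a::metric_space set" and h :: "'a \<Rightarrow> 'b::metric_space"
  assumes "0 \<le> s" and iso: "\<And>x y. x \<in> A \<Longrightarrow> y \<in> A \<Longrightarrow> dist (h x) (h y) = dist x y"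
  shows "hausdorff_measure s (h ` A) = hausdorff_measure s A"
proof (rule antisym)
  show "hausdorff_measure s (h ` A) \<le> hausdorff_measure s A"
    by (rule hausdorff_measure_isometric_image_le[OF assms])
  have inj: "inj_on h A" using iso by (metis dist_eq_0_iff inj_onI)
  have "hausdorff_measure s (inv_into A h ` h ` A) \<le> hausdorff_measure s (h ` A)"
    by (rule hausdorff_measure_isometric_image_le[OF assms(1)]) (use inj iso in auto)
  moreover have "inv_into A h ` h ` A = A" using inj by (simp add: inv_into_image_cancel)
  ultimately show "hausdorff_measure s A \<le> hausdorff_measure s (h ` A)" by simp
qed

lemma hausdorff_measure_zeroI:
  fixes A :: "'a::metric_space set"
  assumes \<beta>: "0 < \<beta>"
    and cover: "\<And>\<delta> \<epsilon>. 0 < \<delta> \<Longrightarrow> 0 < \<epsilon> \<Longrightarrow> \<exists>T r. finite T \<and> 0 < r \<and> 2 * r \<le> \<delta> \<and> A \<subseteq> (\<Union>c\<in>T. cball c r)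
        \<and> real (card T) * (2 * r) powr \<beta> \<le> \<epsilon>"
  shows "hausdorff_measure \<beta> A = 0"
proof -
  have "hausdorff_premeasure \<beta> \<delta> A \<le> 0" if \<delta>: "0 < \<delta>" for \<delta>
  proof (rule ennreal_le_epsilon)
    fix \<epsilon> :: real assume "0 < \<epsilon>"
    then obtain T r where T: "finite T" "0 < r" "2 * r \<le> \<delta>" "A \<subseteq> (\<Union>c\<in>T. cball c r)"
      "real (card T) * (2 * r) powr \<beta> \<le> \<epsilon>"
      using cover[OF \<delta>] by blast
    obtain h where h: "bij_betw h {..<card T} T"
      using ex_bij_betw_nat_finite[OF T(1)] by (metis lessThan_atLeast0)
    define U where "U i = (if i < card T then cball (h i) r else {})" for i
    have d: "bounded (U i)" "diameter (U i) \<le> 2 * r" for i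
    proof -
      have "dist x y \<le> 2 * r" if "x \<in> U i" "y \<in> U i" for x y
        using that dist_triangle3[of x y "h i"] by (auto simp: U_def split: if_splits)
      then show "bounded (U i)" "diameter (U i) \<le> 2 * r"
        using diameter_le_of_dist[of "2 * r" "U i"] T(2) by auto
    qed
    have pow: "diameter_power \<beta> (U i) \<le> ennreal ((2 * r) powr \<beta>)" for i
      using d[of i] \<beta> T(2)
      by (auto simp: diameter_power_def intro!: ennreal_leI powr_mono2 diameter_ge_0)
    have "A \<subseteq> (\<Union>i. U i)"
    proof
      fix x assume "x \<in> A"
      then obtain c where c: "c \<in> T" "x \<in> cball c r" using T(4) by blast
      have "c \<in> h ` {..<card T}" using c h by (simp add: bij_betw_def)
      then obtain i where "i < card T" "h i = c" by blast
      then show "x \<in> (\<Union>i. U i)" using c by (auto simp: U_def)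
    qed
    then have "hausdorff_premeasure \<beta> \<delta> A \<le> (\<Sum>i. diameter_power \<beta> (U i))"
      unfolding hausdorff_premeasure_def using d T(3) by (intro INF_lower) (auto intro: order_trans)
    also have "\<dots> = (\<Sum>i<card T. diameter_power \<beta> (U i))"
      by (rule suminf_finite) (auto simp: U_def diameter_power_def)
    also have "\<dots> \<le> (\<Sum>i<card T. ennreal ((2 * r) powr \<beta>))" by (rule sum_mono[OF pow])
    also have "\<dots> = ennreal (real (card T) * (2 * r) powr \<beta>)"
      by (simp add: ennreal_mult ennreal_of_nat_eq_real_of_nat)
    also have "\<dots> \<le> ennreal \<epsilon>" by (rule ennreal_leI[OF T(5)])
    finally show "hausdorff_premeasure \<beta> \<delta> A \<le> 0 + ennreal \<epsilon>" by simp
  qed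
  then have "hausdorff_measure \<beta> A \<le> 0" unfolding hausdorff_measure_def by (intro SUP_least) auto
  then show ?thesis by simp
qed

lemma hausdorff_measure_posI:
  fixes A :: "'a::metric_space set"
  assumes "0 < c" and "\<And>U. A \<subseteq> (\<Union>i. U i) \<Longrightarrow> (\<And>i::nat. bounded (U i)) \<Longrightarrow> c \<le> (\<Sum>i. diameter_power s (U i))"
  shows "0 < hausdorff_measure s A"
proof -
  have "c \<le> hausdorff_premeasure s 1 A"
    unfolding hausdorff_premeasure_def using assms(2) by (intro INF_greatest) auto
  also have "\<dots> \<le> hausdorff_measure s A" by (rule hausdorff_premeasure_le_measure) simp
  finally show ?thesis using assms(1) by simp
qed

text \<open>Volume comparison: the balls of radius \<open>\<delta>/2\<close> around the points are disjoint and lie in one ball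
  of radius \<open>u + \<delta>/2\<close>.\<close>

lemma card_separated_le:
  fixes A :: "'a::euclidean_space set"
  assumes "finite A" "0 < \<delta>" "0 \<le> u"
    and sep: "\<And>x y. x \<in> A \<Longrightarrow> y \<in> A \<Longrightarrow> x \<noteq> y \<Longrightarrow> \<delta> \<le> dist x y"
    and close: "\<And>x y. x \<in> A \<Longrightarrow> y \<in> A \<Longrightarrow> dist x y \<le> u"
  shows "real (card A) \<le> (1 + 2 * u / \<delta>) ^ DIM('a)"
proof (cases "A = {}")
  case False
  then obtain a where a: "a \<in> A" by blast
  define v where "v = unit_ball_vol (real DIM('a))"
  have v: "0 < v" by (simp add: v_def)
  have "disjoint_family_on (\<lambda>x. ball x (\<delta> / 2)) A"
    unfolding disjoint_family_on_def
  proof (intro ballI impI)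
    fix x y assume "x \<in> A" "y \<in> A" "x \<noteq> y"
    then have "\<delta> / 2 + \<delta> / 2 \<le> dist x y" using sep by simp
    then show "ball x (\<delta> / 2) \<inter> ball y (\<delta> / 2) = {}" by (rule disjoint_ballI)
  qed
  then have "measure lborel (\<Union>x\<in>A. ball x (\<delta> / 2)) = (\<Sum>x\<in>A. measure lborel (ball x (\<delta> / 2)))"
    by (intro measure_finite_Union assms(1)) (use emeasure_lborel_ball_finite in \<open>auto simp: less_top[symmetric] infinity_ennreal_def\<close>)
  also have "\<dots> = real (card A) * (v * (\<delta> / 2) ^ DIM('a))"
    using assms(2) by (simp add: content_ball v_def)
  finally have "real (card A) * (v * (\<delta> / 2) ^ DIM('a)) = measure lborel (\<Union>x\<in>A. ball x (\<delta> / 2))" by simp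
  also have "\<dots> \<le> measure lborel (ball a (u + \<delta> / 2))"
  proof (rule measure_mono_fmeasurable)
    show "(\<Union>x\<in>A. ball x (\<delta> / 2)) \<subseteq> ball a (u + \<delta> / 2)"
    proof
      fix z assume "z \<in> (\<Union>x\<in>A. ball x (\<delta> / 2))"
      then obtain x where "x \<in> A" "dist x z < \<delta> / 2" by auto
      then show "z \<in> ball a (u + \<delta> / 2)" using close[OF a \<open>x \<in> A\<close>] dist_triangle[of a z x] by simp
    qed
    show "(\<Union>x\<in>A. ball x (\<delta> / 2)) \<in> sets lborel"
      unfolding sets_lborel by (intro borel_open open_UN ballI open_ball)
    show "ball a (u + \<delta> / 2) \<in> fmeasurable lborel"
      by (intro fmeasurableI emeasure_lborel_ball_finite) simp
  qed
  also have "\<dots> = v * (u + \<delta> / 2) ^ DIM('a)" using assms by (simp add: content_ball v_def)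
  finally have "real (card A) * (\<delta> / 2) ^ DIM('a) \<le> (u + \<delta> / 2) ^ DIM('a)" using v by (simp add: mult.left_commute)
  then have "real (card A) \<le> (u + \<delta> / 2) ^ DIM('a) / (\<delta> / 2) ^ DIM('a)"
    using assms(2) by (simp add: pos_le_divide_eq)
  also have "\<dots> = (1 + 2 * u / \<delta>) ^ DIM('a)"
  proof -
    have "(u + \<delta> / 2) / (\<delta> / 2) = 1 + 2 * u / \<delta>" using assms(2) by (simp add: field_simps)
    then show ?thesis by (metis power_divide)
  qed
  finally show ?thesis .
qed (use assms in simp)

text \<open>A separated subset of maximal cardinality is a net.\<close>

lemma maximal_separated_subset:
  assumes "\<And>x y. close x y \<Longrightarrow> close y x" "\<And>x. close x x"
    and bound: "\<And>S. finite S \<Longrightarrow> S \<subseteq> A \<Longrightarrow> pairwise (\<lambda>x y. \<not> close x y) S \<Longrightarrow> card S \<le> N"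
  obtains S where "finite S" "S \<subseteq> A" "pairwise (\<lambda>x y. \<not> close x y) S" "\<And>x. x \<in> A \<Longrightarrow> \<exists>y\<in>S. close y x"
proof -
  define sep where "sep S \<longleftrightarrow> finite S \<and> S \<subseteq> A \<and> pairwise (\<lambda>x y. \<not> close x y) S" for S
  have "sep {}" by (simp add: sep_def)
  moreover have "card S < Suc N" if "sep S" for S using that bound by (simp add: sep_def less_Suc_eq_le)
  ultimately obtain S where S: "sep S" "\<And>S'. sep S' \<Longrightarrow> card S' \<le> card S"
    using ex_has_greatest_nat[of sep "{}" card] by blast
  show thesis
  proof (rule that)
    show "finite S" "S \<subseteq> A" "pairwise (\<lambda>x y. \<not> close x y) S" using S(1) by (simp_all add: sep_def)
    fix x assume x: "x \<in> A"
    show "\<exists>y\<in>S. close y x"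
    proof (rule ccontr)
      assume far: "\<not> (\<exists>y\<in>S. close y x)"
      then have "x \<notin> S" using assms(2) by blast
      have "sep (insert x S)" using S(1) x far assms(1) by (auto simp: sep_def pairwise_insert)
      then have "card (insert x S) \<le> card S" by (rule S(2))
      then show False using \<open>x \<notin> S\<close> S(1) by (simp add: sep_def)
    qed
  qed
qed

text \<open>Volume comparison bounds maximal \<open>r\<close>-separated sets by \<open>O(r powr -n)\<close> points.\<close>

lemma hausdorff_measure_bounded_zero:
  fixes A :: "'a::euclidean_space set"
  assumes "bounded A" and \<beta>: "real DIM('a) < \<beta>"
  shows "hausdorff_measure \<beta> A = 0"
proof (rule hausdorff_measure_zeroI)
  define n where "n = DIM('a)"
  show "0 < \<beta>" using \<beta> by (simp add: order_le_less_trans[OF of_nat_0_le_iff])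
  obtain u where u: "1 \<le> u" "\<And>x y. x \<in> A \<Longrightarrow> y \<in> A \<Longrightarrow> dist x y \<le> u"
  proof -
    obtain e where "\<And>x y. x \<in> A \<Longrightarrow> y \<in> A \<Longrightarrow> dist x y \<le> e" using assms(1) by (auto simp: bounded_two_points)
    then show ?thesis by (intro that[of "max 1 e"]) (auto intro: le_max_iff_disj[THEN iffD2])
  qed
  fix \<delta> \<epsilon> :: real assume \<delta>: "0 < \<delta>" and \<epsilon>: "0 < \<epsilon>"
  have "((\<lambda>r. (3 * u) ^ n * 2 powr \<beta> * r powr (\<beta> - real n)) \<longlongrightarrow> (3 * u) ^ n * 2 powr \<beta> * 0 powr (\<beta> - real n)) (at_right 0)"
    using \<beta> by (intro tendsto_intros tendsto_powr') (auto simp: n_def eventually_at_right_field intro!: exI[of _ 1])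
  then have "\<forall>\<^sub>F r in at_right 0. (3 * u) ^ n * 2 powr \<beta> * r powr (\<beta> - real n) < \<epsilon>"
    using \<epsilon> by (intro order_tendstoD(2)) auto
  moreover have "\<forall>\<^sub>F r in at_right 0. r < min 1 (\<delta> / 2)"
    using \<delta> by (intro order_tendstoD(2)[OF tendsto_ident_at]) auto
  moreover have "\<forall>\<^sub>F r::real in at_right 0. 0 < r" by (rule eventually_at_right_less)
  ultimately have "\<forall>\<^sub>F r in at_right 0. (3 * u) ^ n * 2 powr \<beta> * r powr (\<beta> - real n) < \<epsilon> \<and> r < min 1 (\<delta> / 2) \<and> 0 < r"
    by eventually_elim simp
  then obtain r where r: "(3 * u) ^ n * 2 powr \<beta> * r powr (\<beta> - real n) < \<epsilon>" "r < 1" "r < \<delta> / 2" "0 < r"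
    using eventually_happens[of _ "at_right (0::real)"] by fastforce
  have card_le: "real (card S) \<le> (3 * u / r) ^ n"
    if S: "finite S" "S \<subseteq> A" "pairwise (\<lambda>x y. \<not> dist x y < r) S" for S
  proof -
    have "real (card S) \<le> (1 + 2 * u / r) ^ n"
      unfolding n_def using S r u by (intro card_separated_le) (auto simp: pairwise_def not_less subset_eq)
    also have "\<dots> \<le> (3 * u / r) ^ n" using u r by (intro power_mono) (auto simp: field_simps)
    finally show ?thesis .
  qed
  obtain S where S: "finite S" "S \<subseteq> A" "pairwise (\<lambda>x y. \<not> dist x y < r) S"
    "\<And>x. x \<in> A \<Longrightarrow> \<exists>y\<in>S. dist y x < r"
    by (rule maximal_separated_subset[of "\<lambda>x y. dist x y < r" A "nat \<lfloor>(3 * u / r) ^ n\<rfloor>"])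
      (use r card_le in \<open>auto simp: dist_commute intro: le_nat_floor\<close>)
  have "A \<subseteq> (\<Union>c\<in>S. cball c r)" using S(4) by (force intro: less_imp_le)
  moreover have "real (card S) * (2 * r) powr \<beta> \<le> \<epsilon>"
  proof -
    have "real (card S) * (2 * r) powr \<beta> \<le> (3 * u / r) ^ n * (2 * r) powr \<beta>"
      by (intro mult_right_mono card_le S(1-3)) auto
    also have "\<dots> = (3 * u) ^ n * 2 powr \<beta> * r powr (\<beta> - real n)"
      using r by (simp add: power_divide powr_mult powr_diff powr_realpow)
    finally show ?thesis using r by linarith
  qed
  ultimately show "\<exists>T r. finite T \<and> 0 < r \<and> 2 * r \<le> \<delta> \<and> A \<subseteq> (\<Union>c\<in>T. cball c r) \<and> real (card T) * (2 * r) powr \<beta> \<le> \<epsilon>"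
    using S(1) r by (intro exI[of _ S] exI[of _ r]) auto
qed

section \<open>Cantor sets with uniform branching\<close>

text \<open>Stage \<open>j\<close> of the construction consists of the closed balls of radius \<open>\<rho> j\<close> around the points of
  \<open>T j\<close>. No ball of a stage contains more than the average number of points of the next one, so the
  uniform mass distribution gives each ball of stage \<open>j\<close> at most the mass \<open>1 / card (T j)\<close>, which by
  \<open>mass\<close> is \<open>\<rho> j powr \<alpha> / \<Lambda>\<close>. The
  condition \<open>many\<close> says that the children fill their parent up to a constant factor at the scale of
  their separation. The ratios of consecutive radii may be arbitrarily small, which
  the choice of lacunary scales requires.\<close>

locale uniform_cantor =
  fixes T :: "nat \<Rightarrow> 'a::euclidean_space set" and \<rho> \<delta> :: "nat \<Rightarrow> real" and \<alpha> \<kappa> \<Lambda> :: real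
  assumes finite_T: "\<And>j. finite (T j)" and T_nonempty: "\<And>j. T j \<noteq> {}"
    and \<rho>_pos: "\<And>j. 0 < \<rho> j" and \<rho>_decreasing: "decseq \<rho>" and \<rho>_lim: "\<rho> \<longlonglongrightarrow> 0"
    and nested: "\<And>j c. c \<in> T (Suc j) \<Longrightarrow> \<exists>b\<in>T j. cball c (\<rho> (Suc j)) \<subseteq> cball b (\<rho> j)"
    and children: "\<And>j b. b \<in> T j \<Longrightarrow> card (T (Suc j) \<inter> cball b (\<rho> j)) * card (T j) \<le> card (T (Suc j))"
    and separated: "\<And>j x y. x \<in> T j \<Longrightarrow> y \<in> T j \<Longrightarrow> x \<noteq> y \<Longrightarrow> \<delta> j \<le> dist x y"
    and gap: "\<And>j. 2 * \<rho> j < \<delta> j"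
    and mass: "\<And>j. real (card (T j)) * \<rho> j powr \<alpha> = \<Lambda>"
    and many: "\<And>j. \<kappa> * (\<rho> j / \<delta> (Suc j)) ^ DIM('a) * real (card (T j)) \<le> real (card (T (Suc j)))"
    and \<kappa>_pos: "0 < \<kappa>" and \<alpha>_pos: "0 < \<alpha>" and \<alpha>_le: "\<alpha> \<le> real DIM('a)"
begin

definition E :: "nat \<Rightarrow> 'a set" where
  "E j = (\<Union>c\<in>T j. cball c (\<rho> j))"

definition cantor_set :: "'a set" where
  "cantor_set = (\<Inter>j. E j)"

lemma card_T_pos: "0 < card (T j)"
  using finite_T T_nonempty by (simp add: card_gt_0_iff)

lemma \<Lambda>_pos: "0 < \<Lambda>"
  using card_T_pos[of 0] \<rho>_pos[of 0] unfolding mass[of 0, symmetric] by simp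

lemma center_mem: "c \<in> cball c (\<rho> j)"
  using \<rho>_pos[of j] by simp

lemma T_subset_E: "T j \<subseteq> E j"
  using center_mem unfolding E_def by blast

lemma E_antimono: "i \<le> j \<Longrightarrow> E j \<subseteq> E i"
proof (rule lift_Suc_antimono_le[of E])
  fix n show "E (Suc n) \<subseteq> E n" using nested[of _ n] by (fastforce simp: E_def)
qed

lemma compact_E: "compact (E j)"
  unfolding E_def by (intro compact_UN finite_T compact_cball)

lemma ancestor: "b \<in> T (j + n) \<Longrightarrow> \<exists>a\<in>T j. cball b (\<rho> (j + n)) \<subseteq> cball a (\<rho> j)"
proof (induction n arbitrary: b)
  case (Suc n)
  then obtain b' where "b' \<in> T (j + n)" "cball b (\<rho> (j + Suc n)) \<subseteq> cball b' (\<rho> (j + n))"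
    using nested[of b "j + n"] by auto
  then show ?case using Suc.IH[of b'] by blast
qed auto

text \<open>Induction on \<open>n\<close>: a point of stage \<open>j + n + 1\<close> in the ball has its parent in the same ball, because
  the balls of stage \<open>j\<close> are disjoint.\<close>

lemma descendants:
  assumes a: "a \<in> T j"
  shows "card (T (j + n) \<inter> cball a (\<rho> j)) * card (T j) \<le> card (T (j + n))"
proof (induction n)
  case 0
  have "T j \<inter> cball a (\<rho> j) \<subseteq> {a}"
  proof
    fix x assume "x \<in> T j \<inter> cball a (\<rho> j)"
    then show "x \<in> {a}" using separated[OF a, of x] gap[of j] \<rho>_pos[of j] by auto
  qed
  then have "card (T j \<inter> cball a (\<rho> j)) \<le> card {a}" by (intro card_mono) auto
  then show ?case by simp
next
  case (Suc n)
  define S where "S = T (j + n) \<inter> cball a (\<rho> j)"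
  have sub: "T (j + Suc n) \<inter> cball a (\<rho> j) \<subseteq> (\<Union>b\<in>S. T (Suc (j + n)) \<inter> cball b (\<rho> (j + n)))"
  proof
    fix c assume c: "c \<in> T (j + Suc n) \<inter> cball a (\<rho> j)"
    then obtain b where b: "b \<in> T (j + n)" "cball c (\<rho> (Suc (j + n))) \<subseteq> cball b (\<rho> (j + n))"
      using nested[of c "j + n"] by auto
    have cb: "c \<in> cball b (\<rho> (j + n))" using b(2) center_mem by blast
    obtain a' where a': "a' \<in> T j" "cball b (\<rho> (j + n)) \<subseteq> cball a' (\<rho> j)" using ancestor[OF b(1)] by blast
    have "dist a' c \<le> \<rho> j" using a'(2) cb by auto
    moreover have "dist a c \<le> \<rho> j" using c by simp
    ultimately have "dist a a' \<le> 2 * \<rho> j" using dist_triangle2[of a a' c] by simp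
    then have "\<not> \<delta> j \<le> dist a a'" using gap[of j] by linarith
    then have "a = a'" using separated[OF a a'(1)] by blast
    then have "b \<in> S" using b(1) a'(2) center_mem unfolding S_def by blast
    then show "c \<in> (\<Union>b\<in>S. T (Suc (j + n)) \<inter> cball b (\<rho> (j + n)))" using c cb by auto
  qed
  have "card (T (j + Suc n) \<inter> cball a (\<rho> j)) \<le> card (\<Union>b\<in>S. T (Suc (j + n)) \<inter> cball b (\<rho> (j + n)))"
    using finite_T by (intro card_mono sub) (auto simp: S_def)
  also have "\<dots> \<le> (\<Sum>b\<in>S. card (T (Suc (j + n)) \<inter> cball b (\<rho> (j + n))))"
    using finite_T by (intro card_UN_le) (auto simp: S_def)
  finally have "card (T (j + Suc n) \<inter> cball a (\<rho> j)) * card (T (j + n))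
      \<le> (\<Sum>b\<in>S. card (T (Suc (j + n)) \<inter> cball b (\<rho> (j + n))) * card (T (j + n)))"
    by (simp add: sum_distrib_right[symmetric])
  also have "\<dots> \<le> (\<Sum>b\<in>S. card (T (j + Suc n)))"
    using children by (intro sum_mono) (auto simp: S_def)
  also have "\<dots> = card S * card (T (j + Suc n))" by simp
  finally have "card (T (j + Suc n) \<inter> cball a (\<rho> j)) * card (T (j + n)) * card (T j)
      \<le> card S * card (T (j + Suc n)) * card (T j)" by (rule mult_right_mono) simp
  also have "\<dots> = (card S * card (T j)) * card (T (j + Suc n))" by (simp add: mult_ac)
  also have "\<dots> \<le> card (T (j + n)) * card (T (j + Suc n))"
    using Suc.IH unfolding S_def by (rule mult_right_mono) simp
  finally have "card (T (j + n)) * (card (T (j + Suc n) \<inter> cball a (\<rho> j)) * card (T j))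
      \<le> card (T (j + n)) * card (T (j + Suc n))" by (simp add: mult_ac)
  then show ?case using card_T_pos[of "j + n"] by simp
qed

text \<open>The sum of the constants for the three ranges of diameters in the mass estimate: above \<open>\<rho> 0\<close>,
  between a radius and the separation of its stage, and between this separation and the preceding radius.\<close>

definition frostman_const :: real where
  "frostman_const = \<rho> 0 powr - \<alpha> + 7 ^ DIM('a) / \<Lambda> + 7 ^ DIM('a) / (\<kappa> * \<Lambda>)"

lemma frostman_const_ge:
  "0 < frostman_const" "\<rho> 0 powr - \<alpha> \<le> frostman_const" "7 ^ DIM('a) / \<Lambda> \<le> frostman_const"
  "7 ^ DIM('a) / (\<kappa> * \<Lambda>) \<le> frostman_const"
proof -
  have "0 < \<rho> 0 powr - \<alpha>" "0 < 7 ^ DIM('a) / \<Lambda>" "0 < 7 ^ DIM('a) / (\<kappa> * \<Lambda>)"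
    using \<rho>_pos[of 0] \<Lambda>_pos \<kappa>_pos by auto
  then show "0 < frostman_const" "\<rho> 0 powr - \<alpha> \<le> frostman_const" "7 ^ DIM('a) / \<Lambda> \<le> frostman_const"
    "7 ^ DIM('a) / (\<kappa> * \<Lambda>) \<le> frostman_const" unfolding frostman_const_def by linarith+
qed

text \<open>The mass distribution estimate, for counting measures of finite stages. Let \<open>\<rho> k \<le> u < \<rho> i\<close>
  with \<open>k = Suc i\<close>. If \<open>u\<close> is below the separation \<open>\<delta> k\<close>, then \<open>V\<close> meets boundedly many balls of
  stage \<open>k\<close>, each of mass at most \<open>u powr \<alpha> / \<Lambda>\<close>. Otherwise it meets \<open>O((u / \<delta> k)^n)\<close> of them, and
  by \<open>many\<close> their mass is \<open>O((u / \<rho> i)^n)\<close> times the mass of a ball of stage \<open>i\<close>; since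
  \<open>u < \<rho> i\<close>, the exponent \<open>n\<close> may be lowered to \<open>\<alpha>\<close>.\<close>

lemma frostman:
  assumes u: "\<rho> J \<le> u" and V: "\<And>x y. x \<in> V \<Longrightarrow> y \<in> V \<Longrightarrow> dist x y \<le> u"
  shows "real (card (T J \<inter> V)) \<le> frostman_const * real (card (T J)) * u powr \<alpha>"
proof -
  have u_pos: "0 < u" using u \<rho>_pos[of J] by linarith
  have le_card: "real (card (T J \<inter> V)) \<le> real (card (T J))"
    using finite_T by (simp add: card_mono)
  show ?thesis
  proof (cases "\<rho> 0 \<le> u")
    case True
    have "1 = \<rho> 0 powr - \<alpha> * \<rho> 0 powr \<alpha>" using \<rho>_pos[of 0] by (simp flip: powr_add)
    also have "\<dots> \<le> frostman_const * u powr \<alpha>"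
      using True \<rho>_pos[of 0] \<alpha>_pos frostman_const_ge by (intro mult_mono powr_mono2) auto
    finally have "real (card (T J)) * 1 \<le> real (card (T J)) * (frostman_const * u powr \<alpha>)"
      by (intro mult_left_mono) auto
    then show ?thesis using le_card by (simp add: mult_ac)
  next
    case False
    \<comment> \<open>The first stage whose balls are no larger than \<open>V\<close>.\<close>
    define k where "k = (LEAST j. \<rho> j \<le> u)"
    have k: "\<rho> k \<le> u" "k \<le> J" unfolding k_def using u by (auto intro: LeastI Least_le)
    have "k \<noteq> 0" using k False by (cases k) auto
    then obtain i where i: "k = Suc i" by (cases k) auto
    have ui: "u < \<rho> i" using not_less_Least[of i "\<lambda>j. \<rho> j \<le> u"] i by (auto simp: k_def)
    define A where "A = {a \<in> T k. \<exists>c\<in>T J \<inter> V. dist a c \<le> \<rho> k}"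
    have fin_A: "finite A" using finite_T by (simp add: A_def)
    have sub: "T J \<inter> V \<subseteq> (\<Union>a\<in>A. T J \<inter> cball a (\<rho> k))"
    proof
      fix c assume c: "c \<in> T J \<inter> V"
      then obtain a where a: "a \<in> T k" "cball c (\<rho> J) \<subseteq> cball a (\<rho> k)"
        using ancestor[of c k "J - k"] k(2) by auto
      then have "c \<in> cball a (\<rho> k)" using center_mem by blast
      then have "dist a c \<le> \<rho> k" by simp
      then show "c \<in> (\<Union>a\<in>A. T J \<inter> cball a (\<rho> k))" using a c by (auto simp: A_def)
    qed
    have "card (T J \<inter> V) \<le> card (\<Union>a\<in>A. T J \<inter> cball a (\<rho> k))"
      using finite_T fin_A by (intro card_mono sub) auto
    also have "\<dots> \<le> (\<Sum>a\<in>A. card (T J \<inter> cball a (\<rho> k)))" by (rule card_UN_le[OF fin_A])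
    finally have "card (T J \<inter> V) * card (T k) \<le> (\<Sum>a\<in>A. card (T J \<inter> cball a (\<rho> k)) * card (T k))"
      by (simp add: sum_distrib_right[symmetric])
    also have "\<dots> \<le> (\<Sum>a\<in>A. card (T J))"
      using descendants[of _ k "J - k"] k(2) by (intro sum_mono) (auto simp: A_def)
    finally have "card (T J \<inter> V) * card (T k) \<le> card A * card (T J)" by simp
    then have count: "real (card (T J \<inter> V)) * real (card (T k)) \<le> real (card A) * real (card (T J))"
      by (metis of_nat_le_iff of_nat_mult)
    have \<delta>_pos: "0 < \<delta> k" using gap[of k] \<rho>_pos[of k] by linarith
    have "dist a a' \<le> 3 * u" if aa: "a \<in> A" "a' \<in> A" for a a'
    proof -
      obtain c c' where c: "c \<in> V" "c' \<in> V" "dist a c \<le> \<rho> k" "dist a' c' \<le> \<rho> k"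
        using aa by (auto simp: A_def)
      have "dist a a' \<le> dist a c + dist c c' + dist a' c'"
        using dist_triangle[of a a' c] dist_triangle2[of c a' c'] by linarith
      then show ?thesis using c V[of c c'] k(1) by linarith
    qed
    then have "real (card A) \<le> (1 + 2 * (3 * u) / \<delta> k) ^ DIM('a)"
      using fin_A \<delta>_pos u_pos separated by (intro card_separated_le) (auto simp: A_def)
    also have "\<dots> \<le> (7 * max 1 (u / \<delta> k)) ^ DIM('a)"
    proof (rule power_mono)
      have "1 + 6 * (u / \<delta> k) \<le> 7 * max 1 (u / \<delta> k)" by linarith
      then show "1 + 2 * (3 * u) / \<delta> k \<le> 7 * max 1 (u / \<delta> k)" by simp
    qed (use u_pos \<delta>_pos in auto)
    finally have card_A: "real (card A) \<le> 7 ^ DIM('a) * max 1 (u / \<delta> k) ^ DIM('a)"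
      by (simp add: power_mult_distrib)
    have goal: "real (card A) \<le> frostman_const * real (card (T k)) * u powr \<alpha>"
    proof (cases "u \<le> \<delta> k")
      case True
      have "max 1 (u / \<delta> k) = 1" using True \<delta>_pos by simp
      then have "real (card A) \<le> 7 ^ DIM('a)" using card_A by simp
      also have "\<dots> = 7 ^ DIM('a) / \<Lambda> * (real (card (T k)) * \<rho> k powr \<alpha>)"
        unfolding mass using \<Lambda>_pos by simp
      also have "\<dots> \<le> frostman_const * (real (card (T k)) * u powr \<alpha>)"
        using k(1) \<rho>_pos[of k] \<alpha>_pos \<Lambda>_pos frostman_const_ge
        by (intro mult_mono powr_mono2 order_refl) auto
      finally show ?thesis by (simp add: mult_ac)
    next
      case False
      have "max 1 (u / \<delta> k) = \<rho> i / \<delta> k * (u / \<rho> i)" using False \<delta>_pos \<rho>_pos[of i] by simp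
      then have "real (card A) \<le> 7 ^ DIM('a) * ((\<rho> i / \<delta> k) ^ DIM('a) * (u / \<rho> i) ^ DIM('a))"
        using card_A by (simp only: power_mult_distrib)
      also have "\<dots> \<le> 7 ^ DIM('a) * ((\<rho> i / \<delta> k) ^ DIM('a) * (u / \<rho> i) powr \<alpha>)"
      proof -
        have "(u / \<rho> i) powr real DIM('a) \<le> (u / \<rho> i) powr \<alpha>"
          using u_pos ui \<rho>_pos[of i] \<alpha>_le by (intro powr_mono') auto
        moreover have "(u / \<rho> i) powr real DIM('a) = (u / \<rho> i) ^ DIM('a)"
          using u_pos \<rho>_pos[of i] by (intro powr_realpow) simp
        ultimately show ?thesis using \<rho>_pos[of i] \<delta>_pos by (intro mult_left_mono) auto
      qed
      also have "\<dots> = 7 ^ DIM('a) / (\<kappa> * \<Lambda>) * (\<kappa> * (\<rho> i / \<delta> k) ^ DIM('a) * real (card (T i))) * u powr \<alpha>"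
      proof -
        have "(u / \<rho> i) powr \<alpha> = u powr \<alpha> / \<rho> i powr \<alpha>"
          by (rule powr_divide)
        also have "\<dots> = real (card (T i)) * u powr \<alpha> / \<Lambda>"
          unfolding mass[of i, symmetric] using card_T_pos[of i] by simp
        finally have eq: "(u / \<rho> i) powr \<alpha> = real (card (T i)) * u powr \<alpha> / \<Lambda>" .
        show ?thesis unfolding eq using \<kappa>_pos by simp
      qed
      also have "\<dots> \<le> frostman_const * real (card (T k)) * u powr \<alpha>"
        using many[of i] \<kappa>_pos \<rho>_pos[of i] \<delta>_pos frostman_const_ge
        by (intro mult_right_mono mult_mono) (auto simp: i)
      finally show ?thesis .
    qed
    have "real (card (T J \<inter> V)) * real (card (T k)) \<le> (frostman_const * real (card (T k)) * u powr \<alpha>) * real (card (T J))"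
      by (rule order_trans[OF count mult_right_mono[OF goal]]) simp
    then have "real (card (T k)) * real (card (T J \<inter> V)) \<le> real (card (T k)) * (frostman_const * real (card (T J)) * u powr \<alpha>)"
      by (simp add: mult_ac)
    then show ?thesis using card_T_pos[of k] by simp
  qed
qed

text \<open>Enlarging the covering sets slightly makes them open and their sizes positive. By
  compactness finitely many of them cover a whole stage, and a still later stage is fine enough for the
  counting estimate.\<close>

lemma cover_sum_ge:
  fixes U :: "nat \<Rightarrow> 'a set"
  assumes cover: "cantor_set \<subseteq> (\<Union>i. U i)" and bdd: "\<And>i. bounded (U i)"
  shows "ennreal (1 / (2 * frostman_const)) \<le> (\<Sum>i. diameter_power \<alpha> (U i))"
proof -
  define \<epsilon> where "\<epsilon> = 1 / (2 * frostman_const)"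
  have \<epsilon>: "0 < \<epsilon>" using frostman_const_ge(1) by (simp add: \<epsilon>_def)
  define D where "D i = diameter (U i)" for i
  have D: "0 \<le> D i" for i unfolding D_def by (rule diameter_ge_0[OF bdd])
  have "\<exists>e>0. (D i + 2 * e) powr \<alpha> \<le> D i powr \<alpha> + \<epsilon> * (1/2) ^ Suc i" for i
  proof -
    have "((\<lambda>e. (D i + 2 * e) powr \<alpha>) \<longlongrightarrow> (D i + 2 * 0) powr \<alpha>) (at_right 0)"
      using D[of i] \<alpha>_pos
      by (intro tendsto_powr' tendsto_intros) (auto simp: eventually_at_right_field intro!: exI[of _ 1])
    then have "\<forall>\<^sub>F e in at_right 0. (D i + 2 * e) powr \<alpha> < D i powr \<alpha> + \<epsilon> * (1/2) ^ Suc i"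
      using \<epsilon> by (intro order_tendstoD(2)) auto
    moreover have "\<forall>\<^sub>F e::real in at_right 0. 0 < e" by (rule eventually_at_right_less)
    ultimately have "\<forall>\<^sub>F e in at_right 0. 0 < e \<and> (D i + 2 * e) powr \<alpha> < D i powr \<alpha> + \<epsilon> * (1/2) ^ Suc i"
      by (rule eventually_conj[rotated])
    then show ?thesis using eventually_happens[of _ "at_right (0::real)"] by (force intro: less_imp_le)
  qed
  then obtain e where e: "\<And>i. 0 < e i" "\<And>i. (D i + 2 * e i) powr \<alpha> \<le> D i powr \<alpha> + \<epsilon> * (1/2) ^ Suc i"
    by metis
  define V where "V i = (\<Union>y\<in>U i. ball y (e i))" for i
  have V_open: "open (V i)" for i unfolding V_def by blast
  have V_dist: "dist x y \<le> D i + 2 * e i" if xy: "x \<in> V i" "y \<in> V i" for x y i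
  proof -
    obtain x' y' where x': "x' \<in> U i" "dist x' x < e i" and y': "y' \<in> U i" "dist y' y < e i"
      using xy by (auto simp: V_def)
    have "dist x' y' \<le> D i" unfolding D_def by (rule diameter_bounded_bound[OF bdd x'(1) y'(1)])
    moreover have "dist x y \<le> dist x' x + dist x' y' + dist y' y"
      using dist_triangle3[of x y x'] dist_triangle[of x' y y'] by linarith
    ultimately show ?thesis using x' y' by linarith
  qed
  have UV: "U i \<subseteq> V i" for i using e(1) by (force simp: V_def)
  obtain n where n: "E n \<subseteq> (\<Union>i. V i)"
  proof (rule ccontr)
    assume *: "\<not> thesis"
    have "(\<Inter>n. E n - (\<Union>i. V i)) \<noteq> {}"
    proof (rule compact_nest)
      show "compact (E n - (\<Union>i. V i))" for n
        using V_open by (intro compact_diff compact_E open_UN) auto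
      show "E n - (\<Union>i. V i) \<noteq> {}" for n using that * by blast
      show "E n - (\<Union>i. V i) \<subseteq> E m - (\<Union>i. V i)" if "m \<le> n" for m n
        using E_antimono[OF that] by blast
    qed
    then obtain x where x: "x \<in> (\<Inter>n. E n - (\<Union>i. V i))" by (meson all_not_in_conv)
    then have "x \<in> cantor_set" "x \<notin> (\<Union>i. V i)" unfolding cantor_set_def by blast+
    obtain i where "x \<in> U i" using cover \<open>x \<in> cantor_set\<close> by auto
    then have "x \<in> V i" using UV[of i] by auto
    then show False using \<open>x \<notin> (\<Union>i. V i)\<close> by auto
  qed
  obtain I where I: "finite I" "E n \<subseteq> (\<Union>i\<in>I. V i)"
    using compactE_image[OF compact_E V_open n] by (metis subset_UNIV)
  have "\<forall>\<^sub>F J in sequentially. \<forall>i\<in>I. \<rho> J < 2 * e i"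
    using \<rho>_lim e(1) by (intro eventually_ball_finite[OF I(1)] ballI order_tendstoD(2)) auto
  then have "\<forall>\<^sub>F J in sequentially. n \<le> J \<and> (\<forall>i\<in>I. \<rho> J < 2 * e i)"
    using eventually_ge_at_top[of n] by (rule eventually_conj[rotated])
  then obtain J where J: "n \<le> J" "\<And>i. i \<in> I \<Longrightarrow> \<rho> J < 2 * e i"
    using eventually_happens[of _ sequentially] by fastforce
  have "T J \<subseteq> (\<Union>i\<in>I. T J \<inter> V i)"
    using T_subset_E[of J] E_antimono[OF J(1)] I(2) by blast
  then have "card (T J) \<le> card (\<Union>i\<in>I. T J \<inter> V i)"
    using finite_T I(1) by (intro card_mono) auto
  also have "\<dots> \<le> (\<Sum>i\<in>I. card (T J \<inter> V i))" by (rule card_UN_le[OF I(1)])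
  finally have "real (card (T J)) \<le> (\<Sum>i\<in>I. real (card (T J \<inter> V i)))"
    by (metis of_nat_le_iff of_nat_sum)
  also have "\<dots> \<le> (\<Sum>i\<in>I. frostman_const * real (card (T J)) * (D i powr \<alpha> + \<epsilon> * (1/2) ^ Suc i))"
  proof (rule sum_mono)
    fix i assume "i \<in> I"
    have "real (card (T J \<inter> V i)) \<le> frostman_const * real (card (T J)) * (D i + 2 * e i) powr \<alpha>"
      using J(2)[OF \<open>i \<in> I\<close>] D[of i] by (intro frostman V_dist) auto
    also have "\<dots> \<le> frostman_const * real (card (T J)) * (D i powr \<alpha> + \<epsilon> * (1/2) ^ Suc i)"
      using frostman_const_ge(1) by (intro mult_left_mono e) auto
    finally show "real (card (T J \<inter> V i)) \<le> frostman_const * real (card (T J)) * (D i powr \<alpha> + \<epsilon> * (1/2) ^ Suc i)" .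
  qed
  also have "\<dots> = real (card (T J)) * (frostman_const * ((\<Sum>i\<in>I. D i powr \<alpha>) + \<epsilon> * (\<Sum>i\<in>I. (1/2) ^ Suc i)))"
    by (simp only: sum_distrib_left sum.distrib distrib_left mult_ac)
  finally have "1 \<le> frostman_const * ((\<Sum>i\<in>I. D i powr \<alpha>) + \<epsilon> * (\<Sum>i\<in>I. (1/2) ^ Suc i))"
    using card_T_pos[of J] by (simp add: mult_le_cancel_left1)
  also have "\<dots> \<le> frostman_const * ((\<Sum>i\<in>I. D i powr \<alpha>) + \<epsilon> * 1)"
  proof -
    have "(\<Sum>i\<in>I. (1/2::real) ^ Suc i) \<le> (\<Sum>i. (1/2) ^ Suc i)"
      by (rule sum_le_suminf) (use I(1) power_half_series in \<open>auto simp: sums_iff\<close>)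
    also have "\<dots> = 1" using power_half_series by (simp add: sums_iff)
    finally show ?thesis using \<epsilon> frostman_const_ge(1) by (intro mult_left_mono add_left_mono) auto
  qed
  finally have "\<epsilon> \<le> (\<Sum>i\<in>I. D i powr \<alpha>)"
    using frostman_const_ge(1) by (simp add: \<epsilon>_def field_simps)
  then have "ennreal \<epsilon> \<le> (\<Sum>i\<in>I. ennreal (D i powr \<alpha>))" by (simp add: ennreal_leI)
  also have "\<dots> \<le> (\<Sum>i\<in>I. diameter_power \<alpha> (U i))"
    using \<alpha>_pos by (intro sum_mono) (auto simp: diameter_power_def D_def)
  also have "\<dots> \<le> (\<Sum>i. diameter_power \<alpha> (U i))"
    by (rule sum_le_suminf) (use I(1) in auto)
  finally show ?thesis by (simp add: \<epsilon>_def)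
qed

theorem hausdorff_measure_cantor_set_pos: "0 < hausdorff_measure \<alpha> cantor_set"
  by (rule hausdorff_measure_posI[OF _ cover_sum_ge]) (use frostman_const_ge(1) in auto)

theorem hausdorff_measure_cantor_set_zero:
  assumes "\<alpha> < \<beta>"
  shows "hausdorff_measure \<beta> cantor_set = 0"
proof (rule hausdorff_measure_zeroI)
  show "0 < \<beta>" using assms \<alpha>_pos by simp
  fix r \<epsilon> :: real assume "0 < r" "0 < \<epsilon>"
  have "(\<lambda>j. \<Lambda> * 2 powr \<beta> * \<rho> j powr (\<beta> - \<alpha>)) \<longlonglongrightarrow> \<Lambda> * 2 powr \<beta> * 0 powr (\<beta> - \<alpha>)"
    using assms \<rho>_pos by (intro tendsto_intros tendsto_powr' \<rho>_lim) (auto simp: less_imp_le)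
  then have "\<forall>\<^sub>F j in sequentially. \<Lambda> * 2 powr \<beta> * \<rho> j powr (\<beta> - \<alpha>) < \<epsilon>"
    using \<open>0 < \<epsilon>\<close> by (intro order_tendstoD(2)) auto
  moreover have "\<forall>\<^sub>F j in sequentially. \<rho> j < r / 2"
    using \<rho>_lim \<open>0 < r\<close> by (intro order_tendstoD(2)) auto
  ultimately have "\<forall>\<^sub>F j in sequentially. \<Lambda> * 2 powr \<beta> * \<rho> j powr (\<beta> - \<alpha>) < \<epsilon> \<and> \<rho> j < r / 2"
    by (rule eventually_conj)
  then obtain j where j: "\<Lambda> * 2 powr \<beta> * \<rho> j powr (\<beta> - \<alpha>) < \<epsilon>" "\<rho> j < r / 2"
    by (auto simp: eventually_sequentially)
  have "real (card (T j)) * (2 * \<rho> j) powr \<beta> = real (card (T j)) * \<rho> j powr \<alpha> * 2 powr \<beta> * \<rho> j powr (\<beta> - \<alpha>)"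
    using \<rho>_pos[of j] by (simp add: powr_mult powr_diff)
  also have "\<dots> = \<Lambda> * 2 powr \<beta> * \<rho> j powr (\<beta> - \<alpha>)" unfolding mass ..
  finally have "real (card (T j)) * (2 * \<rho> j) powr \<beta> \<le> \<epsilon>" using j by simp
  moreover have "cantor_set \<subseteq> (\<Union>c\<in>T j. cball c (\<rho> j))" by (auto simp: cantor_set_def E_def)
  ultimately show "\<exists>T r'. finite T \<and> 0 < r' \<and> 2 * r' \<le> r \<and> cantor_set \<subseteq> (\<Union>c\<in>T. cball c r') \<and> real (card T) * (2 * r') powr \<beta> \<le> \<epsilon>"
    using finite_T \<rho>_pos[of j] j(2) by (intro exI[of _ "T j"] exI[of _ "\<rho> j"]) auto
qed

end

section \<open>Well-spread rational points\<close>

definition cube :: "real ^ 'd \<Rightarrow> real \<Rightarrow> (real ^ 'd) set" where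
  "cube a h = {x. \<forall>l. \<bar>x $ l - a $ l\<bar> \<le> h}"

lemma cube_eq_cbox: "cube a h = cbox (\<chi> l. a $ l - h) (\<chi> l. a $ l + h)"
  unfolding cube_def by (auto simp: mem_box_cart abs_le_iff) (metis add.commute diff_le_eq le_diff_eq minus_diff_eq)+

lemma measure_cube:
  fixes a :: "real ^ 'd::finite"
  assumes "0 \<le> h" shows "measure lborel (cube a h) = (2 * h) ^ CARD('d)"
proof -
  have "cbox (\<chi> l. a $ l - h) (\<chi> l. a $ l + h) \<noteq> {}"
    using assms by (simp add: interval_ne_empty_cart)
  then show ?thesis unfolding cube_eq_cbox by (simp add: content_cbox_cart)
qed

lemma cube_fmeasurable: "cube a h \<in> fmeasurable lborel"
  unfolding cube_eq_cbox by (rule fmeasurable_cbox)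

lemma cube_swap:
  assumes "x \<in> cube a h" "x \<in> cube p \<eta>" shows "p \<in> cube a (h + \<eta>)"
proof -
  have "\<bar>p $ l - a $ l\<bar> \<le> h + \<eta>" for l
  proof -
    have "\<bar>x $ l - a $ l\<bar> \<le> h" "\<bar>x $ l - p $ l\<bar> \<le> \<eta>" using assms by (simp_all add: cube_def)
    then show ?thesis by linarith
  qed
  then show ?thesis by (simp add: cube_def)
qed

lemma cube_sym: "x \<in> cube y h \<longleftrightarrow> y \<in> cube x h"
  by (simp add: cube_def abs_minus_commute)

lemma cube_mono: "w \<le> w' \<Longrightarrow> cube a w \<subseteq> cube a w'"
  unfolding cube_def by (auto intro: order_trans)

lemma norm_le_of_components:
  fixes x :: "real ^ 'd::finite"
  assumes "\<And>l. \<bar>x $ l\<bar> \<le> w" shows "norm x \<le> real CARD('d) * w"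
proof -
  have "norm x \<le> (\<Sum>l\<in>UNIV. \<bar>x $ l\<bar>)" by (rule norm_le_l1_cart)
  also have "\<dots> \<le> (\<Sum>l\<in>(UNIV::'d set). w)" by (rule sum_mono[OF assms])
  finally show ?thesis by simp
qed

lemma card_int_interval:
  assumes "0 \<le> w"
  shows "finite {r::int. \<bar>of_int r - u\<bar> \<le> w}" "real (card {r::int. \<bar>of_int r - u\<bar> \<le> w}) \<le> 2 * w + 1"
proof -
  have eq: "{r::int. \<bar>of_int r - u\<bar> \<le> w} = {\<lceil>u - w\<rceil>..\<lfloor>u + w\<rfloor>}"
    by (auto simp: abs_le_iff ceiling_le_iff le_floor_iff)
  show "finite {r::int. \<bar>of_int r - u\<bar> \<le> w}" unfolding eq by simp
  have "real_of_int (\<lfloor>u + w\<rfloor> - \<lceil>u - w\<rceil> + 1) \<le> 2 * w + 1"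
    using of_int_floor_le[of "u + w"] le_of_int_ceiling[of "u - w"]
    unfolding of_int_diff of_int_add of_int_1 by linarith
  then show "real (card {r::int. \<bar>of_int r - u\<bar> \<le> w}) \<le> 2 * w + 1"
    unfolding eq using assms by simp
qed

lemma card_int_cube:
  fixes u :: "'d::finite \<Rightarrow> real"
  assumes "0 \<le> w"
  shows "finite {r::int^'d. \<forall>l. \<bar>of_int (r $ l) - u l\<bar> \<le> w}"
    "real (card {r::int^'d. \<forall>l. \<bar>of_int (r $ l) - u l\<bar> \<le> w}) \<le> (2 * w + 1) ^ CARD('d)"
proof -
  let ?S = "\<lambda>l. {r::int. \<bar>of_int r - u l\<bar> \<le> w}"
  let ?R = "{r::int^'d. \<forall>l. \<bar>of_int (r $ l) - u l\<bar> \<le> w}"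
  have fin: "finite (PiE UNIV ?S)" by (intro finite_PiE card_int_interval assms) auto
  have inj: "inj_on vec_nth ?R" by (auto simp: inj_on_def vec_eq_iff)
  have sub: "vec_nth ` ?R \<subseteq> PiE UNIV ?S" by auto
  show "finite ?R" using finite_imageD[OF finite_subset[OF sub fin] inj] .
  have "card ?R \<le> card (PiE UNIV ?S)" by (rule card_inj_on_le[OF inj sub fin])
  also have "\<dots> = (\<Prod>l\<in>UNIV. card (?S l))" by (rule card_PiE) simp
  finally have "real (card ?R) \<le> (\<Prod>l\<in>UNIV. real (card (?S l)))"
    by (simp only: of_nat_le_iff flip: of_nat_prod)
  also have "\<dots> \<le> (\<Prod>l\<in>(UNIV::'d set). 2 * w + 1)"
    by (intro prod_mono conjI card_int_interval assms) simp
  finally show "real (card ?R) \<le> (2 * w + 1) ^ CARD('d)" by simp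
qed

text \<open>Passage from multiples of \<open>2 pi/q\<close> to integers.\<close>

lemma scaled_abs_le_iff:
  assumes "0 < q"
  shows "\<bar>2 * pi * v / q - u\<bar> \<le> B \<longleftrightarrow> \<bar>v - q * u / (2 * pi)\<bar> \<le> B * (q / (2 * pi))"
proof -
  have "v - q * u / (2 * pi) = (2 * pi * v / q - u) * (q / (2 * pi))"
    using assms by (simp add: field_simps)
  then have "\<bar>v - q * u / (2 * pi)\<bar> = \<bar>2 * pi * v / q - u\<bar> * (q / (2 * pi))"
    using assms by (simp add: abs_mult del: times_divide_eq_right)
  moreover have "0 < q / (2 * pi)" using assms by simp
  ultimately show ?thesis by (simp only: mult_le_cancel_right_pos)
qed

definition rational_point :: "nat \<Rightarrow> int ^ 'd \<Rightarrow> real ^ 'd" where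
  "rational_point q r = (\<chi> l. 2 * pi * of_int (r $ l) / real q)"

text \<open>Dirichlet's theorem on simultaneous approximation with the bound \<open>m^n\<close> on the denominators.\<close>

lemma dirichlet_rational_point:
  fixes x :: "real ^ 'd::finite"
  assumes "0 < m"
  obtains q r where "0 < q" "q \<le> m ^ CARD('d)" "x \<in> cube (rational_point q r) (2 * pi / (real q * real m))"
proof -
  obtain e :: "nat \<Rightarrow> 'd" where e: "bij_betw e {..<CARD('d)} UNIV"
    using ex_bij_betw_nat_finite[of "UNIV :: 'd set"] by (auto simp: lessThan_atLeast0)
  obtain q p where q: "0 < q" "q \<le> int (m ^ CARD('d))"
    and p: "\<And>i. i < CARD('d) \<Longrightarrow> \<bar>of_int q * (x $ e i / (2 * pi)) - of_int (p i)\<bar> < 1 / real m"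
    using Dirichlet_approx_simult[OF assms, of "CARD('d)" "\<lambda>i. x $ e i / (2 * pi)"] by blast
  define r :: "int ^ 'd" where "r = (\<chi> l. p (inv_into {..<CARD('d)} e l))"
  have "x \<in> cube (rational_point (nat q) r) (2 * pi / (real (nat q) * real m))"
    unfolding cube_def rational_point_def
  proof (clarsimp)
    fix l
    define i where "i = inv_into {..<CARD('d)} e l"
    have l: "l \<in> e ` {..<CARD('d)}" using e by (simp add: bij_betw_def)
    have i: "i < CARD('d)" "e i = l"
      using inv_into_into[OF l] f_inv_into_f[OF l] by (auto simp: i_def)
    have "\<bar>of_int (p i) - real (nat q) * x $ l / (2 * pi)\<bar> \<le> 1 / real m"
      using p[OF i(1)] i(2) q by (simp add: abs_minus_commute)
    also have "\<dots> = 2 * pi / (real (nat q) * real m) * (real (nat q) / (2 * pi))" using q by simp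
    finally have "\<bar>2 * pi * of_int (p i) / real (nat q) - x $ l\<bar> \<le> 2 * pi / (real (nat q) * real m)"
      using q by (subst scaled_abs_le_iff) auto
    then show "\<bar>x $ l - 2 * pi * of_int (r $ l) / real (nat q)\<bar> \<le> 2 * pi / (real (nat q) * real m)"
      by (simp add: r_def i_def abs_minus_commute)
  qed
  moreover have "nat q \<le> m ^ CARD('d)" using q by (simp add: nat_le_iff)
  ultimately show ?thesis using q that[of "nat q" r] by simp
qed

lemma card_rational_points:
  fixes a :: "real ^ 'd::finite"
  assumes q: "0 < q" and w: "0 \<le> w"
  shows "finite {r. rational_point q r \<in> cube a w}"
    "real (card {r. rational_point q r \<in> cube a w}) \<le> (real q * w / pi + 1) ^ CARD('d)"
proof -
  have eq: "{r. rational_point q r \<in> cube a w}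
      = {r. \<forall>l. \<bar>of_int (r $ l) - real q * a $ l / (2 * pi)\<bar> \<le> w * (real q / (2 * pi))}"
    using q by (simp add: cube_def rational_point_def scaled_abs_le_iff)
  have w': "0 \<le> w * (real q / (2 * pi))" using w by simp
  show "finite {r. rational_point q r \<in> cube a w}" unfolding eq by (rule card_int_cube(1)[OF w'])
  show "real (card {r. rational_point q r \<in> cube a w}) \<le> (real q * w / pi + 1) ^ CARD('d)"
    using card_int_cube(2)[OF w', of "\<lambda>l. real q * a $ l / (2 * pi)"] unfolding eq by (simp add: mult.commute)
qed

text \<open>The part of a cube that Dirichlet's theorem approximates with the denominator \<open>q\<close>.\<close>

definition near_rationals :: "nat \<Rightarrow> real ^ 'd \<Rightarrow> real \<Rightarrow> nat \<Rightarrow> (real ^ 'd) set" where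
  "near_rationals m a h q =
    cube a h \<inter> (\<Union>r. cube (rational_point q r) (2 * pi / (real q * real m)))"

text \<open>There are \<open>O(q h + 1)^n\<close> numerators, each of which contributes a cube of side
  \<open>4 pi/(q m)\<close>.\<close>

lemma near_rationals_measure:
  fixes a :: "real ^ 'd::finite"
  assumes "0 < m" "0 < q" "0 < h"
  shows "\<exists>B. near_rationals m a h q \<subseteq> B \<and> B \<in> fmeasurable lborel \<and>
    measure lborel B \<le> ((4 * h + 12 * pi / real q) / real m) ^ CARD('d)"
proof -
  define \<eta> where "\<eta> = 2 * pi / (real q * real m)"
  have \<eta>: "0 \<le> \<eta>" by (simp add: \<eta>_def)
  define R where "R = {r. rational_point q r \<in> cube a (h + \<eta>)}"
  define B where "B = (\<Union>r\<in>R. cube (rational_point q r) \<eta>)"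
  have fin: "finite R" and card: "real (card R) \<le> (real q * (h + \<eta>) / pi + 1) ^ CARD('d)"
    unfolding R_def using card_rational_points[OF assms(2), of "h + \<eta>" a] assms(3) \<eta> by auto
  have "near_rationals m a h q \<subseteq> B"
  proof
    fix x assume "x \<in> near_rationals m a h q"
    then obtain r where x: "x \<in> cube a h" "x \<in> cube (rational_point q r) \<eta>"
      by (auto simp: near_rationals_def \<eta>_def)
    then have "r \<in> R" unfolding R_def using cube_swap by blast
    then show "x \<in> B" using x by (auto simp: B_def)
  qed
  moreover have "B \<in> fmeasurable lborel"
    unfolding B_def by (intro fmeasurable.finite_UN fin cube_fmeasurable)
  moreover have "measure lborel B \<le> ((4 * h + 12 * pi / real q) / real m) ^ CARD('d)"
  proof -
    have "measure lborel B \<le> (\<Sum>r\<in>R. measure lborel (cube (rational_point q r) \<eta>))"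
      unfolding B_def by (intro measure_UNION_le fin fmeasurableD cube_fmeasurable)
    also have "\<dots> = real (card R) * (2 * \<eta>) ^ CARD('d)" by (simp add: measure_cube[OF \<eta>])
    also have "\<dots> \<le> (real q * (h + \<eta>) / pi + 1) ^ CARD('d) * (2 * \<eta>) ^ CARD('d)"
      using \<eta> by (intro mult_right_mono card) auto
    also have "\<dots> \<le> ((4 * h + 12 * pi / real q) / real m) ^ CARD('d)"
      unfolding power_mult_distrib[symmetric]
    proof (rule power_mono)
      have "1 \<le> real m" using assms by simp
      then have "real q * \<eta> / pi \<le> 2" using assms by (simp add: \<eta>_def field_simps)
      then have "(real q * (h + \<eta>) / pi + 1) * (2 * \<eta>) \<le> (real q * h / pi + 3) * (2 * \<eta>)"
        using \<eta> by (intro mult_right_mono) (auto simp: distrib_left add_divide_distrib)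
      also have "\<dots> = (4 * h + 12 * pi / real q) / real m"
        using assms by (simp add: \<eta>_def field_simps)
      finally show "(real q * (h + \<eta>) / pi + 1) * (2 * \<eta>) \<le> (4 * h + 12 * pi / real q) / real m" .
      show "0 \<le> (real q * (h + \<eta>) / pi + 1) * (2 * \<eta>)" using \<eta> assms by simp
    qed
    finally show ?thesis .
  qed
  ultimately show ?thesis by blast
qed

text \<open>Twice pi divided by \<open>q m\<close>, for the smallest denominator \<open>q = m^n / 4^(n+1)\<close> in use.\<close>

definition spacing :: "nat \<Rightarrow> nat \<Rightarrow> real" where
  "spacing n m = 2 * pi * (4 / real m) ^ Suc n"

lemma spacing_pos: "0 < m \<Longrightarrow> 0 < spacing n m"
  by (simp add: spacing_def)

text \<open>Denominators much smaller than \<open>m^n\<close> do not suffice in Dirichlet's theorem: the set that they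
  approximate has at most half the measure of the cube. For \<open>q \<ge> 3 pi/h\<close> each denominator
  contributes at most \<open>(8h/m)^n\<close>, and the finitely many others contribute \<open>O(m^-n)\<close>
  altogether.\<close>

lemma small_denominators_measure:
  fixes a :: "real ^ 'd::finite"
  assumes "0 < h"
  shows "\<forall>\<^sub>F m in sequentially. \<exists>B. (\<Union>q\<in>{q. 0 < q \<and> real q < real m ^ CARD('d) / 4 ^ Suc CARD('d)}. near_rationals m a h q) \<subseteq> B
    \<and> B \<in> fmeasurable lborel \<and> measure lborel B \<le> (2 * h) ^ CARD('d) / 2"
proof -
  define n where "n = CARD('d)"
  \<comment> \<open>For denominators from \<open>q0\<close> on, the number of numerators is comparable to \<open>(q h)^n\<close>.\<close>
  define q0 where "q0 = nat \<lceil>3 * pi / h\<rceil>"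
  have "(\<lambda>m. real q0 * ((4 * h + 12 * pi) / real m) ^ n) \<longlonglongrightarrow> real q0 * 0 ^ n"
    by (intro tendsto_intros tendsto_divide_0 filterlim_at_top_imp_at_infinity filterlim_real_sequentially)
  then have "\<forall>\<^sub>F m in sequentially. real q0 * ((4 * h + 12 * pi) / real m) ^ n < (2 * h) ^ n / 4"
    using assms by (intro order_tendstoD(2)) (auto simp: n_def zero_power)
  then show ?thesis using eventually_gt_at_top[of 0]
  proof eventually_elim
    case (elim m)
    define Z where "Z = {q. 0 < q \<and> real q < real m ^ n / 4 ^ Suc n}"
    have "Z \<subseteq> {..<m ^ n}"
    proof
      fix q assume "q \<in> Z"
      then have "real q < real m ^ n / 4 ^ Suc n" by (simp add: Z_def)
      also have "\<dots> \<le> real m ^ n / 1" by (intro divide_left_mono one_le_power) auto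
      finally have "real q < real (m ^ n)" by simp
      then show "q \<in> {..<m ^ n}" by (simp only: lessThan_iff of_nat_less_iff)
    qed
    then have finZ: "finite Z" by (rule finite_subset) simp
    have cardZ: "real (card Z) \<le> real m ^ n / 4 ^ Suc n"
    proof -
      have "Z \<subseteq> {1..nat \<lfloor>real m ^ n / 4 ^ Suc n\<rfloor>}" by (auto simp: Z_def le_nat_floor)
      then have "card Z \<le> card {1..nat \<lfloor>real m ^ n / 4 ^ Suc n\<rfloor>}" by (intro card_mono) auto
      then show ?thesis by (simp add: le_nat_iff le_floor_iff)
    qed
    define v where "v q = ((4 * h + 12 * pi / real q) / real m) ^ n" for q
    have "\<exists>B. \<forall>q\<in>Z. near_rationals m a h q \<subseteq> B q \<and> B q \<in> fmeasurable lborel \<and> measure lborel (B q) \<le> v q"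
      using near_rationals_measure[OF elim(2) _ assms] unfolding v_def n_def Z_def by (intro bchoice) auto
    then obtain B where B: "\<And>q. q \<in> Z \<Longrightarrow> near_rationals m a h q \<subseteq> B q" "\<And>q. q \<in> Z \<Longrightarrow> B q \<in> fmeasurable lborel"
      "\<And>q. q \<in> Z \<Longrightarrow> measure lborel (B q) \<le> v q" by blast
    have v1: "v q \<le> ((4 * h + 12 * pi) / real m) ^ n" if "q \<in> Z" for q
      unfolding v_def using that assms
      by (intro power_mono divide_right_mono add_left_mono) (auto simp: Z_def field_simps)
    have v2: "v q \<le> (8 * h / real m) ^ n" if "q \<in> Z" "q0 \<le> q" for q
    proof -
      have "3 * pi / h \<le> real q0" unfolding q0_def by linarith
      then have "3 * pi / h \<le> real q" using that by linarith
      then have "12 * pi / real q \<le> 4 * h" using that assms by (simp add: Z_def field_simps)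
      then show ?thesis unfolding v_def using assms by (intro power_mono divide_right_mono) auto
    qed
    have "measure lborel (\<Union>q\<in>Z. B q) \<le> (\<Sum>q\<in>Z. measure lborel (B q))"
      by (intro measure_UNION_le finZ fmeasurableD B)
    also have "\<dots> \<le> (\<Sum>q\<in>Z. v q)" by (rule sum_mono[OF B(3)])
    also have "\<dots> \<le> (\<Sum>q\<in>Z. (8 * h / real m) ^ n + (if q < q0 then ((4 * h + 12 * pi) / real m) ^ n else 0))"
      using v1 v2 assms by (intro sum_mono) (auto simp: add_increasing)
    also have "\<dots> = real (card Z) * (8 * h / real m) ^ n + (\<Sum>q\<in>Z \<inter> {..<q0}. ((4 * h + 12 * pi) / real m) ^ n)"
      unfolding sum.distrib sum.inter_restrict[OF finZ] by simp
    also have "\<dots> \<le> real m ^ n / 4 ^ Suc n * (8 * h / real m) ^ n + real q0 * ((4 * h + 12 * pi) / real m) ^ n"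
    proof (intro add_mono mult_right_mono cardZ)
      have "card (Z \<inter> {..<q0}) \<le> card {..<q0}" by (intro card_mono) auto
      then show "(\<Sum>q\<in>Z \<inter> {..<q0}. ((4 * h + 12 * pi) / real m) ^ n) \<le> real q0 * ((4 * h + 12 * pi) / real m) ^ n"
        using assms by (simp add: mult_right_mono)
    qed (use assms in auto)
    also have "real m ^ n / 4 ^ Suc n * (8 * h / real m) ^ n = (2 * h) ^ n / 4"
    proof -
      have "x ^ n / 4 ^ Suc n * y ^ n = (x / 4 * y) ^ n / 4" for x y :: real
        by (simp add: power_mult_distrib power_divide)
      then have "real m ^ n / 4 ^ Suc n * (8 * h / real m) ^ n = (real m / 4 * (8 * h / real m)) ^ n / 4" .
      also have "real m / 4 * (8 * h / real m) = 2 * h" using elim(2) by simp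
      finally show ?thesis .
    qed
    finally have "measure lborel (\<Union>q\<in>Z. B q) \<le> (2 * h) ^ n / 2" using elim(1) by linarith
    moreover have "(\<Union>q\<in>Z. B q) \<in> fmeasurable lborel" by (intro fmeasurable.finite_UN finZ B)
    moreover have "(\<Union>q\<in>Z. near_rationals m a h q) \<subseteq> (\<Union>q\<in>Z. B q)" using B(1) by blast
    ultimately show ?case unfolding Z_def n_def by blast
  qed
qed

definition rational_net :: "real ^ 'd \<Rightarrow> real \<Rightarrow> nat \<Rightarrow> (real ^ 'd) set \<Rightarrow> bool" where
  "rational_net a w m S \<longleftrightarrow> finite S \<and> S \<subseteq> cube a w \<and>
     (\<forall>p\<in>S. \<exists>q r. p = rational_point q r \<and> 0 < q \<and> q \<le> m ^ CARD('d) \<and> real m ^ CARD('d) / 4 ^ Suc CARD('d) \<le> real q) \<and>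
     (\<forall>p\<in>S. \<forall>p'\<in>S. p \<noteq> p' \<longrightarrow> p' \<notin> cube p (spacing CARD('d) m))"

lemma rational_net_subset: "rational_net a w m S \<Longrightarrow> S' \<subseteq> S \<Longrightarrow> rational_net a w m S'"
  unfolding rational_net_def by (simp add: finite_subset subset_eq)

text \<open>At least half of the cube is within the distance \<open>spacing\<close> of rational points with denominators
  between \<open>m^n / 4^(n+1)\<close> and \<open>m^n\<close>. The cubes of twice this size around a maximal separated set
  of such points cover this half, which bounds their number from below.\<close>

lemma large_rational_net:
  fixes a :: "real ^ 'd::finite"
  assumes h: "0 < h"
  shows "\<forall>\<^sub>F m in sequentially. \<exists>S. rational_net a (h + spacing CARD('d) m) m S \<and>
     (h / (2 * spacing CARD('d) m)) ^ CARD('d) / 2 \<le> real (card S)"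
  unfolding rational_net_def
  using small_denominators_measure[OF h, of a] eventually_gt_at_top[of 0]
proof eventually_elim
  case (elim m)
  define n where "n = CARD('d)"
  define \<delta> where "\<delta> = spacing n m"
  have \<delta>: "0 < \<delta>" unfolding \<delta>_def by (rule spacing_pos[OF elim(2)])
  define Z where "Z = {q. 0 < q \<and> real q < real m ^ n / 4 ^ Suc n}"
  obtain B where B: "(\<Union>q\<in>Z. near_rationals m a h q) \<subseteq> B" "B \<in> fmeasurable lborel" "measure lborel B \<le> (2 * h) ^ n / 2"
    using elim(1) unfolding Z_def n_def by blast
  define W where "W = {q. 0 < q \<and> q \<le> m ^ n \<and> real m ^ n / 4 ^ Suc n \<le> real q}"
  define P where "P = cube a (h + \<delta>) \<inter> (\<Union>q\<in>W. range (rational_point q))"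
  have "finite P"
  proof -
    have "finite W" by (rule finite_subset[of _ "{..m ^ n}"]) (auto simp: W_def)
    moreover have "finite (rational_point q ` {r. rational_point q r \<in> cube a (h + \<delta>)})" if "q \<in> W" for q
      using that h \<delta> by (intro finite_imageI card_rational_points(1)) (auto simp: W_def)
    ultimately have "finite (\<Union>q\<in>W. rational_point q ` {r. rational_point q r \<in> cube a (h + \<delta>)})" by blast
    then show ?thesis by (rule finite_subset[rotated]) (auto simp: P_def)
  qed
  obtain S where S: "finite S" "S \<subseteq> P" "pairwise (\<lambda>x y. \<not> x \<in> cube y \<delta>) S" "\<And>p. p \<in> P \<Longrightarrow> \<exists>s\<in>S. s \<in> cube p \<delta>"
  proof (rule maximal_separated_subset[of "\<lambda>x y. x \<in> cube y \<delta>" P "card P"])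
    show "x \<in> cube x \<delta>" for x :: "real ^ 'd" using \<delta> by (simp add: cube_def)
    show "y \<in> cube x \<delta>" if "x \<in> cube y \<delta>" for x y :: "real ^ 'd" using that cube_sym by blast
    show "card S \<le> card P" if "S \<subseteq> P" for S using that \<open>finite P\<close> by (rule card_mono[rotated])
  qed blast
  have covering: "cube a h - B \<subseteq> (\<Union>s\<in>S. cube s (2 * \<delta>))"
  proof
    fix x assume x: "x \<in> cube a h - B"
    obtain q r where q: "0 < q" "q \<le> m ^ n" and xr: "x \<in> cube (rational_point q r) (2 * pi / (real q * real m))"
      using dirichlet_rational_point[OF elim(2), of x] unfolding n_def by blast
    have "q \<notin> Z" using x B(1) xr by (auto simp: near_rationals_def)
    then have qW: "q \<in> W" using q by (auto simp: Z_def W_def)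
    have "2 * pi / (real q * real m) \<le> 2 * pi / (real m ^ n / 4 ^ Suc n * real m)"
      using qW elim(2) by (intro divide_left_mono mult_right_mono) (auto simp: W_def)
    also have "\<dots> = \<delta>" by (simp add: \<delta>_def spacing_def power_divide)
    finally have le: "2 * pi / (real q * real m) \<le> \<delta>" .
    then have near: "x \<in> cube (rational_point q r) \<delta>" using xr cube_mono by blast
    then have "rational_point q r \<in> cube a (h + \<delta>)" using x cube_swap by blast
    then have "rational_point q r \<in> P" using qW by (auto simp: P_def)
    then obtain s where s: "s \<in> S" "s \<in> cube (rational_point q r) \<delta>" using S(4) by blast
    have "rational_point q r \<in> cube x \<delta>" using near cube_sym by blast
    then have "s \<in> cube x (\<delta> + \<delta>)" using s(2) cube_sym cube_swap by blast
    then have "x \<in> cube s (2 * \<delta>)" unfolding mult_2 using cube_sym by blast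
    then show "x \<in> (\<Union>s\<in>S. cube s (2 * \<delta>))" using s by blast
  qed
  have "(2 * h) ^ n = measure lborel (cube a h)" using h by (simp add: measure_cube n_def)
  also have "\<dots> \<le> measure lborel ((\<Union>s\<in>S. cube s (2 * \<delta>)) \<union> B)"
  proof (rule measure_mono_fmeasurable)
    show "cube a h \<subseteq> (\<Union>s\<in>S. cube s (2 * \<delta>)) \<union> B" using covering by blast
    show "cube a h \<in> sets lborel" by (rule fmeasurableD[OF cube_fmeasurable])
    show "(\<Union>s\<in>S. cube s (2 * \<delta>)) \<union> B \<in> fmeasurable lborel"
      by (intro fmeasurable.Un fmeasurable.finite_UN S(1) B cube_fmeasurable)
  qed
  also have "\<dots> \<le> measure lborel (\<Union>s\<in>S. cube s (2 * \<delta>)) + measure lborel B"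
    by (intro measure_Un_le fmeasurableD fmeasurable.finite_UN cube_fmeasurable S(1) B)
  finally have le: "(2 * h) ^ n \<le> measure lborel (\<Union>s\<in>S. cube s (2 * \<delta>)) + measure lborel B" .
  have "measure lborel (\<Union>s\<in>S. cube s (2 * \<delta>)) \<le> (\<Sum>s\<in>S. measure lborel (cube s (2 * \<delta>)))"
    by (intro measure_UNION_le S(1) fmeasurableD cube_fmeasurable)
  also have "\<dots> = real (card S) * (4 * \<delta>) ^ n"
    using \<delta> by (simp add: measure_cube n_def)
  finally have "(2 * h) ^ n / 2 \<le> real (card S) * (4 * \<delta>) ^ n" using le B(3) by linarith
  then have "(2 * h) ^ n / 2 / (4 * \<delta>) ^ n \<le> real (card S)" using \<delta> by (simp add: pos_divide_le_eq)
  moreover have "(2 * h) ^ n / 2 / (4 * \<delta>) ^ n = (2 * h / (4 * \<delta>)) ^ n / 2"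
    by (simp only: power_divide divide_divide_eq_left mult.commute)
  moreover have "2 * h / (4 * \<delta>) = h / (2 * \<delta>)" by simp
  ultimately have "(h / (2 * \<delta>)) ^ n / 2 \<le> real (card S)" by simp
  moreover have "\<exists>q r. p = rational_point q r \<and> 0 < q \<and> q \<le> m ^ n \<and> real m ^ n / 4 ^ Suc n \<le> real q" if "p \<in> S" for p
    using that S(2) unfolding P_def W_def by blast
  moreover have "\<forall>p\<in>S. \<forall>p'\<in>S. p \<noteq> p' \<longrightarrow> p' \<notin> cube p \<delta>"
    using S(3) by (auto simp: pairwise_def)
  moreover have "S \<subseteq> cube a (h + \<delta>)" using S(2) by (auto simp: P_def)
  ultimately show ?case
    using S(1) unfolding n_def[symmetric] \<delta>_def[symmetric] by blast
qed

section \<open>Choice of the scales\<close>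

lemma eventually_powr_ge:
  fixes b e B :: real
  assumes "0 < b" "0 < e"
  shows "\<forall>\<^sub>F m::nat in sequentially. B \<le> b * real m powr e"
proof -
  define x where "x = ((\<bar>B\<bar> + 1) / b) powr (1 / e)"
  have "\<forall>\<^sub>F m::nat in sequentially. x \<le> real m"
    using filterlim_real_sequentially by (simp add: filterlim_at_top)
  then show ?thesis
  proof eventually_elim
    case (elim m)
    have "x powr e \<le> real m powr e" using elim assms by (intro powr_mono2) (auto simp: x_def)
    moreover have "x powr e = (\<bar>B\<bar> + 1) / b" using assms by (simp add: x_def powr_powr)
    ultimately have "b * ((\<bar>B\<bar> + 1) / b) \<le> b * real m powr e" using assms by (intro mult_left_mono) auto
    then show ?case using assms by simp
  qed
qed

lemma eventually_powr_le:
  fixes b b' e e' :: real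
  assumes "0 < b" "e' < e"
  shows "\<forall>\<^sub>F m::nat in sequentially. b' * real m powr (- e) \<le> b * real m powr (- e')"
proof -
  have "\<forall>\<^sub>F m::nat in sequentially. b' \<le> b * real m powr (e - e')"
    by (rule eventually_powr_ge) (use assms in auto)
  then show ?thesis
  proof eventually_elim
    case (elim m)
    have "b' * real m powr (- e) \<le> (b * real m powr (e - e')) * real m powr (- e)"
      using elim by (intro mult_right_mono) auto
    also have "\<dots> = b * real m powr (- e')" by (simp add: mult.assoc flip: powr_add)
    finally show ?case .
  qed
qed

text \<open>If the denominators are at most \<open>m^n\<close> and the order of the block is at least a constant times
  \<open>m powr (n(n+1)/\<alpha>)\<close>, the size of the block at a resonance is at least a constant times
  \<open>m powr (n(n+1)/\<alpha> * (n/2 - s) - n^2/2)\<close>. The hypothesis on \<open>s\<close> says that this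
  exponent is positive.\<close>

lemma admissible_scale_eventually:
  fixes \<alpha> s X \<rho>' :: real and n j :: nat
  assumes n: "0 < n" and \<alpha>: "0 < \<alpha>" "\<alpha> \<le> real n" and s: "0 \<le> s"
    and s_less: "s < real n / (2 * (real n + 1)) * (real n + 1 - \<alpha>)"
    and X: "0 < X" and \<rho>': "0 < \<rho>'"
  shows "\<forall>\<^sub>F m in sequentially. \<forall>\<rho>>0. \<rho> \<le> X * real m powr (- (real n * (real n + 1) / \<alpha>)) \<longrightarrow>
           admissible_scale n s j \<rho>' \<rho> (m ^ n)"
proof -
  define \<beta> where "\<beta> = real n * (real n + 1) / \<alpha>"
  have \<beta>: "real n < \<beta>" "0 < \<beta>"
  proof -
    have "real n * \<alpha> < real n * (real n + 1)" using n \<alpha> by (intro mult_strict_left_mono) auto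
    then show "real n < \<beta>" using \<alpha> by (simp add: \<beta>_def field_simps)
    then show "0 < \<beta>" by linarith
  qed
  define e where "e = real n / 2 - s"
  have s_less': "2 * s * (real n + 1) < real n * (real n + 1 - \<alpha>)"
    using s_less by (simp add: field_simps)
  have e: "0 < e"
  proof -
    have "real n * (real n + 1 - \<alpha>) < real n * (real n + 1)" using n \<alpha> by (intro mult_strict_left_mono) auto
    then have "2 * s * (real n + 1) < real n * (real n + 1)" using s_less' by linarith
    then have "2 * s < real n" by (simp only: mult_less_cancel_right_pos[of "real n + 1"])
    then show ?thesis by (simp add: e_def)
  qed
  \<comment> \<open>This is where the upper bound for \<open>s\<close> enters.\<close>
  have exponent: "0 < \<beta> * e - (real n)\<^sup>2 / 2"
  proof -
    have "\<alpha> * (real n)\<^sup>2 < 2 * (real n * (real n + 1)) * e"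
    proof -
      have "real n * (2 * s * (real n + 1)) < real n * (real n * (real n + 1 - \<alpha>))"
        using s_less' n by (intro mult_strict_left_mono) auto
      then show ?thesis by (simp add: e_def algebra_simps power2_eq_square)
    qed
    then show ?thesis using \<alpha> by (simp add: \<beta>_def field_simps)
  qed
  define Y where "Y = 1 / (24 * X)"
  have Y: "0 < Y" using X by (simp add: Y_def)
  define D where "D = (1/2::real) ^ j * (1 / (4 * sqrt 2)) ^ n * Y powr e"
  have D: "0 < D" using Y by (simp add: D_def)
  have ev1: "\<forall>\<^sub>F m::nat in sequentially. max 1 (16 / \<rho>'\<^sup>2) \<le> Y * real m powr \<beta>"
    by (rule eventually_powr_ge[OF Y \<beta>(2)])
  have ev2: "\<forall>\<^sub>F m::nat in sequentially. 8 \<le> Y * real m powr (\<beta> - real n)"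
    by (rule eventually_powr_ge[OF Y]) (use \<beta> in simp)
  have ev3: "\<forall>\<^sub>F m::nat in sequentially. real j + 2 + 2 / \<rho>' ^ n \<le> D * real m powr (\<beta> * e - (real n)\<^sup>2 / 2)"
    by (rule eventually_powr_ge[OF D exponent])
  show ?thesis using ev1 ev2 ev3 eventually_gt_at_top[of 0]
  proof eventually_elim
    case (elim m)
    show ?case
    proof (intro allI impI)
      fix \<rho> :: real assume \<rho>: "0 < \<rho>" "\<rho> \<le> X * real m powr (- (real n * (real n + 1) / \<alpha>))"
      define K where "K = block_size \<rho>"
      \<comment> \<open>The constant \<open>24\<close> in \<open>Y\<close> is twice the constant in \<open>block_size\<close> and absorbs the rounding.\<close>
      have K_ge: "Y * real m powr \<beta> \<le> real K"
      proof -
        have "2 * (Y * real m powr \<beta>) = 1 / (12 * (X * real m powr (- \<beta>)))"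
          using elim(4) by (simp add: Y_def powr_minus field_simps)
        also have "\<dots> \<le> 1 / (12 * \<rho>)"
          using \<rho> elim(4) X by (intro divide_left_mono mult_left_mono) (auto simp: \<beta>_def)
        also have "\<dots> \<le> real K + 1"
          unfolding K_def block_size_def using \<rho>(1) by linarith
        finally show ?thesis using elim(1) by linarith
      qed
      have K_pos: "0 < real K" using K_ge elim(1) by linarith
      have c1: "8 * m ^ n \<le> K"
      proof -
        have "8 * real m ^ n \<le> (Y * real m powr (\<beta> - real n)) * real m ^ n"
          using elim(2) by (intro mult_right_mono) auto
        also have "\<dots> = Y * real m powr \<beta>"
          using elim(4) by (simp add: mult.assoc powr_realpow[symmetric] flip: powr_add)
        also have "\<dots> \<le> real K" by (rule K_ge)
        finally have "real (8 * m ^ n) \<le> real K" by simp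
        then show ?thesis by (simp only: of_nat_le_iff)
      qed
      have c2: "16 / \<rho>'\<^sup>2 \<le> real K" using K_ge elim(1) by linarith
      have split: "real K powr (- (real n / 2 + s)) * (real K / (4 * sqrt (2 * real (m ^ n)))) ^ n
          = (1 / (4 * sqrt 2)) ^ n * (real K powr e * real m powr (- ((real n)\<^sup>2 / 2)))"
      proof -
        have sq: "sqrt (2 * real (m ^ n)) = sqrt 2 * real m powr (real n / 2)"
        proof -
          have "sqrt (real (m ^ n)) = real m powr (real n / 2)"
            using elim(4) by (simp add: powr_half_sqrt[symmetric] powr_realpow[symmetric] powr_powr)
          then show ?thesis by (simp add: real_sqrt_mult)
        qed
        have "(real K / (4 * sqrt (2 * real (m ^ n)))) ^ n = (1 / (4 * sqrt 2) * (real K * real m powr (- (real n / 2)))) ^ n"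
          unfolding sq by (simp add: powr_minus field_simps)
        also have "\<dots> = (1 / (4 * sqrt 2)) ^ n * (real K ^ n * (real m powr (- (real n / 2))) ^ n)"
          by (simp only: power_mult_distrib)
        also have "real K ^ n = real K powr real n" using K_pos by (simp add: powr_realpow)
        also have "(real m powr (- (real n / 2))) ^ n = real m powr (- ((real n)\<^sup>2 / 2))"
          using elim(4) by (simp add: powr_powr power2_eq_square flip: powr_realpow)
        finally have "real K powr (- (real n / 2 + s)) * (real K / (4 * sqrt (2 * real (m ^ n)))) ^ n
            = (1 / (4 * sqrt 2)) ^ n * ((real K powr (- (real n / 2 + s)) * real K powr real n) * real m powr (- ((real n)\<^sup>2 / 2)))"
          by (simp only: mult_ac)
        also have "real K powr (- (real n / 2 + s)) * real K powr real n = real K powr e"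
          unfolding powr_add[symmetric] e_def by (intro arg_cong[of _ _ "(powr) (real K)"]) (simp add: field_simps)
        finally show ?thesis .
      qed
      have "D * real m powr (\<beta> * e - (real n)\<^sup>2 / 2)
          = (1/2) ^ j * ((1 / (4 * sqrt 2)) ^ n * ((Y * real m powr \<beta>) powr e * real m powr (- ((real n)\<^sup>2 / 2))))"
      proof -
        have "real m powr (\<beta> * e - (real n)\<^sup>2 / 2) = real m powr (\<beta> * e) * real m powr (- ((real n)\<^sup>2 / 2))"
          by (simp flip: powr_add)
        moreover have "(Y * real m powr \<beta>) powr e = Y powr e * real m powr (\<beta> * e)"
          by (simp only: powr_mult powr_powr)
        ultimately show ?thesis by (simp only: D_def mult_ac)
      qed
      also have "\<dots> \<le> (1/2) ^ j * ((1 / (4 * sqrt 2)) ^ n * (real K powr e * real m powr (- ((real n)\<^sup>2 / 2))))"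
        using K_ge Y e by (intro mult_left_mono mult_right_mono powr_mono2) auto
      finally have c3: "real j + 2 + 2 / \<rho>' ^ n
          \<le> (1/2) ^ j * real K powr (- (real n / 2 + s)) * (real K / (4 * sqrt (2 * real (m ^ n)))) ^ n"
        using elim(3) unfolding mult.assoc split by linarith
      show "admissible_scale n s j \<rho>' \<rho> (m ^ n)"
        unfolding admissible_scale_def K_def[symmetric] using c1 c2 c3 elim(4) by simp
    qed
  qed
qed

lemma spacing_eq: "0 < m \<Longrightarrow> spacing n m = 2 * pi * 4 ^ Suc n * real m powr (- (real n + 1))"
proof -
  assume "0 < m"
  then have "real m powr real (Suc n) = real m ^ Suc n" by (intro powr_realpow) simp
  moreover have "real n + 1 = real (Suc n)" by simp
  ultimately have "real m powr (- (real n + 1)) = 1 / real m ^ Suc n"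
    by (simp only: powr_minus_divide)
  then show ?thesis by (simp only: spacing_def power_divide) simp
qed

lemma spacing_eventually_le:
  assumes "0 < b" shows "\<forall>\<^sub>F m in sequentially. spacing n m \<le> b"
proof -
  have "\<forall>\<^sub>F m::nat in sequentially. 2 * pi * 4 ^ Suc n * real m powr (- (real n + 1)) \<le> b * real m powr (- 0)"
    by (rule eventually_powr_le[OF assms]) simp
  then show ?thesis using eventually_gt_at_top[of 0]
    by eventually_elim (simp add: spacing_eq)
qed

text \<open>A set of diameter \<open>D\<close> lies in a cube of side \<open>2 D\<close>.\<close>

lemma hausdorff_measure_pos_of_lebesgue:
  fixes A :: "(real ^ 'd::finite) set"
  assumes "A \<in> sets lborel" "0 < emeasure lborel A"
  shows "0 < hausdorff_measure (real CARD('d)) A"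
proof (rule hausdorff_measure_posI[of "emeasure lborel A / ennreal (2 ^ CARD('d))"])
  show "0 < emeasure lborel A / ennreal (2 ^ CARD('d))"
    using assms(2) by (simp only: ennreal_zero_less_divide ennreal_less_top simp_thms)
  fix U :: "nat \<Rightarrow> (real ^ 'd) set"
  assume cover: "A \<subseteq> (\<Union>i. U i)" and bdd: "\<And>i. bounded (U i)"
  have D: "0 \<le> diameter (U i)" for i by (rule diameter_ge_0[OF bdd])
  define V where "V i = (if U i = {} then {} else cube (SOME x. x \<in> U i) (diameter (U i)))" for i
  have UV: "U i \<subseteq> V i" for i
  proof
    fix y assume y: "y \<in> U i"
    then have x: "(SOME x. x \<in> U i) \<in> U i" by (rule someI)
    have "\<bar>y $ l - (SOME x. x \<in> U i) $ l\<bar> \<le> diameter (U i)" for l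
      using component_le_norm_cart[of "y - (SOME x. x \<in> U i)" l] diameter_bounded_bound[OF bdd y x]
      by (simp add: dist_norm)
    then show "y \<in> V i" using y by (auto simp: V_def cube_def)
  qed
  have V_sets: "V i \<in> sets lborel" for i
    unfolding V_def using fmeasurableD[OF cube_fmeasurable] by auto
  have V: "emeasure lborel (V i) \<le> ennreal (2 ^ CARD('d)) * diameter_power (real CARD('d)) (U i)" for i
  proof (cases "U i = {}")
    case False
    have "emeasure lborel (V i) = ennreal ((2 * diameter (U i)) ^ CARD('d))"
      using False D[of i] by (simp add: V_def emeasure_eq_measure2[OF cube_fmeasurable] measure_cube)
    also have "\<dots> = ennreal (2 ^ CARD('d) * diameter (U i) powr real CARD('d))"
      using D[of i] by (simp add: power_mult_distrib powr_realpow' )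
    finally show ?thesis using False D[of i] by (simp add: diameter_power_def ennreal_mult)
  qed (simp add: V_def)
  have "emeasure lborel A \<le> emeasure lborel (\<Union>i. V i)"
    using cover UV V_sets by (intro emeasure_mono) blast+
  also have "\<dots> \<le> (\<Sum>i. emeasure lborel (V i))"
    using V_sets by (intro emeasure_subadditive_countably) auto
  also have "\<dots> \<le> (\<Sum>i. ennreal (2 ^ CARD('d)) * diameter_power (real CARD('d)) (U i))"
    by (intro suminf_le V summableI)
  also have "\<dots> = ennreal (2 ^ CARD('d)) * (\<Sum>i. diameter_power (real CARD('d)) (U i))"
    by (rule ennreal_suminf_cmult)
  finally show "emeasure lborel A / ennreal (2 ^ CARD('d)) \<le> (\<Sum>i. diameter_power (real CARD('d)) (U i))"
    by (subst (asm) mult.commute, intro divide_le_posI_ennreal) (simp_all only: ennreal_less_zero_iff zero_less_power zero_less_numeral)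
qed

section \<open>A Cantor set of resonant points\<close>

lemma half_power_mult: "x ^ n / 2 * y ^ n = (x * y) ^ n / (2::real)"
  by (simp add: power_mult_distrib)

text \<open>The components are the centres of the balls of a stage, their radius, their separation
  and the largest denominator in use.\<close>

type_synonym 'd stage = "(real ^ 'd) set \<times> real \<times> real \<times> nat"

text \<open>The factor \<open>1/12\<close> is the radius of the initial ball, for which \<open>block_size\<close> equals one;
  the halving in each step makes the radii tend to zero.\<close>

definition valid_stage :: "real \<Rightarrow> nat \<Rightarrow> 'd::finite stage \<Rightarrow> bool" where
  "valid_stage \<alpha> j = (\<lambda>(T, \<rho>, \<delta>, Q). finite T \<and> T \<noteq> {} \<and> 0 < \<rho> \<and> \<rho> \<le> (1/2) ^ j / 12 \<and> 2 * \<rho> < \<delta> \<and>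
     (\<forall>x\<in>T. \<forall>y\<in>T. x \<noteq> y \<longrightarrow> \<delta> \<le> dist x y) \<and> real (card T) * \<rho> powr \<alpha> = (1/12) powr \<alpha>)"

text \<open>The requirements of a uniform Cantor set on consecutive stages, together with the admissibility of
  the new scale and the resonance of the new balls.\<close>

definition branching :: "real \<Rightarrow> nat \<Rightarrow> 'd::finite stage \<Rightarrow> 'd stage \<Rightarrow> bool" where
  "branching s j = (\<lambda>(T, \<rho>, \<delta>, Q) (T', \<rho>', \<delta>', Q').
     \<rho>' \<le> \<rho> \<and> (\<forall>c\<in>T'. \<exists>b\<in>T. cball c \<rho>' \<subseteq> cball b \<rho>) \<and>
     (\<forall>b\<in>T. card (T' \<inter> cball b \<rho>) * card T \<le> card T') \<and>
     (1 / (16 * real CARD('d))) ^ CARD('d) / 2 * (\<rho> / \<delta>') ^ CARD('d) * real (card T) \<le> real (card T') \<and>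
     admissible_scale CARD('d) s (Suc j) \<rho> \<rho>' Q' \<and>
     (\<forall>c\<in>T'. \<forall>x\<in>cball c \<rho>'. resonant (Suc j) Q' \<rho>' x))"

text \<open>Shifting the centre of a ball of radius \<open>\<rho>\<close> by \<open>2 \<rho>\<close> in every coordinate keeps the whole ball
  away from the rational point.\<close>

lemma resonant_near_rational_point:
  fixes x :: "real ^ 'd::finite"
  assumes "L \<le> q" "0 < q" "q \<le> Q" "x \<in> cube (rational_point q r + (\<chi> l. 2 * \<rho>)) \<rho>"
  shows "resonant L Q \<rho> x"
  unfolding resonant_def
proof (intro exI[of _ q] exI[of _ "\<lambda>l. r $ l"] conjI allI)
  fix l
  have "\<bar>x $ l - (2 * pi * of_int (r $ l) / real q + 2 * \<rho>)\<bar> \<le> \<rho>"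
    using assms(4) by (simp add: cube_def rational_point_def)
  then show "\<rho> \<le> x $ l - 2 * pi * of_int (r $ l) / real q" "x $ l - 2 * pi * of_int (r $ l) / real q \<le> 3 * \<rho>"
    by linarith+
qed (use assms in auto)

text \<open>Each ball receives the same number \<open>M\<close> of points of a rational net, and the new radius is
  determined by the requirement that the new number of points times its power \<open>\<alpha>\<close> is unchanged. As \<open>\<alpha>\<close> is
  less than the dimension, the new radius is much smaller than the separation of the net if \<open>m\<close> is large.\<close>

lemma branching_exists:
  fixes st :: "'d::finite stage" and \<alpha> s :: real
  assumes \<alpha>: "0 < \<alpha>" "\<alpha> < real CARD('d)" and s: "0 \<le> s"
    and s_less: "s < real CARD('d) / (2 * (real CARD('d) + 1)) * (real CARD('d) + 1 - \<alpha>)"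
    and st: "valid_stage \<alpha> j st"
  shows "\<exists>st'. valid_stage \<alpha> (Suc j) st' \<and> branching s j st st'"
proof -
  define n where "n = CARD('d)"
  have n: "0 < n" by (simp add: n_def)
  obtain T \<rho> \<delta> Q where st_eq: "st = (T, \<rho>, \<delta>, Q)" by (cases st)
  have finT: "finite T" and neT: "T \<noteq> {}" and \<rho>: "0 < \<rho>" "\<rho> \<le> (1/2) ^ j / 12" and \<delta>: "2 * \<rho> < \<delta>"
    and sepT: "\<And>x y. x \<in> T \<Longrightarrow> y \<in> T \<Longrightarrow> x \<noteq> y \<Longrightarrow> \<delta> \<le> dist x y"
    using st by (auto simp: valid_stage_def st_eq)
  have cardT: "0 < card T" using finT neT by (simp add: card_gt_0_iff)
  \<comment> \<open>Cubes of half-side \<open>2h\<close> lie in balls of radius \<open>\<rho>/4\<close>, which leaves room for the shift and for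
    the new balls.\<close>
  define h where "h = \<rho> / (8 * real n)"
  have h: "0 < h" using \<rho> n by (simp add: h_def)
  define \<beta> where "\<beta> = real n * (real n + 1) / \<alpha>"
  have \<beta>: "real n + 1 < \<beta>" "0 < \<beta>"
  proof -
    have "\<alpha> * (real n + 1) < real n * (real n + 1)" using \<alpha> by (intro mult_strict_right_mono) (auto simp: n_def)
    then show "real n + 1 < \<beta>" using \<alpha> by (simp add: \<beta>_def field_simps)
    then show "0 < \<beta>" by linarith
  qed
  define Y where "Y = (h / (4 * pi * 4 ^ Suc n)) ^ n / 2"
  have Y: "0 < Y" using h by (simp add: Y_def)
  define X where "X = 1/12 * (real (card T) * Y) powr (- (1 / \<alpha>))"
  have X: "0 < X" using cardT Y by (simp add: X_def)
  have ev_pts: "\<forall>\<^sub>F m in sequentially. \<forall>b\<in>T. \<exists>S. rational_net b (h + spacing n m) m S \<and>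
     (h / (2 * spacing n m)) ^ n / 2 \<le> real (card S)"
    unfolding n_def by (intro eventually_ball_finite finT ballI large_rational_net h)
  have ev_small: "\<forall>\<^sub>F m in sequentially. spacing n m \<le> h"
    by (rule spacing_eventually_le[OF h])
  have ev_radius: "\<forall>\<^sub>F m in sequentially. X * real m powr (- \<beta>) \<le> \<rho> / (16 * real n) * real m powr (- 0)"
    using \<rho> n \<beta> by (intro eventually_powr_le) auto
  have ev_gap: "\<forall>\<^sub>F m in sequentially. X * real m powr (- \<beta>) \<le> (2 * pi * 4 ^ Suc n / 3) * real m powr (- (real n + 1))"
    using \<beta> by (intro eventually_powr_le) auto
  have ev_adm: "\<forall>\<^sub>F m in sequentially. \<forall>\<rho>'>0. \<rho>' \<le> X * real m powr (- \<beta>) \<longrightarrow> admissible_scale n s (Suc j) \<rho> \<rho>' (m ^ n)"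
    unfolding \<beta>_def using \<alpha> s s_less n X \<rho> by (intro admissible_scale_eventually) (auto simp: n_def)
  have ev_denom: "\<forall>\<^sub>F m in sequentially. real (Suc j) \<le> (1 / 4 ^ Suc n) * real m powr real n"
    using n by (intro eventually_powr_ge) auto
  obtain m where m: "0 < m" and pts: "\<And>b. b \<in> T \<Longrightarrow> \<exists>S. rational_net b (h + spacing n m) m S \<and>
     (h / (2 * spacing n m)) ^ n / 2 \<le> real (card S)"
    and small: "spacing n m \<le> h" and radius: "X * real m powr (- \<beta>) \<le> \<rho> / (16 * real n)"
    and gap: "X * real m powr (- \<beta>) \<le> spacing n m / 3"
    and adm: "\<And>\<rho>'. 0 < \<rho>' \<Longrightarrow> \<rho>' \<le> X * real m powr (- \<beta>) \<Longrightarrow> admissible_scale n s (Suc j) \<rho> \<rho>' (m ^ n)"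
    and denom: "real (Suc j) \<le> real m ^ n / 4 ^ Suc n"
  proof -
    have "\<forall>\<^sub>F m in sequentially. thesis"
      using ev_pts ev_small ev_radius ev_gap ev_adm ev_denom eventually_gt_at_top[of 0]
    proof eventually_elim
      case (elim m)
      show ?case
        by (rule that[of m]) (use elim in \<open>auto simp: spacing_eq powr_realpow\<close>)
    qed
    then show thesis by simp
  qed
  define \<Delta> where "\<Delta> = spacing n m"
  have \<Delta>: "0 < \<Delta>" unfolding \<Delta>_def by (rule spacing_pos[OF m])
  define M where "M = nat \<lceil>(h / (2 * \<Delta>)) ^ n / 2\<rceil>"
  have M: "(h / (2 * \<Delta>)) ^ n / 2 \<le> real M" unfolding M_def by linarith
  have M_pos: "0 < M" using h \<Delta> by (simp add: M_def)
  have "\<forall>b\<in>T. \<exists>S. rational_net b (h + \<Delta>) m S \<and> card S = M"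
  proof
    fix b assume "b \<in> T"
    then obtain S where S: "rational_net b (h + \<Delta>) m S" "(h / (2 * \<Delta>)) ^ n / 2 \<le> real (card S)"
      using pts unfolding \<Delta>_def by blast
    have "M \<le> card S" unfolding M_def using S(2) by (simp add: ceiling_le_iff nat_le_iff)
    then obtain S' where "S' \<subseteq> S" "card S' = M" by (rule obtain_subset_with_card_n)
    then show "\<exists>S. rational_net b (h + \<Delta>) m S \<and> card S = M" using rational_net_subset[OF S(1)] by blast
  qed
  then obtain S where net: "\<And>b. b \<in> T \<Longrightarrow> rational_net b (h + \<Delta>) m (S b)" and card_S: "\<And>b. b \<in> T \<Longrightarrow> card (S b) = M"
    using bchoice[of T "\<lambda>b S. rational_net b (h + \<Delta>) m S \<and> card S = M"] by blast
  have S: "\<And>b. b \<in> T \<Longrightarrow> finite (S b)" "\<And>b. b \<in> T \<Longrightarrow> S b \<subseteq> cube b (h + \<Delta>)"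
    "\<And>b p. b \<in> T \<Longrightarrow> p \<in> S b \<Longrightarrow> \<exists>q r. p = rational_point q r \<and> 0 < q \<and> q \<le> m ^ n \<and> real m ^ n / 4 ^ Suc n \<le> real q"
    "\<And>b p p'. b \<in> T \<Longrightarrow> p \<in> S b \<Longrightarrow> p' \<in> S b \<Longrightarrow> p \<noteq> p' \<Longrightarrow> p' \<notin> cube p \<Delta>"
    using net unfolding rational_net_def n_def \<Delta>_def by blast+
  define \<rho>' where "\<rho>' = 1/12 * (real (card T) * real M) powr (- (1 / \<alpha>))"
  have \<rho>': "0 < \<rho>'" using cardT M_pos by (simp add: \<rho>'_def)
  have \<rho>'_le: "\<rho>' \<le> X * real m powr (- \<beta>)"
  proof -
    have "Y * real m powr (real n * (real n + 1)) = (h / (2 * \<Delta>)) ^ n / 2"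
    proof -
      define A where "A = h / (4 * pi * 4 ^ Suc n)"
      have "h / (2 * \<Delta>) = A * real m powr (real n + 1)"
        unfolding \<Delta>_def A_def spacing_eq[OF m] powr_minus_divide by (simp add: field_simps)
      then have "(h / (2 * \<Delta>)) ^ n = A ^ n * (real m powr (real n + 1)) ^ n"
        by (simp only: power_mult_distrib)
      moreover have "(real m powr (real n + 1)) ^ n = real m powr (real n * (real n + 1))"
        using m by (simp add: powr_powr mult.commute flip: powr_realpow)
      ultimately show ?thesis by (simp add: Y_def A_def)
    qed
    then have "real (card T) * Y * real m powr (real n * (real n + 1)) \<le> real (card T) * real M"
      using M by (simp add: mult.assoc mult_left_mono)
    moreover have "0 < real (card T) * Y * real m powr (real n * (real n + 1))" using cardT Y m by simp
    ultimately have "(real (card T) * real M) powr (- (1 / \<alpha>)) \<le> (real (card T) * Y * real m powr (real n * (real n + 1))) powr (- (1 / \<alpha>))"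
      using \<alpha> by (intro powr_mono2') auto
    also have "\<dots> = (real (card T) * Y) powr (- (1 / \<alpha>)) * real m powr (- \<beta>)"
      by (simp add: powr_mult powr_powr \<beta>_def)
    finally show ?thesis by (simp add: \<rho>'_def X_def)
  qed
  have \<rho>'_small: "\<rho>' \<le> \<rho> / (16 * real n)" "3 * \<rho>' \<le> \<Delta>"
    using \<rho>'_le radius gap by (simp_all add: \<Delta>_def)
  have \<rho>'_le_16: "\<rho>' \<le> \<rho> / 16"
  proof -
    have "\<rho> / (16 * real n) \<le> \<rho> / 16" using \<rho> n by (intro divide_left_mono) auto
    then show ?thesis using \<rho>'_small(1) by linarith
  qed
  define v :: "real ^ 'd" where "v = (\<chi> l. 2 * \<rho>')"
  have norm_v: "norm v \<le> \<rho> / 8"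
  proof -
    have "norm v \<le> real CARD('d) * (2 * \<rho>')" using \<rho>' by (intro norm_le_of_components) (simp add: v_def)
    also have "\<dots> \<le> real CARD('d) * (2 * (\<rho> / (16 * real n)))" using \<rho>'_small by (intro mult_left_mono) auto
    also have "\<dots> = \<rho> / 8" using n by (simp add: n_def)
    finally show ?thesis .
  qed
  define C where "C b = (\<lambda>p. p + v) ` S b" for b
  define T' where "T' = (\<Union>b\<in>T. C b)"
  have C_near: "dist b c \<le> 3 * \<rho> / 8" if b: "b \<in> T" and c: "c \<in> C b" for b c
  proof -
    obtain p where p: "p \<in> S b" "c = p + v" using c by (auto simp: C_def)
    have "p \<in> cube b (2 * h)" using S(2)[OF b] p(1) cube_mono[of "h + \<Delta>" "2 * h" b] small by (auto simp: \<Delta>_def)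
    then have "norm (p - b) \<le> real CARD('d) * (2 * h)" by (intro norm_le_of_components) (simp add: cube_def)
    also have "\<dots> = \<rho> / 4" using n by (simp add: h_def n_def)
    finally have "norm (p - b) \<le> \<rho> / 4" .
    moreover have "dist b c = norm ((p - b) + v)"
    proof -
      have "b - c = - ((p - b) + v)" by (simp add: p(2))
      then show ?thesis unfolding dist_norm by (simp only: norm_minus_cancel)
    qed
    moreover have "norm ((p - b) + v) \<le> norm (p - b) + norm v" by (rule norm_triangle_ineq)
    ultimately show ?thesis using norm_v by linarith
  qed
  have finC: "finite (C b)" "card (C b) = M" if "b \<in> T" for b
    using S(1)[OF that] card_S[OF that] by (auto simp: C_def card_image)
  have sep_diff: "\<rho> < dist c c'" if "b \<in> T" "b' \<in> T" "b \<noteq> b'" "c \<in> C b" "c' \<in> C b'" for b b' c c'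
  proof -
    have "\<delta> \<le> dist b b'" using sepT that by blast
    also have "\<dots> \<le> dist b c + dist c c' + dist b' c'"
      using dist_triangle[of b b' c] dist_triangle2[of c b' c'] by linarith
    finally show ?thesis using C_near[of b c] C_near[of b' c'] that \<delta> \<rho> by linarith
  qed
  have h_le: "h \<le> \<rho>"
  proof -
    have "\<rho> / (8 * real n) \<le> \<rho> / 1" using \<rho> n by (intro divide_left_mono) auto
    then show ?thesis by (simp add: h_def)
  qed
  have sepT': "\<Delta> \<le> dist c c'" if cc: "c \<in> T'" "c' \<in> T'" "c \<noteq> c'" for c c'
  proof -
    obtain b b' where b: "b \<in> T" "c \<in> C b" "b' \<in> T" "c' \<in> C b'" using cc by (auto simp: T'_def)
    show ?thesis
    proof (cases "b = b'")
      case True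
      obtain p p' where p: "p \<in> S b" "c = p + v" "p' \<in> S b" "c' = p' + v" using b True by (auto simp: C_def)
      then have "p' \<notin> cube p \<Delta>" using S(4)[OF b(1)] cc(3) by auto
      then obtain l where "\<Delta> < \<bar>p' $ l - p $ l\<bar>" by (auto simp: cube_def not_le)
      also have "\<dots> \<le> norm (p' - p)" using component_le_norm_cart[of "p' - p" l] by simp
      finally show ?thesis using p by (simp add: dist_norm norm_minus_commute)
    next
      case False
      then have "\<rho> < dist c c'" using sep_diff b by blast
      then show ?thesis using small h_le by (simp add: \<Delta>_def)
    qed
  qed
  have finT': "finite T'" unfolding T'_def using finT finC by blast
  have cardT': "card T' = card T * M"
  proof -
    have "C b \<inter> C b' = {}" if "b \<in> T" "b' \<in> T" "b \<noteq> b'" for b b'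
    proof (rule ccontr)
      assume "C b \<inter> C b' \<noteq> {}"
      then obtain x where "x \<in> C b" "x \<in> C b'" by blast
      then have "\<rho> < dist x x" by (rule sep_diff[OF that])
      then show False using \<rho> by simp
    qed
    then have "card T' = (\<Sum>b\<in>T. card (C b))" unfolding T'_def using finT finC by (intro card_UN_disjoint) auto
    then show ?thesis using finC by simp
  qed
  have T'_child: "cball c \<rho>' \<subseteq> cball b \<rho>" if "b \<in> T" "c \<in> C b" for b c
  proof
    fix x assume "x \<in> cball c \<rho>'"
    then have "dist b x \<le> 3 * \<rho> / 8 + \<rho>'" using dist_triangle[of b x c] C_near[OF that] by simp
    then show "x \<in> cball b \<rho>" using \<rho>'_le_16 \<rho> by simp
  qed
  have T'_cball: "T' \<inter> cball b \<rho> \<subseteq> C b" if b: "b \<in> T" for b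
  proof
    fix c assume c: "c \<in> T' \<inter> cball b \<rho>"
    then obtain b' where b': "b' \<in> T" "c \<in> C b'" by (auto simp: T'_def)
    have "b = b'"
    proof (rule ccontr)
      assume "b \<noteq> b'"
      then have "\<delta> \<le> dist b b'" using sepT b b' by blast
      then show False using dist_triangle2[of b b' c] C_near[OF b'] c \<delta> \<rho> by simp
    qed
    then show "c \<in> C b" using b' by simp
  qed
  define st' where "st' = (T', \<rho>', \<Delta>, m ^ n)"
  have "valid_stage \<alpha> (Suc j) st'"
  proof -
    have "\<rho>' \<le> (1/2) ^ Suc j / 12" using \<rho>'_le_16 \<rho> by simp
    moreover have "T' \<noteq> {}" using cardT' cardT M_pos by auto
    moreover have "real (card T') * \<rho>' powr \<alpha> = (1/12) powr \<alpha>"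
    proof -
      have "\<rho>' powr \<alpha> = (1/12) powr \<alpha> * (real (card T) * real M) powr (- 1)"
        using \<alpha> unfolding \<rho>'_def powr_mult powr_powr by simp
      then show ?thesis using cardT M_pos by (simp add: cardT' powr_minus field_simps)
    qed
    ultimately show ?thesis
      unfolding st'_def valid_stage_def using finT' \<rho>' \<rho>'_small sepT' by auto
  qed
  moreover have "branching s j st st'"
    unfolding st'_def st_eq branching_def prod.case
  proof (intro conjI ballI)
    show "\<rho>' \<le> \<rho>" using \<rho>'_le_16 \<rho> by linarith
    show "\<exists>b\<in>T. cball c \<rho>' \<subseteq> cball b \<rho>" if "c \<in> T'" for c
      using that T'_child unfolding T'_def by blast
    show "card (T' \<inter> cball b \<rho>) * card T \<le> card T'" if "b \<in> T" for b
    proof -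
      have "card (T' \<inter> cball b \<rho>) \<le> M" using card_mono[OF finC(1)[OF that] T'_cball[OF that]] finC(2)[OF that] by simp
      then show ?thesis unfolding cardT' mult.commute[of "card T"] by (rule mult_right_mono) simp
    qed
    show "(1 / (16 * real CARD('d))) ^ CARD('d) / 2 * (\<rho> / \<Delta>) ^ CARD('d) * real (card T) \<le> real (card T')"
    proof -
      have "(1 / (16 * real n)) ^ n / 2 * (\<rho> / \<Delta>) ^ n = (1 / (16 * real n) * (\<rho> / \<Delta>)) ^ n / 2"
        by (rule half_power_mult)
      also have "1 / (16 * real n) * (\<rho> / \<Delta>) = h / (2 * \<Delta>)" by (simp add: h_def)
      finally have "(1 / (16 * real n)) ^ n / 2 * (\<rho> / \<Delta>) ^ n \<le> real M" using M by simp
      then show ?thesis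
        unfolding cardT' n_def[symmetric] of_nat_mult mult.commute[of "real (card T)"] by (rule mult_right_mono) simp
    qed
    show "admissible_scale CARD('d) s (Suc j) \<rho> \<rho>' (m ^ n)" using adm[OF \<rho>' \<rho>'_le] by (simp add: n_def)
    show "resonant (Suc j) (m ^ n) \<rho>' x" if c: "c \<in> T'" "x \<in> cball c \<rho>'" for c x
    proof -
      obtain b p where p: "b \<in> T" "p \<in> S b" "c = p + v" using c(1) by (auto simp: T'_def C_def)
      obtain q r where q: "p = rational_point q r" "0 < q" "q \<le> m ^ n" "real m ^ n / 4 ^ Suc n \<le> real q"
        using S(3)[OF p(1,2)] by blast
      have "real (Suc j) \<le> real q" using denom q(4) by linarith
      then have "Suc j \<le> q" by (simp only: of_nat_le_iff)
      moreover have "x \<in> cube (rational_point q r + (\<chi> l. 2 * \<rho>')) \<rho>'"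
      proof -
        have "\<bar>x $ l - c $ l\<bar> \<le> \<rho>'" for l
          using component_le_norm_cart[of "x - c" l] c(2) by (simp add: dist_norm norm_minus_commute)
        then show ?thesis unfolding cube_def p(3) q(1) v_def by simp
      qed
      ultimately show ?thesis using q by (intro resonant_near_rational_point)
    qed
  qed
  ultimately show ?thesis by blast
qed

section \<open>Divergence sets of all dimensions\<close>

text \<open>The data from which a divergent datum for all points of \<open>A\<close> is built.\<close>

definition resonance_scheme :: "real \<Rightarrow> (nat \<Rightarrow> real) \<Rightarrow> (nat \<Rightarrow> nat) \<Rightarrow> (real ^ 'd) set \<Rightarrow> bool" where
  "resonance_scheme s \<rho> Q A \<longleftrightarrow> \<rho> 0 \<le> 1/12 \<and>
     (\<forall>j. 0 < \<rho> j \<and> \<rho> (Suc j) \<le> \<rho> j \<and> admissible_scale CARD('d) s (Suc j) (\<rho> j) (\<rho> (Suc j)) (Q (Suc j))) \<and>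
     (\<forall>x\<in>A. \<exists>\<^sub>\<infinity>j. resonant j (Q j) (\<rho> j) x)"

lemma resonance_schemeI:
  assumes "\<rho> 0 \<le> 1/12" "\<And>j. 0 < \<rho> j" "\<And>j. \<rho> (Suc j) \<le> \<rho> j"
    "\<And>j. admissible_scale CARD('d) s (Suc j) (\<rho> j) (\<rho> (Suc j)) (Q (Suc j))"
    "\<And>j x. x \<in> A \<Longrightarrow> \<exists>i>j. resonant i (Q i) (\<rho> i) x"
  shows "resonance_scheme s \<rho> Q (A :: (real ^ 'd::finite) set)"
  unfolding resonance_scheme_def INFM_nat using assms by blast

lemma resonance_datum_exists:
  fixes A :: "(real ^ 'd::finite) set"
  assumes s: "0 \<le> s" and scheme: "resonance_scheme s \<rho> Q A"
  shows "\<exists>f \<in> sobolev s. \<forall>x\<in>A.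
     Limsup (at 0 within schroedinger_times f (to_torus x)) (\<lambda>t. ereal (cmod (schroedinger t f (to_torus x)))) = \<infinity>"
proof -
  define K where "K j = block_size (\<rho> j)" for j
  define c where "c j = (1/2) ^ j * real (K j) powr (- (real CARD('d) / 2 + s))" for j
  define f :: "circle ^ 'd \<Rightarrow> complex" where "f = fejer_series c K"
  have \<rho>0: "\<rho> 0 \<le> 1/12" and \<rho>: "\<And>j. 0 < \<rho> j"
    and adm: "\<And>j. admissible_scale CARD('d) s (Suc j) (\<rho> j) (\<rho> (Suc j)) (Q (Suc j))"
    and inf: "\<And>x. x \<in> A \<Longrightarrow> \<exists>\<^sub>\<infinity>j. resonant j (Q j) (\<rho> j) x"
    using scheme unfolding resonance_scheme_def by blast+
  have dec: "decseq \<rho>" using scheme unfolding resonance_scheme_def decseq_Suc_iff by blast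
  have K_pos: "0 < K j" for j
  proof -
    have "\<rho> j \<le> 1/12" using decseqD[OF dec, of 0 j] \<rho>0 by simp
    then have "1 \<le> 1 / (12 * \<rho> j)" using \<rho>[of j] by simp
    then have "1 \<le> \<lfloor>1 / (12 * \<rho> j)\<rfloor>" by (simp add: le_floor_iff)
    then show ?thesis by (simp add: K_def block_size_def)
  qed
  interpret resonance c K s f \<rho> Q
  proof unfold_locales
    show "f = fejer_series c K" by (rule f_def)
    show "0 \<le> s" by (rule s)
    show "decseq \<rho>" by (rule dec)
    fix j
    show "0 < K j" by (rule K_pos)
    show "c j = (1/2) ^ j * real (K j) powr (- (real CARD('d) / 2 + s))" by (rule c_def)
    show "K j = block_size (\<rho> j)" by (rule K_def)
    show "0 < \<rho> j" by (rule \<rho>)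
    show "admissible_scale CARD('d) s (Suc j) (\<rho> j) (\<rho> (Suc j)) (Q (Suc j))" by (rule adm)
  qed
  show ?thesis using f_sobolev limsup_infinite inf by blast
qed

lemma dist_to_torus:
  fixes x y :: "real ^ 'd::finite"
  assumes "\<And>l. \<bar>x $ l - y $ l\<bar> \<le> pi"
  shows "dist (to_torus x) (to_torus y) = dist x y"
proof -
  have "dist (to_circle a) (to_circle b) = dist a b" if ab: "\<bar>a - b\<bar> \<le> pi" for a b
  proof -
    have "infdist (a - b) period_lattice = \<bar>a - b\<bar>"
    proof (rule antisym)
      show "infdist (a - b) period_lattice \<le> \<bar>a - b\<bar>"
        using infdist_le[OF period_lattice_0, of "a - b"] by simp
      obtain p where p: "p \<in> period_lattice" "infdist (a - b) period_lattice = dist (a - b) p"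
        using infdist_attains_inf[OF closed_period_lattice] period_lattice_0 by blast
      obtain m :: int where m: "p = 2 * pi * of_int m" using p(1) by (auto simp: period_lattice_def)
      have "\<bar>a - b\<bar> \<le> \<bar>a - b - p\<bar>"
      proof (cases "m = 0")
        case False
        then have "1 \<le> \<bar>real_of_int m\<bar>" by linarith
        then have "2 * pi * 1 \<le> 2 * pi * \<bar>real_of_int m\<bar>" by (intro mult_left_mono) auto
        then have "2 * pi \<le> \<bar>p\<bar>" by (simp add: m abs_mult)
        then show ?thesis using ab by linarith
      qed (simp add: m)
      then show "\<bar>a - b\<bar> \<le> infdist (a - b) period_lattice" by (simp add: p dist_real_def)
    qed
    moreover have "dist (to_circle a) (to_circle b) = infdist (a - b) period_lattice"
      by transfer simp
    ultimately show ?thesis by (simp add: dist_real_def)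
  qed
  then show ?thesis using assms by (simp add: dist_vec_def to_torus_def)
qed

lemma to_torus_isometric_on_cube:
  fixes A :: "(real ^ 'd::finite) set"
  assumes "A \<subseteq> cube 0 1" "x \<in> A" "y \<in> A"
  shows "dist (to_torus x) (to_torus y) = dist x y"
proof (rule dist_to_torus)
  fix l
  have "\<bar>x $ l\<bar> \<le> 1" "\<bar>y $ l\<bar> \<le> 1" using assms by (auto simp: cube_def)
  then show "\<bar>x $ l - y $ l\<bar> \<le> pi" using pi_gt3 by linarith
qed

lemma fractional_dimension_case:
  fixes \<alpha> s :: real
  assumes \<alpha>: "0 < \<alpha>" "\<alpha> < real CARD('d::finite)" and s: "0 \<le> s"
    and s_less: "s < real CARD('d) / (2 * (real CARD('d) + 1)) * (real CARD('d) + 1 - \<alpha>)"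
  shows "\<exists>\<rho> Q. \<exists>A \<subseteq> (cube 0 1 :: (real ^ 'd) set). resonance_scheme s \<rho> Q A \<and>
     0 < hausdorff_measure \<alpha> A \<and> (\<forall>\<beta>>\<alpha>. hausdorff_measure \<beta> A = 0)"
proof -
  have "\<exists>st :: nat \<Rightarrow> 'd stage. \<forall>j. (valid_stage \<alpha> j (st j) \<and> (j = 0 \<longrightarrow> fst (st j) = {0})) \<and> branching s j (st j) (st (Suc j))"
  proof (rule dependent_nat_choice)
    show "\<exists>x :: 'd stage. valid_stage \<alpha> 0 x \<and> (0 = (0::nat) \<longrightarrow> fst x = {0})"
      by (rule exI[of _ "({0}, 1/12, 1, 1)"]) (simp add: valid_stage_def)
    fix x :: "'d stage" and j :: nat assume "valid_stage \<alpha> j x \<and> (j = 0 \<longrightarrow> fst x = {0})"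
    then show "\<exists>y. (valid_stage \<alpha> (Suc j) y \<and> (Suc j = 0 \<longrightarrow> fst y = {0})) \<and> branching s j x y"
      using branching_exists[OF \<alpha> s s_less, of j x] by auto
  qed
  then obtain st :: "nat \<Rightarrow> 'd stage" where st0: "fst (st 0) = {0}" and valid: "\<And>j. valid_stage \<alpha> j (st j)"
    and branch: "\<And>j. branching s j (st j) (st (Suc j))" by blast
  define T where "T j = fst (st j)" for j
  define \<rho> where "\<rho> j = fst (snd (st j))" for j
  define \<delta> where "\<delta> j = fst (snd (snd (st j)))" for j
  define Q where "Q j = snd (snd (snd (st j)))" for j
  have st: "st j = (T j, \<rho> j, \<delta> j, Q j)" for j by (simp add: T_def \<rho>_def \<delta>_def Q_def)
  note valid' = valid[unfolded st valid_stage_def prod.case]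
  note branch' = branch[unfolded st branching_def prod.case]
  have \<rho>_le: "\<rho> j \<le> (1/2) ^ j / 12" for j using valid' by blast
  have \<rho>_lim: "\<rho> \<longlonglongrightarrow> 0"
  proof (rule tendsto_sandwich[of "\<lambda>_. 0" _ _ "\<lambda>j. (1/2) ^ j / 12"])
    show "(\<lambda>j. (1/2::real) ^ j / 12) \<longlonglongrightarrow> 0"
      by (intro tendsto_divide_zero LIMSEQ_power_zero) simp
    have "0 \<le> \<rho> j" for j using valid'[of j] by (elim conjE) (rule less_imp_le)
    then show "\<forall>\<^sub>F j in sequentially. 0 \<le> \<rho> j" "\<forall>\<^sub>F j in sequentially. \<rho> j \<le> (1/2) ^ j / 12"
      using \<rho>_le by simp_all
  qed simp
  have \<rho>_Suc: "\<rho> (Suc j) \<le> \<rho> j" for j by (rule conjunct1[OF branch'])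
  have \<rho>_dec: "decseq \<rho>" unfolding decseq_Suc_iff by (intro allI \<rho>_Suc)
  interpret uniform_cantor T \<rho> \<delta> \<alpha> "(1 / (16 * real CARD('d))) ^ CARD('d) / 2" "(1/12) powr \<alpha>"
  proof unfold_locales
    show "\<rho> \<longlonglongrightarrow> 0" by (rule \<rho>_lim)
    show "decseq \<rho>" by (rule \<rho>_dec)
    fix j
    show "finite (T j)" "T j \<noteq> {}" "0 < \<rho> j" "2 * \<rho> j < \<delta> j" "real (card (T j)) * \<rho> j powr \<alpha> = (1/12) powr \<alpha>"
      using valid'[of j] by blast+
    show "\<delta> j \<le> dist x y" if "x \<in> T j" "y \<in> T j" "x \<noteq> y" for x y using valid'[of j] that by blast
    show "\<exists>b\<in>T j. cball c (\<rho> (Suc j)) \<subseteq> cball b (\<rho> j)" if "c \<in> T (Suc j)" for c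
      using branch'[of j] that by blast
    show "card (T (Suc j) \<inter> cball b (\<rho> j)) * card (T j) \<le> card (T (Suc j))" if "b \<in> T j" for b
      using branch'[of j] that by blast
    show "(1 / (16 * real CARD('d))) ^ CARD('d) / 2 * (\<rho> j / \<delta> (Suc j)) ^ DIM(real ^ 'd) * real (card (T j)) \<le> real (card (T (Suc j)))"
      using branch'[of j] by simp
  qed (use \<alpha> in auto)
  have resonant: "resonant (Suc j) (Q (Suc j)) (\<rho> (Suc j)) x" if "x \<in> cantor_set" for j x
  proof -
    have "x \<in> E (Suc j)" using that unfolding cantor_set_def by blast
    then obtain c where "c \<in> T (Suc j)" "x \<in> cball c (\<rho> (Suc j))" unfolding E_def by blast
    then show ?thesis using branch'[of j] by blast
  qed
  have "cantor_set \<subseteq> cube 0 1"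
  proof
    fix x assume "x \<in> cantor_set"
    then have "x \<in> E 0" unfolding cantor_set_def by blast
    then have "norm x \<le> \<rho> 0" using st0 by (simp add: E_def T_def)
    then have "norm x \<le> 1" using \<rho>_le[of 0] by simp
    then have "\<bar>x $ l\<bar> \<le> 1" for l using component_le_norm_cart[of x l] by linarith
    then show "x \<in> cube 0 1" by (simp add: cube_def)
  qed
  moreover have "resonance_scheme s \<rho> Q cantor_set"
  proof (rule resonance_schemeI)
    fix j
    show "\<rho> 0 \<le> 1/12" using \<rho>_le[of 0] by simp
    show "0 < \<rho> j" using valid'[of j] by blast
    show "\<rho> (Suc j) \<le> \<rho> j" by (rule \<rho>_Suc)
    show "admissible_scale CARD('d) s (Suc j) (\<rho> j) (\<rho> (Suc j)) (Q (Suc j))" using branch'[of j] by blast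
    show "\<exists>i>j. resonant i (Q i) (\<rho> i) x" if "x \<in> cantor_set" for x
      using resonant[OF that] by blast
  qed
  ultimately show ?thesis
    using hausdorff_measure_cantor_set_pos hausdorff_measure_cantor_set_zero by blast
qed

text \<open>In the critical dimension the radius is comparable to the separation of the rational net, and the
  cubes around the net fill a fixed proportion of the unit cube.\<close>

lemma thick_stage_exists:
  fixes s \<rho> :: real and j :: nat
  assumes s: "0 \<le> s" "s < real CARD('d::finite) / (2 * (real CARD('d) + 1))" and \<rho>: "0 < \<rho>"
  shows "\<exists>\<rho>' Q'. \<exists>B \<subseteq> (cube 0 1 :: (real ^ 'd) set). 0 < \<rho>' \<and> \<rho>' \<le> \<rho> \<and> admissible_scale CARD('d) s (Suc j) \<rho> \<rho>' Q' \<and>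
    B \<in> fmeasurable lborel \<and> (1/16) ^ CARD('d) / 2 \<le> measure lborel B \<and> (\<forall>x\<in>B. resonant (Suc j) Q' \<rho>' x)"
proof -
  define n where "n = CARD('d)"
  have n: "0 < n" by (simp add: n_def)
  define X where "X = 2 * pi * 4 ^ Suc n / (4::real)"
  have X: "0 < X" by (simp add: X_def)
  have exp_eq: "real n * (real n + 1) / real n = real n + 1" using n by simp
  have ev_net: "\<forall>\<^sub>F m in sequentially. \<exists>S. rational_net (0::real^'d) (1/4 + spacing n m) m S \<and> (1/4 / (2 * spacing n m)) ^ n / 2 \<le> real (card S)"
    unfolding n_def by (rule large_rational_net) simp
  have ev_small: "\<forall>\<^sub>F m in sequentially. spacing n m \<le> min \<rho> (1/4)"
    using \<rho> by (intro spacing_eventually_le) simp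
  have ev_adm: "\<forall>\<^sub>F m in sequentially. \<forall>\<rho>'>0. \<rho>' \<le> X * real m powr (- (real n * (real n + 1) / real n)) \<longrightarrow> admissible_scale n s (Suc j) \<rho> \<rho>' (m ^ n)"
    using s \<rho> n X by (intro admissible_scale_eventually) (auto simp: n_def)
  have ev_denom: "\<forall>\<^sub>F m in sequentially. real (Suc j) \<le> (1 / 4 ^ Suc n) * real m powr real n"
    using n by (intro eventually_powr_ge) auto
  obtain m S where m: "0 < m" and net: "rational_net (0::real^'d) (1/4 + spacing n m) m S"
    and card_S: "(1/4 / (2 * spacing n m)) ^ n / 2 \<le> real (card S)" and small: "spacing n m \<le> \<rho>" "spacing n m \<le> 1/4"
    and adm: "\<And>\<rho>'. 0 < \<rho>' \<Longrightarrow> \<rho>' \<le> X * real m powr (- (real n + 1)) \<Longrightarrow> admissible_scale n s (Suc j) \<rho> \<rho>' (m ^ n)"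
    and denom: "real (Suc j) \<le> real m ^ n / 4 ^ Suc n"
  proof -
    have "\<forall>\<^sub>F m in sequentially. thesis"
      using ev_net ev_small ev_adm[unfolded exp_eq] ev_denom eventually_gt_at_top[of 0]
    proof eventually_elim
      case (elim m)
      from elim(1) obtain S where "rational_net (0::real^'d) (1/4 + spacing n m) m S" "(1/4 / (2 * spacing n m)) ^ n / 2 \<le> real (card S)"
        by blast
      then show ?case
        by (rule that[of m S, rotated 1]) (use elim in \<open>auto simp: powr_realpow\<close>)
    qed
    then show thesis by simp
  qed
  define \<Delta> where "\<Delta> = spacing n m"
  have \<Delta>: "0 < \<Delta>" unfolding \<Delta>_def by (rule spacing_pos[OF m])
  define \<rho>' where "\<rho>' = \<Delta> / 4"
  have \<rho>': "0 < \<rho>'" using \<Delta> by (simp add: \<rho>'_def)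
  define v :: "real ^ 'd" where "v = (\<chi> l. 2 * \<rho>')"
  define B where "B = (\<Union>p\<in>S. cube (p + v) \<rho>')"
  have S: "finite S" "S \<subseteq> cube 0 (1/4 + \<Delta>)"
    "\<And>p. p \<in> S \<Longrightarrow> \<exists>q r. p = rational_point q r \<and> 0 < q \<and> q \<le> m ^ n \<and> real m ^ n / 4 ^ Suc n \<le> real q"
    "\<And>p p'. p \<in> S \<Longrightarrow> p' \<in> S \<Longrightarrow> p \<noteq> p' \<Longrightarrow> p' \<notin> cube p \<Delta>"
    using net unfolding rational_net_def n_def \<Delta>_def by blast+
  have "B \<subseteq> cube 0 1"
  proof
    fix x assume "x \<in> B"
    then obtain p where p: "p \<in> S" "x \<in> cube (p + v) \<rho>'" unfolding B_def by blast
    show "x \<in> cube 0 1"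
      unfolding cube_def
    proof (clarify)
      fix l
      have "\<bar>p $ l\<bar> \<le> 1/4 + \<Delta>" using S(2) p(1) by (auto simp: cube_def)
      moreover have "\<bar>x $ l - (p $ l + 2 * \<rho>')\<bar> \<le> \<rho>'" using p(2) by (simp add: cube_def v_def)
      moreover have "4 * \<rho>' = \<Delta>" "\<Delta> \<le> 1/4" using small by (simp_all add: \<rho>'_def \<Delta>_def)
      ultimately show "\<bar>x $ l - 0 $ l\<bar> \<le> 1" using \<rho>' unfolding zero_index by linarith
    qed
  qed
  moreover have "B \<in> fmeasurable lborel"
    unfolding B_def by (intro fmeasurable.finite_UN S cube_fmeasurable)
  moreover have "(1/16) ^ CARD('d) / 2 \<le> measure lborel B"
  proof -
    have "disjoint_family_on (\<lambda>p. cube (p + v) \<rho>') S"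
      unfolding disjoint_family_on_def
    proof (intro ballI impI)
      fix p p' assume pp: "p \<in> S" "p' \<in> S" "p \<noteq> p'"
      then obtain l where l: "\<Delta> < \<bar>p' $ l - p $ l\<bar>" using S(4) by (force simp: cube_def not_le)
      show "cube (p + v) \<rho>' \<inter> cube (p' + v) \<rho>' = {}"
      proof (rule ccontr)
        assume "cube (p + v) \<rho>' \<inter> cube (p' + v) \<rho>' \<noteq> {}"
        then obtain x where "x \<in> cube (p + v) \<rho>'" "x \<in> cube (p' + v) \<rho>'" by blast
        then have "\<bar>x $ l - (p $ l + v $ l)\<bar> \<le> \<rho>'" "\<bar>x $ l - (p' $ l + v $ l)\<bar> \<le> \<rho>'" by (simp_all add: cube_def)
        moreover have "\<Delta> = 4 * \<rho>'" by (simp add: \<rho>'_def)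
        ultimately show False using l \<rho>' by linarith
      qed
    qed
    then have "measure lborel B = (\<Sum>p\<in>S. measure lborel (cube (p + v) \<rho>'))"
      unfolding B_def using S(1) fmeasurableD[OF cube_fmeasurable] fmeasurableD2[OF cube_fmeasurable]
      by (intro measure_finite_Union) auto
    also have "\<dots> = real (card S) * (2 * \<rho>') ^ n" using \<rho>' by (simp add: measure_cube n_def)
    also have "\<dots> \<ge> (1/4 / (2 * \<Delta>)) ^ n / 2 * (2 * \<rho>') ^ n"
      using card_S \<rho>' by (intro mult_right_mono) (auto simp: \<Delta>_def)
    also have "(1/4 / (2 * \<Delta>)) ^ n / 2 * (2 * \<rho>') ^ n = (1/4 / (2 * \<Delta>) * (2 * \<rho>')) ^ n / 2"
      by (rule half_power_mult)
    also have "1/4 / (2 * \<Delta>) * (2 * \<rho>') = 1/16" using \<Delta> by (simp add: \<rho>'_def)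
    finally show ?thesis by (simp add: n_def)
  qed
  moreover have "resonant (Suc j) (m ^ n) \<rho>' x" if "x \<in> B" for x
  proof -
    obtain p where p: "p \<in> S" "x \<in> cube (p + v) \<rho>'" using \<open>x \<in> B\<close> unfolding B_def by blast
    obtain q r where q: "p = rational_point q r" "0 < q" "q \<le> m ^ n" "real m ^ n / 4 ^ Suc n \<le> real q"
      using S(3)[OF p(1)] by blast
    have "real (Suc j) \<le> real q" using denom q(4) by linarith
    then have "Suc j \<le> q" by (simp only: of_nat_le_iff)
    then show ?thesis using q p(2) unfolding v_def by (intro resonant_near_rational_point) auto
  qed
  moreover have "admissible_scale CARD('d) s (Suc j) \<rho> \<rho>' (m ^ n)"
    using adm[OF \<rho>'] spacing_eq[OF m, of n] by (simp add: \<rho>'_def \<Delta>_def X_def n_def)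
  moreover have "\<rho>' \<le> \<rho>" using small \<Delta> by (simp add: \<rho>'_def \<Delta>_def)
  ultimately show ?thesis using \<rho>' by blast
qed

text \<open>The sets of points that are resonant at a given scale have measures bounded from below inside a
  fixed cube, hence so has their upper limit.\<close>

lemma full_dimension_case:
  fixes s :: real
  assumes s: "0 \<le> s" "s < real CARD('d::finite) / (2 * (real CARD('d) + 1))"
  shows "\<exists>\<rho> Q. \<exists>A \<subseteq> (cube 0 1 :: (real ^ 'd) set). resonance_scheme s \<rho> Q A \<and>
     0 < hausdorff_measure (real CARD('d)) A \<and> (\<forall>\<beta>>real CARD('d). hausdorff_measure \<beta> A = 0)"
proof -
  define good where "good j \<rho> st \<longleftrightarrow> (case st of (\<rho>', Q', B) \<Rightarrow> 0 < \<rho>' \<and> \<rho>' \<le> \<rho> \<and> admissible_scale CARD('d) s (Suc j) \<rho> \<rho>' Q' \<and>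
    B \<subseteq> cube 0 1 \<and> B \<in> fmeasurable lborel \<and> (1/16) ^ CARD('d) / 2 \<le> measure lborel B \<and> (\<forall>x\<in>B. resonant (Suc j) Q' \<rho>' x))"
    for j and \<rho> :: real and st :: "real \<times> nat \<times> (real ^ 'd) set"
  have "\<exists>st. \<forall>j. (0 < fst (st j) \<and> (j = 0 \<longrightarrow> fst (st j) = 1/12)) \<and> good j (fst (st j)) (st (Suc j))"
  proof (rule dependent_nat_choice)
    show "\<exists>x :: real \<times> nat \<times> (real ^ 'd) set. 0 < fst x \<and> (0 = (0::nat) \<longrightarrow> fst x = 1/12)"
      by (rule exI[of _ "(1/12, 0, {})"]) simp
    fix x :: "real \<times> nat \<times> (real ^ 'd) set" and j :: nat
    assume "0 < fst x \<and> (j = 0 \<longrightarrow> fst x = 1/12)"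
    then obtain \<rho>' Q' and B :: "(real ^ 'd) set" where "good j (fst x) (\<rho>', Q', B)"
      using thick_stage_exists[OF s, of "fst x" j] unfolding good_def by auto
    moreover from this have "0 < \<rho>'" by (simp add: good_def)
    ultimately show "\<exists>y. (0 < fst y \<and> (Suc j = 0 \<longrightarrow> fst y = 1/12)) \<and> good j (fst x) y"
      by (intro exI[of _ "(\<rho>', Q', B)"]) simp
  qed
  then obtain st where st0: "fst (st 0) = 1/12" and st_pos: "\<And>j. 0 < fst (st j)" and st_good: "\<And>j. good j (fst (st j)) (st (Suc j))"
    by blast
  define \<rho> where "\<rho> j = fst (st j)" for j
  define Q where "Q j = fst (snd (st j))" for j
  define B where "B j = snd (snd (st (Suc j)))" for j
  have st: "\<rho> (Suc j) \<le> \<rho> j" "admissible_scale CARD('d) s (Suc j) (\<rho> j) (\<rho> (Suc j)) (Q (Suc j))"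
    "B j \<subseteq> cube 0 1" "B j \<in> fmeasurable lborel" "(1/16) ^ CARD('d) / 2 \<le> measure lborel (B j)"
    "\<And>x. x \<in> B j \<Longrightarrow> resonant (Suc j) (Q (Suc j)) (\<rho> (Suc j)) x" for j
    using st_good[of j] unfolding good_def \<rho>_def Q_def B_def by (auto split: prod.splits)
  define U where "U N = (\<Union>j\<in>{N..}. B j)" for N
  define A where "A = (\<Inter>N. U N)"
  have sets_B: "B j \<in> sets lborel" for j by (rule fmeasurableD[OF st(4)])
  have sets_U: "U N \<in> sets lborel" for N unfolding U_def using sets_B by (intro sets.countable_UN') auto
  have sub: "U N \<subseteq> cube 0 1" for N unfolding U_def using st(3) by blast
  have emU: "emeasure lborel (U N) \<noteq> \<infinity>" for N
  proof -
    have "emeasure lborel (U N) \<le> emeasure lborel (cube (0::real^'d) 1)"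
      by (intro emeasure_mono sub fmeasurableD cube_fmeasurable)
    also have "\<dots> < \<infinity>" using fmeasurableD2[OF cube_fmeasurable[of "0::real^'d" 1]] by (simp add: less_top)
    finally show ?thesis by simp
  qed
  have lower: "ennreal ((1/16) ^ CARD('d) / 2) \<le> emeasure lborel (U N)" for N
  proof -
    have "ennreal ((1/16) ^ CARD('d) / 2) \<le> ennreal (measure lborel (B N))" by (rule ennreal_leI[OF st(5)])
    also have "\<dots> = emeasure lborel (B N)" by (rule emeasure_eq_measure2[OF st(4), symmetric])
    also have "\<dots> \<le> emeasure lborel (U N)" by (rule emeasure_mono[OF _ sets_U]) (auto simp: U_def)
    finally show ?thesis .
  qed
  have "decseq U"
    unfolding decseq_def
  proof (intro allI impI)
    fix M N :: nat assume "M \<le> N"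
    then show "U N \<subseteq> U M" unfolding U_def by (intro UN_mono) auto
  qed
  then have "(INF N. emeasure lborel (U N)) = emeasure lborel A"
    unfolding A_def using sets_U emU by (intro INF_emeasure_decseq) auto
  moreover have "ennreal ((1/16) ^ CARD('d) / 2) \<le> (INF N. emeasure lborel (U N))" by (intro INF_greatest lower)
  ultimately have "ennreal ((1/16) ^ CARD('d) / 2) \<le> emeasure lborel A" by simp
  moreover have "0 < ennreal ((1/16) ^ CARD('d) / 2)" by simp
  ultimately have "0 < emeasure lborel A" by (rule less_le_trans[rotated])
  moreover have "A \<in> sets lborel" unfolding A_def using sets_U by (intro sets.countable_INT') auto
  ultimately have pos: "0 < hausdorff_measure (real CARD('d)) A" by (intro hausdorff_measure_pos_of_lebesgue)
  have A_sub: "A \<subseteq> cube 0 1" unfolding A_def using sub by blast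
  have zero: "\<forall>\<beta>>real CARD('d). hausdorff_measure \<beta> A = 0"
  proof (intro allI impI hausdorff_measure_bounded_zero)
    show "bounded A" using A_sub bounded_cbox bounded_subset unfolding cube_eq_cbox by blast
  qed simp
  have "resonance_scheme s \<rho> Q A"
  proof (rule resonance_schemeI)
    fix j
    show "\<rho> 0 \<le> 1/12" by (simp add: \<rho>_def st0)
    show "0 < \<rho> j" using st_pos by (simp add: \<rho>_def)
    show "\<rho> (Suc j) \<le> \<rho> j" "admissible_scale CARD('d) s (Suc j) (\<rho> j) (\<rho> (Suc j)) (Q (Suc j))" by (rule st)+
    fix x assume "x \<in> A"
    then have "x \<in> U j" unfolding A_def by blast
    then obtain i where "j \<le> i" "x \<in> B i" unfolding U_def by auto
    then show "\<exists>i>j. resonant i (Q i) (\<rho> i) x" using st(6) by (intro exI[of _ "Suc i"]) auto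
  qed
  then show ?thesis using A_sub pos zero by blast
qed

theorem theorem1p1:
  fixes \<alpha> s d :: real
  assumes "d = real CARD('d::finite)"
    and "0 < \<alpha>" and "\<alpha> \<le> d" and "0 \<le> s"
    and "s < d / (2 * (d + 1)) * (d + 1 - \<alpha>)"
  shows "\<exists>f \<in> (sobolev s :: (circle ^ 'd \<Rightarrow> complex) set). \<exists>\<Gamma> :: (circle ^ 'd) set.
           hausdorff_dim \<Gamma> = ennreal \<alpha> \<and>
           (\<forall>x\<in>\<Gamma>. Limsup (at 0 within schroedinger_times f x)
                    (\<lambda>t. ereal (cmod (schroedinger t f x))) = \<infinity>) \<and>
           (\<alpha> = d \<longrightarrow> hausdorff_measure d \<Gamma> > 0)"
proof -
  have "\<exists>\<rho> Q. \<exists>A \<subseteq> (cube 0 1 :: (real ^ 'd) set). resonance_scheme s \<rho> Q A \<and>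
     0 < hausdorff_measure \<alpha> A \<and> (\<forall>\<beta>>\<alpha>. hausdorff_measure \<beta> A = 0)"
  proof (cases "\<alpha> = d")
    case True
    then have "s < real CARD('d) / (2 * (real CARD('d) + 1))" using assms(1,5) by simp
    then show ?thesis using full_dimension_case[OF assms(4)] True assms(1) by simp
  next
    case False
    then show ?thesis using assms by (intro fractional_dimension_case) auto
  qed
  then obtain \<rho> Q A where A: "A \<subseteq> (cube 0 1 :: (real ^ 'd) set)" and scheme: "resonance_scheme s \<rho> Q A"
    and pos: "0 < hausdorff_measure \<alpha> A" and zero: "\<And>\<beta>. \<alpha> < \<beta> \<Longrightarrow> hausdorff_measure \<beta> A = 0"
    by blast
  obtain f :: "circle ^ 'd \<Rightarrow> complex" where f: "f \<in> sobolev s"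
    and diverges: "\<And>x. x \<in> A \<Longrightarrow>
      Limsup (at 0 within schroedinger_times f (to_torus x)) (\<lambda>t. ereal (cmod (schroedinger t f (to_torus x)))) = \<infinity>"
    using resonance_datum_exists[OF assms(4) scheme] by blast
  have measure_eq: "hausdorff_measure \<beta> (to_torus ` A) = hausdorff_measure \<beta> A" if "0 \<le> \<beta>" for \<beta>
    using that to_torus_isometric_on_cube[OF A] by (intro hausdorff_measure_isometric_image) auto
  have pos': "0 < hausdorff_measure \<alpha> (to_torus ` A)" using pos assms(2) by (simp add: measure_eq)
  have "hausdorff_dim (to_torus ` A) = ennreal \<alpha>"
  proof (rule hausdorff_dim_eqI[OF _ pos'])
    show "hausdorff_measure \<beta> (to_torus ` A) = 0" if "\<alpha> < \<beta>" for \<beta>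
      using zero[OF that] measure_eq[of \<beta>] that assms(2) by simp
  qed (use assms(2) in simp)
  moreover have "\<forall>x\<in>to_torus ` A. Limsup (at 0 within schroedinger_times f x) (\<lambda>t. ereal (cmod (schroedinger t f x))) = \<infinity>"
    using diverges by blast
  ultimately show ?thesis using f pos' by blast
qed

end
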